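(* Let $\pi: M_8\to\mathcal{B}_4$ be a Lagrangian torus bundle (real dimension $8$, fibres $T^4$, base of dimension $4$), equipped with a semi-flat $SU(4)$-structure $(J,\Omega)$ with conformal factor $1$, where $J$ is the symplectic form for which the fibres are Lagrangian. Suppose that $(J,\Omega)$, together with real functions $\mathsf{A},\phi,\vartheta$, a positive function $\alpha$, a real three-form $H$ and a real odd polyform $F=F_1+F_3+F_5+F_7$ on $M_8$, satisfies the symplectic supersymmetric system. Write the almost complex structure of $\Omega$ in local action-angle coordinates through the frame of $(1,0)$-forms $\zeta^j=d\theta^j+a^j{}_k(r)\,dr^k+i\rho^j{}_k(r)\,dr^k$ with $a,\rho$ real, and suppose that the connection is flat, i.e. $$\partial_{[j}a^l{}_{k]}=0 .$$ Then there exists $(J_A,\Omega_A,K_A,\rho_A)$ satisfying the LTY 2A system on $M_8$ with respect to the real polarization induced by the torus fibration.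
   Context: **$SU(n)$-structure.** An $SU(n)$-structure with conformal factor $K$ (a nowhere vanishing function) on a $2n$-manifold is a pair $(J,\Omega)$, with $J$ a real positive-definite two-form and $\Omega$ a complex nowhere vanishing decomposable $n$-form, such that $J\wedge\Omega=0$ and $\frac1{2^n}\Omega\wedge\Omega^*=\frac{i^n}{n!}KJ^n$. $\Omega$ determines an almost complex structure for which $\Omega$ is of type $(n,0)$ and $J$ is of type $(1,1)$, and $J$ together with it determines a Riemannian metric. Here $n=4$. **Torsion classes and flux decomposition.** For an $SU(4)$-structure with conformal factor $1$, $$dJ=W_1\lrcorner\Omega^*+W_3+W_4\wedge J+\text{c.c.},\qquad d\Omega=\tfrac{8i}{3}W_1\wedge J\wedge J+W_2\wedge J+W_5^*\wedge\Omega,$$ with $W_1,W_4,W_5$ of type $(1,0)$ and $W_2,W_3$ primitive of type $(2,1)$. A real three-form decomposes as $F_3=f_3^{(2,1)}+f_3^{(1,0)}\wedge J+\tilde f_3^{(1,0)}\lrcorner\Omega^*+\text{c.c.}$, with $f_3^{(2,1)}$ primitive of type $(2,1)$ and $f_3^{(1,0)},\tilde f_3^{(1,0)}$ of type $(1,0)$; $\lrcorner$ is contraction using the metric. $\partial u$ denotes the $(1,0)$-part of $du$. **Symplectic supersymmetric system.** $$W_1=W_3=W_4=0,\quad W_2=-2i\,e^{\phi-i\vartheta}f_3^{(2,1)},\quad W_5=\partial\mathsf{A}=\tfrac12\partial\phi=2\,\partial\log\alpha=2e^{\phi+i\vartheta}\tilde f_3^{(1,0)},$$ $$F_1=F_5=F_7=H=0,\quad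 f_3^{(1,0)}=0,\quad \partial\vartheta=0 .$$ **Torus bundle conventions.** Singular fibres are not allowed. Locally there are action-angle coordinates $(r^j,\theta^j)$, $j=1,\dots,4$, with $r^j$ coordinates on the base, $\theta^j$ coordinates on the torus fibres and $J=d\theta^j\wedge dr^j$; changes of base coordinates are affine with linear part assumed to lie in $SL(4,\mathbb Z)$. A form is fibre-invariant if its coefficients in the frame $dr^j,d\theta^j$ depend only on $r$. The $SU(4)$-structure is semi-flat if $J$ and $\Omega$ are fibre-invariant. For a semi-flat structure, the almost complex structure has a local frame of $(1,0)$-forms of the form $\zeta^j=d\theta^j+a^j{}_kdr^k+i\rho^j{}_kdr^k$, with $a,\rho$ real symmetric matrices depending only on $r$ and $\rho$ invertible. Put $\delta\theta^j=d\theta^j+a^j{}_kdr^k$. **Polarization and projections.** The polarization induced by the fibration is given by $\mathcal D^*=\mathrm{span}\{dr^1,\dots,dr^4\}$ and $\mathcal D^{*\perp}=\mathrm{span}\{\delta\theta^1,\dots,\delta\theta^4\}$, so $T^*M_8=\mathcal D^*\oplus\mathcal D^{*\perp}$. $\pi_{\mathcal D}^{a,b}$ denotes the projection of forms onto those with $a$ legs in $\mathcal D^*$ and $b$ legs in $\mathcal D^{*\perp}$. **LTY 2A system ($n=4$).** $(J_A,\Omega_A)$ is an $SU(4)$-structure with conformal factor $K_A$, i.e. $\frac1{2^4}\Omega_A\wedge\Omega_A^*=\frac1{4!}K_AJ_A^4$ and $J_A\wedge\Omega_A=0$, such that $$dJ_A=0,\qquad d\big(\pi_{\mathcal D}^{0,4}+\pi_{\mathcal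 D}^{3,1}\big)\Omega_A=0,$$ and $\rho_A$ is the form defined by $\rho_A:=-i\,d\,d^{\mathcal D}\big(K_A(\pi_{\mathcal D}^{1,3}+\pi_{\mathcal D}^{4,0})\Omega_A\big)$, where $d^{\mathcal D}$ is a fixed first-order differential operator attached to the polarization. The last equation is only the definition of $\rho_A$ and imposes no condition. *)

theory Defs
  imports "HOL-Analysis.Analysis"
begin

section \<open>Smooth maps and smooth manifolds\<close>

primrec Ck_on :: "nat \<Rightarrow> 'a::real_normed_vector set \<Rightarrow> ('a \<Rightarrow> 'b::real_normed_vector) \<Rightarrow> bool" where
  "Ck_on 0 S f \<longleftrightarrow> continuous_on S f"
| "Ck_on (Suc k) S f \<longleftrightarrow>
     (\<forall>x\<in>S. f differentiable at x) \<and>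
     (\<forall>v. Ck_on k S (\<lambda>x. frechet_derivative f (at x) v))"

definition smooth_on :: "'a::real_normed_vector set \<Rightarrow> ('a \<Rightarrow> 'b::real_normed_vector) \<Rightarrow> bool" where
  "smooth_on S f \<longleftrightarrow> (\<forall>k. Ck_on k S f)"

text \<open>A chart is given by its inverse, a local parametrization: the pair \<open>(U, x)\<close> is a
  homeomorphism \<open>x\<close> from an open subset \<open>U\<close> of the model space onto an open subset of the
  manifold. The manifold is the whole type \<open>'m\<close>.\<close>

type_synonym ('e, 'm) chart = "'e set \<times> ('e \<Rightarrow> 'm)"

fun is_chart :: "('e::euclidean_space, 'm::topological_space) chart \<Rightarrow> bool" where
  "is_chart (U, x) \<longleftrightarrow>
     open U \<and> open (x ` U) \<and> inj_on x U \<and> homeomorphism U (x ` U) x (inv_into U x)"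

fun transition :: "('e, 'm) chart \<Rightarrow> ('e, 'm) chart \<Rightarrow> 'e \<Rightarrow> 'e" where
  "transition (U, x) (U', x') = inv_into U' x' \<circ> x"

definition overlap :: "('e, 'm) chart \<Rightarrow> ('e, 'm) chart \<Rightarrow> 'e set" where
  "overlap c c' = {u \<in> fst c. snd c u \<in> snd c' ` fst c'}"

definition chart_jacobian :: "('e::euclidean_space, 'm) chart \<Rightarrow> ('e, 'm) chart \<Rightarrow> 'e \<Rightarrow> 'e \<Rightarrow> 'e" where
  "chart_jacobian c c' u = frechet_derivative (transition c c') (at u)"

definition smoothly_compatible ::
    "('e::euclidean_space, 'm) chart \<Rightarrow> ('e, 'm) chart \<Rightarrow> bool" where
  "smoothly_compatible c c' \<longleftrightarrow>
     smooth_on (overlap c c') (transition c c') \<and> smooth_on (overlap c' c) (transition c' c)"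

text \<open>A smooth structure is a maximal smooth atlas.\<close>

definition smooth_structure :: "('e::euclidean_space, 'm::topological_space) chart set \<Rightarrow> bool" where
  "smooth_structure \<A> \<longleftrightarrow>
     (\<forall>c\<in>\<A>. is_chart c) \<and>
     (\<forall>m. \<exists>(U, x)\<in>\<A>. m \<in> x ` U) \<and>
     (\<forall>c\<in>\<A>. \<forall>c'\<in>\<A>. smoothly_compatible c c') \<and>
     (\<forall>c. is_chart c \<and> (\<forall>c'\<in>\<A>. smoothly_compatible c c') \<longrightarrow> c \<in> \<A>)"

definition smooth_fun ::
    "('e::euclidean_space, 'm) chart set \<Rightarrow> ('m \<Rightarrow> 'b::real_normed_vector) \<Rightarrow> bool" where
  "smooth_fun \<A> h \<longleftrightarrow> (\<forall>(U, x)\<in>\<A>. smooth_on U (h \<circ> x))"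


section \<open>Complex exterior algebra of a real vector space\<close>

text \<open>A complex-valued (in general inhomogeneous) form is a function on lists of real vectors; its
  value on lists of length \<open>k\<close> is its part of degree \<open>k\<close>.\<close>

type_synonym 'v form = "'v list \<Rightarrow> complex"

definition alternating :: "'v::real_vector form \<Rightarrow> bool" where
  "alternating \<omega> \<longleftrightarrow>
     (\<forall>us vs. linear (\<lambda>v. \<omega> (us @ v # vs))) \<and>
     (\<forall>us vs ws v. \<omega> (us @ v # vs @ v # ws) = 0)"

definition has_degree :: "nat \<Rightarrow> 'v form \<Rightarrow> bool" where
  "has_degree k \<omega> \<longleftrightarrow> (\<forall>vs. length vs \<noteq> k \<longrightarrow> \<omega> vs = 0)"

definition degree_part :: "nat \<Rightarrow> 'v form \<Rightarrow> 'v form" where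
  "degree_part k \<omega> vs = (if length vs = k then \<omega> vs else 0)"

definition real_form :: "'v form \<Rightarrow> bool" where
  "real_form \<omega> \<longleftrightarrow> (\<forall>vs. Im (\<omega> vs) = 0)"

definition conj_form :: "'v form \<Rightarrow> 'v form" where
  "conj_form \<omega> vs = cnj (\<omega> vs)"

text \<open>Sum over shuffles without combinatorial factor: \<open>(\<alpha> \<and> \<beta>)(v, w) = \<alpha>(v) \<beta>(w) - \<alpha>(w) \<beta>(v)\<close>
  for one-forms. The set \<open>S\<close> consists of the positions that are fed into the first factor.\<close>

definition shuffle_sign :: "nat set \<Rightarrow> nat \<Rightarrow> complex" where
  "shuffle_sign S n = (-1) ^ card {(i, j). i \<in> S \<and> j \<in> {..<n} - S \<and> j < i}"

definition wedge :: "'v form \<Rightarrow> 'v form \<Rightarrow> 'v form" where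
  "wedge \<alpha> \<beta> vs =
     (\<Sum>S\<in>Pow {..<length vs}. shuffle_sign S (length vs) * \<alpha> (nths vs S) * \<beta> (nths vs (- S)))"

definition unit_form :: "'v form" where
  "unit_form vs = (if vs = [] then 1 else 0)"

definition wedge_list :: "'v form list \<Rightarrow> 'v form" where
  "wedge_list \<alpha>s = foldr wedge \<alpha>s unit_form"

definition wedge_power :: "'v form \<Rightarrow> nat \<Rightarrow> 'v form" where
  "wedge_power \<alpha> k = wedge_list (replicate k \<alpha>)"

definition one_form :: "('v \<Rightarrow> complex) \<Rightarrow> 'v form" where
  "one_form l vs = (if length vs = 1 then l (hd vs) else 0)"

definition is_one_form :: "'v::real_vector form \<Rightarrow> bool" where
  "is_one_form \<alpha> \<longleftrightarrow> has_degree 1 \<alpha> \<and> linear (\<lambda>v. \<alpha> [v])"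

definition decomposable :: "nat \<Rightarrow> 'v::real_vector form \<Rightarrow> bool" where
  "decomposable n \<omega> \<longleftrightarrow>
     (\<exists>\<zeta>s. length \<zeta>s = n \<and> (\<forall>\<zeta>\<in>set \<zeta>s. is_one_form \<zeta>) \<and> \<omega> = wedge_list \<zeta>s)"

definition almost_complex :: "('v::real_vector \<Rightarrow> 'v) \<Rightarrow> bool" where
  "almost_complex I \<longleftrightarrow> linear I \<and> (\<forall>v. I (I v) = - v)"

definition form10 :: "('v::real_vector \<Rightarrow> 'v) \<Rightarrow> 'v form \<Rightarrow> bool" where
  "form10 I \<alpha> \<longleftrightarrow> is_one_form \<alpha> \<and> (\<forall>v. \<alpha> [I v] = \<i> * \<alpha> [v])"

definition form01 :: "('v::real_vector \<Rightarrow> 'v) \<Rightarrow> 'v form \<Rightarrow> bool" where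
  "form01 I \<alpha> \<longleftrightarrow> is_one_form \<alpha> \<and> (\<forall>v. \<alpha> [I v] = - \<i> * \<alpha> [v])"

text \<open>Forms of type \<open>(p, q)\<close>: the complex span of products of \<open>p\<close> forms of type \<open>(1, 0)\<close> and
  \<open>q\<close> forms of type \<open>(0, 1)\<close>.\<close>

inductive pq_type :: "('v::real_vector \<Rightarrow> 'v) \<Rightarrow> nat \<Rightarrow> nat \<Rightarrow> 'v form \<Rightarrow> bool"
  for I p q where
  zero: "pq_type I p q (\<lambda>vs. 0)"
| product: "\<lbrakk>length \<alpha>s = p; length \<beta>s = q; \<forall>\<alpha>\<in>set \<alpha>s. form10 I \<alpha>; \<forall>\<beta>\<in>set \<beta>s. form01 I \<beta>\<rbrakk>
     \<Longrightarrow> pq_type I p q (wedge_list (\<alpha>s @ \<beta>s))"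
| add: "pq_type I p q \<alpha> \<Longrightarrow> pq_type I p q \<beta> \<Longrightarrow> pq_type I p q (\<lambda>vs. \<alpha> vs + \<beta> vs)"
| scale: "pq_type I p q \<alpha> \<Longrightarrow> pq_type I p q (\<lambda>vs. c * \<alpha> vs)"

definition part10 :: "('v::real_vector \<Rightarrow> 'v) \<Rightarrow> 'v form \<Rightarrow> 'v form" where
  "part10 I \<alpha> = one_form (\<lambda>v. (\<alpha> [v] - \<i> * \<alpha> [I v]) / 2)"

text \<open>The almost complex structure for which the \<open>n\<close>-form \<open>\<Omega>\<close> is of type \<open>(n, 0)\<close>; it is unique
  when \<open>\<Omega>\<close> is decomposable and \<open>\<Omega> \<and> \<Omega>\<^sup>* \<noteq> 0\<close>.\<close>

definition acs :: "nat \<Rightarrow> 'v::real_vector form \<Rightarrow> 'v \<Rightarrow> 'v" where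
  "acs n \<Omega> = (THE I. almost_complex I \<and> pq_type I n 0 \<Omega>)"

text \<open>The sign is such that \<open>J = (\<i>/2) \<Sum> \<zeta>\<^sup>j \<and> (\<zeta>\<^sup>j)\<^sup>*\<close>, with \<open>\<zeta>\<^sup>j\<close> a frame of \<open>(1,0)\<close>-forms, gives
  a positive-definite metric.\<close>

definition metric :: "'v form \<Rightarrow> ('v \<Rightarrow> 'v) \<Rightarrow> 'v \<Rightarrow> 'v \<Rightarrow> real" where
  "metric J I v w = Re (J [v, I w])"

definition sharp :: "('v \<Rightarrow> 'v \<Rightarrow> real) \<Rightarrow> ('v \<Rightarrow> real) \<Rightarrow> 'v" where
  "sharp g l = (THE v. \<forall>w. g v w = l w)"

text \<open>Contraction of a form with a complex one-form, whose index is raised complex-linearly.\<close>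

definition contract :: "('v \<Rightarrow> 'v \<Rightarrow> real) \<Rightarrow> 'v form \<Rightarrow> 'v form \<Rightarrow> 'v form" where
  "contract g \<alpha> \<omega> vs =
     \<omega> (sharp g (\<lambda>w. Re (\<alpha> [w])) # vs) + \<i> * \<omega> (sharp g (\<lambda>w. Im (\<alpha> [w])) # vs)"

text \<open>For a \<open>k\<close>-form in real dimension \<open>2 n\<close>: \<open>J\<^bsup>n-k+1\<^esup> \<and> \<alpha> = 0\<close>, which for \<open>k \<le> n\<close> means that the
  contraction of \<open>\<alpha>\<close> with \<open>J\<close> vanishes.\<close>

definition primitive :: "nat \<Rightarrow> nat \<Rightarrow> 'v form \<Rightarrow> 'v form \<Rightarrow> bool" where
  "primitive n k J \<alpha> \<longleftrightarrow> (\<forall>vs. wedge (wedge_power J (n + 1 - k)) \<alpha> vs = 0)"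

definition plus_cc :: "'v form \<Rightarrow> 'v form" where
  "plus_cc \<alpha> vs = \<alpha> vs + cnj (\<alpha> vs)"


section \<open>Differential forms\<close>

text \<open>A differential form on a manifold is the family of its local expressions in all charts of the
  smooth structure. The values at \<open>c \<notin> \<A>\<close> or outside the domain of a chart are irrelevant.\<close>

type_synonym ('e, 'm) dform = "('e, 'm) chart \<Rightarrow> 'e \<Rightarrow> 'e form"

definition everywhere :: "('e, 'm) chart set \<Rightarrow> (('e, 'm) chart \<Rightarrow> 'e \<Rightarrow> bool) \<Rightarrow> bool" where
  "everywhere \<A> P \<longleftrightarrow> (\<forall>c\<in>\<A>. \<forall>u\<in>fst c. P c u)"

definition diff_form :: "('e::euclidean_space, 'm) chart set \<Rightarrow> ('e, 'm) dform \<Rightarrow> bool" where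
  "diff_form \<A> \<omega> \<longleftrightarrow>
     everywhere \<A> (\<lambda>c u. alternating (\<omega> c u)) \<and>
     (\<forall>c\<in>\<A>. \<forall>vs. smooth_on (fst c) (\<lambda>u. \<omega> c u vs)) \<and>
     (\<forall>c\<in>\<A>. \<forall>c'\<in>\<A>. \<forall>u\<in>overlap c c'. \<forall>vs.
        \<omega> c u vs = \<omega> c' (transition c c' u) (map (chart_jacobian c c' u) vs))"

definition diff_form_deg :: "('e::euclidean_space, 'm) chart set \<Rightarrow> nat \<Rightarrow> ('e, 'm) dform \<Rightarrow> bool" where
  "diff_form_deg \<A> k \<omega> \<longleftrightarrow> diff_form \<A> \<omega> \<and> everywhere \<A> (\<lambda>c u. has_degree k (\<omega> c u))"

definition form_eq :: "('e, 'm) chart set \<Rightarrow> ('e, 'm) dform \<Rightarrow> ('e, 'm) dform \<Rightarrow> bool" where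
  "form_eq \<A> \<omega> \<eta> \<longleftrightarrow> everywhere \<A> (\<lambda>c u. \<omega> c u = \<eta> c u)"

definition zero_dform :: "('e, 'm) dform" where
  "zero_dform c u vs = 0"

definition add_dform :: "('e, 'm) dform \<Rightarrow> ('e, 'm) dform \<Rightarrow> ('e, 'm) dform" where
  "add_dform \<omega> \<eta> c u vs = \<omega> c u vs + \<eta> c u vs"

definition scale_dform :: "('m \<Rightarrow> complex) \<Rightarrow> ('e, 'm) dform \<Rightarrow> ('e, 'm) dform" where
  "scale_dform h \<omega> c u vs = h (snd c u) * \<omega> c u vs"

definition fun_dform :: "('m \<Rightarrow> complex) \<Rightarrow> ('e, 'm) dform" where
  "fun_dform h c u vs = h (snd c u) * unit_form vs"

text \<open>\<open>(d\<omega>)(v\<^sub>0, \<dots>, v\<^sub>k)\<close> is the alternating sum of the derivatives of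
  \<open>\<omega>(v\<^sub>0, \<dots>, v\<^sub>k)\<close>, \<open>v\<^sub>i\<close> omitted, in the direction of \<open>v\<^sub>i\<close>; the \<open>v\<^sub>i\<close> are constant in the
  coordinates of the chart.\<close>

definition ext_d :: "('e::euclidean_space, 'm) dform \<Rightarrow> ('e, 'm) dform" where
  "ext_d \<omega> c u vs =
     (\<Sum>i<length vs. (-1) ^ i *
        frechet_derivative (\<lambda>z. \<omega> c z (take i vs @ drop (Suc i) vs)) (at u) (vs ! i))"

definition closed_dform :: "('e::euclidean_space, 'm) chart set \<Rightarrow> ('e, 'm) dform \<Rightarrow> bool" where
  "closed_dform \<A> \<omega> \<longleftrightarrow> form_eq \<A> (ext_d \<omega>) zero_dform"

text \<open>First-order differential operators on forms: linear operators \<open>D\<close> with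
  \<open>[[D, f], g] = 0\<close> for all smooth functions \<open>f\<close> and \<open>g\<close>.\<close>

definition first_order_operator ::
    "('e::euclidean_space, 'm) chart set \<Rightarrow> (('e, 'm) dform \<Rightarrow> ('e, 'm) dform) \<Rightarrow> bool" where
  "first_order_operator \<A> D \<longleftrightarrow>
     (\<forall>\<omega>. diff_form \<A> \<omega> \<longrightarrow> diff_form \<A> (D \<omega>)) \<and>
     (\<forall>\<omega> \<eta>. diff_form \<A> \<omega> \<longrightarrow> diff_form \<A> \<eta> \<longrightarrow> form_eq \<A> \<omega> \<eta> \<longrightarrow> form_eq \<A> (D \<omega>) (D \<eta>)) \<and>
     (\<forall>\<omega> \<eta>. diff_form \<A> \<omega> \<longrightarrow> diff_form \<A> \<eta> \<longrightarrow>
        form_eq \<A> (D (add_dform \<omega> \<eta>)) (add_dform (D \<omega>) (D \<eta>))) \<and>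
     (\<forall>k \<omega>. diff_form \<A> \<omega> \<longrightarrow>
        form_eq \<A> (D (scale_dform (\<lambda>m. k) \<omega>)) (scale_dform (\<lambda>m. k) (D \<omega>))) \<and>
     (\<forall>f g \<omega>. smooth_fun \<A> f \<longrightarrow> smooth_fun \<A> g \<longrightarrow> diff_form \<A> \<omega> \<longrightarrow>
        form_eq \<A>
          (add_dform (D (scale_dform (\<lambda>m. f m * g m) \<omega>)) (scale_dform (\<lambda>m. f m * g m) (D \<omega>)))
          (add_dform (scale_dform f (D (scale_dform g \<omega>))) (scale_dform g (D (scale_dform f \<omega>)))))"


section \<open>\<open>SU(n)\<close>-structures and the symplectic supersymmetric system\<close>

definition SU_structure_at :: "nat \<Rightarrow> real \<Rightarrow> 'v::real_vector form \<Rightarrow> 'v form \<Rightarrow> bool" where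
  "SU_structure_at n K J \<Omega> \<longleftrightarrow>
     decomposable n \<Omega> \<and> (\<exists>vs. \<Omega> vs \<noteq> 0) \<and>
     (\<forall>v. v \<noteq> 0 \<longrightarrow> metric J (acs n \<Omega>) v v > 0) \<and>
     (\<forall>vs. wedge J \<Omega> vs = 0) \<and>
     (\<forall>vs. 1 / 2 ^ n * wedge \<Omega> (conj_form \<Omega>) vs =
           \<i> ^ n / fact n * complex_of_real K * wedge_power J n vs)"

definition SU_structure ::
    "('e::euclidean_space, 'm) chart set \<Rightarrow> nat \<Rightarrow> ('m \<Rightarrow> real) \<Rightarrow> ('e, 'm) dform \<Rightarrow> ('e, 'm) dform \<Rightarrow> bool" where
  "SU_structure \<A> n K J \<Omega> \<longleftrightarrow>
     DIM('e) = 2 * n \<and>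
     smooth_fun \<A> K \<and> (\<forall>m. K m \<noteq> 0) \<and>
     diff_form_deg \<A> 2 J \<and> everywhere \<A> (\<lambda>c u. real_form (J c u)) \<and>
     diff_form_deg \<A> n \<Omega> \<and>
     everywhere \<A> (\<lambda>c u. SU_structure_at n (K (snd c u)) (J c u) (\<Omega> c u))"

definition torsion_classes ::
    "('e::euclidean_space, 'm) chart set \<Rightarrow> ('e, 'm) dform \<Rightarrow> ('e, 'm) dform \<Rightarrow>
     ('e, 'm) dform \<Rightarrow> ('e, 'm) dform \<Rightarrow> ('e, 'm) dform \<Rightarrow> ('e, 'm) dform \<Rightarrow> ('e, 'm) dform \<Rightarrow> bool" where
  "torsion_classes \<A> J \<Omega> W1 W2 W3 W4 W5 \<longleftrightarrow>
     diff_form \<A> W1 \<and> diff_form \<A> W2 \<and> diff_form \<A> W3 \<and> diff_form \<A> W4 \<and> diff_form \<A> W5 \<and>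
     everywhere \<A> (\<lambda>c u. let I = acs 4 (\<Omega> c u); g = metric (J c u) I in
       pq_type I 1 0 (W1 c u) \<and> pq_type I 1 0 (W4 c u) \<and> pq_type I 1 0 (W5 c u) \<and>
       pq_type I 2 1 (W2 c u) \<and> primitive 4 3 (J c u) (W2 c u) \<and>
       pq_type I 2 1 (W3 c u) \<and> primitive 4 3 (J c u) (W3 c u) \<and>
       ext_d J c u = plus_cc (\<lambda>vs. contract g (W1 c u) (conj_form (\<Omega> c u)) vs
                                   + W3 c u vs + wedge (W4 c u) (J c u) vs) \<and>
       ext_d \<Omega> c u = (\<lambda>vs. 8 * \<i> / 3 * wedge (W1 c u) (wedge (J c u) (J c u)) vs
                               + wedge (W2 c u) (J c u) vs
                               + wedge (conj_form (W5 c u)) (\<Omega> c u) vs))"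

definition flux_decomposition ::
    "('e::euclidean_space, 'm) chart set \<Rightarrow> ('e, 'm) dform \<Rightarrow> ('e, 'm) dform \<Rightarrow>
     ('e, 'm) dform \<Rightarrow> ('e, 'm) dform \<Rightarrow> ('e, 'm) dform \<Rightarrow> ('e, 'm) dform \<Rightarrow> bool" where
  "flux_decomposition \<A> J \<Omega> F3 f21 f10 ft10 \<longleftrightarrow>
     diff_form \<A> f21 \<and> diff_form \<A> f10 \<and> diff_form \<A> ft10 \<and>
     everywhere \<A> (\<lambda>c u. let I = acs 4 (\<Omega> c u); g = metric (J c u) I in
       pq_type I 2 1 (f21 c u) \<and> primitive 4 3 (J c u) (f21 c u) \<and>
       pq_type I 1 0 (f10 c u) \<and> pq_type I 1 0 (ft10 c u) \<and>
       F3 c u = plus_cc (\<lambda>vs. f21 c u vs + wedge (f10 c u) (J c u) vs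
                              + contract g (ft10 c u) (conj_form (\<Omega> c u)) vs))"

definition del :: "('e::euclidean_space, 'm) dform \<Rightarrow> ('m \<Rightarrow> real) \<Rightarrow> ('e, 'm) dform" where
  "del \<Omega> h c u = part10 (acs 4 (\<Omega> c u)) (ext_d (fun_dform (\<lambda>m. complex_of_real (h m))) c u)"

definition degree_part_dform :: "nat \<Rightarrow> ('e, 'm) dform \<Rightarrow> ('e, 'm) dform" where
  "degree_part_dform k \<omega> c u = degree_part k (\<omega> c u)"

definition symplectic_susy_system ::
    "('e::euclidean_space, 'm) chart set \<Rightarrow> ('e, 'm) dform \<Rightarrow> ('e, 'm) dform \<Rightarrow>
     ('m \<Rightarrow> real) \<Rightarrow> ('m \<Rightarrow> real) \<Rightarrow> ('m \<Rightarrow> real) \<Rightarrow> ('m \<Rightarrow> real) \<Rightarrow>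
     ('e, 'm) dform \<Rightarrow> ('e, 'm) dform \<Rightarrow> bool" where
  "symplectic_susy_system \<A> J \<Omega> A \<phi> vartheta \<alpha> H F \<longleftrightarrow>
     (\<exists>W1 W2 W3 W4 W5 f21 f10 ft10.
        torsion_classes \<A> J \<Omega> W1 W2 W3 W4 W5 \<and>
        flux_decomposition \<A> J \<Omega> (degree_part_dform 3 F) f21 f10 ft10 \<and>
        form_eq \<A> W1 zero_dform \<and> form_eq \<A> W3 zero_dform \<and> form_eq \<A> W4 zero_dform \<and>
        form_eq \<A> W2 (scale_dform (\<lambda>m. - 2 * \<i> * exp (complex_of_real (\<phi> m) - \<i> * complex_of_real (vartheta m))) f21) \<and>
        form_eq \<A> W5 (del \<Omega> A) \<and>
        form_eq \<A> W5 (scale_dform (\<lambda>m. 1 / 2) (del \<Omega> \<phi>)) \<and>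
        form_eq \<A> W5 (scale_dform (\<lambda>m. 2) (del \<Omega> (\<lambda>m. ln (\<alpha> m)))) \<and>
        form_eq \<A> W5 (scale_dform (\<lambda>m. 2 * exp (complex_of_real (\<phi> m) + \<i> * complex_of_real (vartheta m))) ft10) \<and>
        form_eq \<A> (degree_part_dform 1 F) zero_dform \<and>
        form_eq \<A> (degree_part_dform 5 F) zero_dform \<and>
        form_eq \<A> (degree_part_dform 7 F) zero_dform \<and>
        form_eq \<A> H zero_dform \<and>
        form_eq \<A> f10 zero_dform \<and>
        form_eq \<A> (del \<Omega> vartheta) zero_dform)"


section \<open>Lagrangian torus bundles and action-angle coordinates\<close>

text \<open>The model space of the total space consists of the pairs \<open>(r, \<theta>)\<close> of base and fibre
  coordinates.\<close>

type_synonym model = "(real^4) \<times> (real^4)"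

text \<open>A torus coordinate system \<open>(D, y, p)\<close> consists of a base chart \<open>y\<close> on \<open>D\<close> and of a map \<open>p\<close>
  onto the part of the bundle above \<open>y ` D\<close>; the \<open>\<theta>\<^sup>j\<close> are angles, i.e. \<open>p\<close> is
  \<open>2\<pi>\<close>-periodic in each of them and descends to a trivialization with fibre \<open>T\<^sup>4\<close>. Restricting the
  angles to a ball of radius \<open>\<pi>\<close> gives charts of the total space.\<close>

type_synonym ('b, 'm) torus_coords = "(real^4) set \<times> ((real^4) \<Rightarrow> 'b) \<times> (model \<Rightarrow> 'm)"

fun tc_dom :: "('b, 'm) torus_coords \<Rightarrow> (real^4) set" where "tc_dom (D, y, p) = D"
fun tc_base :: "('b, 'm) torus_coords \<Rightarrow> (real^4) \<Rightarrow> 'b" where "tc_base (D, y, p) = y"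
fun tc_map :: "('b, 'm) torus_coords \<Rightarrow> model \<Rightarrow> 'm" where "tc_map (D, y, p) = p"

definition tc_chart :: "('b, 'm) torus_coords \<Rightarrow> real^4 \<Rightarrow> (model, 'm) chart" where
  "tc_chart q \<theta>0 = (tc_dom q \<times> ball \<theta>0 pi, tc_map q)"

definition is_torus_coords ::
    "(model, 'm::topological_space) chart set \<Rightarrow> (real^4, 'b::topological_space) chart set \<Rightarrow>
     ('m \<Rightarrow> 'b) \<Rightarrow> ('b, 'm) torus_coords \<Rightarrow> bool" where
  "is_torus_coords \<A> \<B> prj q \<longleftrightarrow>
     (tc_dom q, tc_base q) \<in> \<B> \<and>
     (\<forall>\<theta>0. tc_chart q \<theta>0 \<in> \<A>) \<and>
     (\<forall>r\<in>tc_dom q. range (\<lambda>\<theta>. tc_map q (r, \<theta>)) = prj -` {tc_base q r}) \<and>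
     (\<forall>r\<in>tc_dom q. \<forall>\<theta> \<theta>'. tc_map q (r, \<theta>) = tc_map q (r, \<theta>') \<longleftrightarrow>
        (\<forall>i. \<exists>k::int. (\<theta> - \<theta>') $ i = 2 * pi * real_of_int k))"

definition torus_bundle ::
    "(model, 'm::topological_space) chart set \<Rightarrow> (real^4, 'b::topological_space) chart set \<Rightarrow>
     ('m \<Rightarrow> 'b) \<Rightarrow> bool" where
  "torus_bundle \<A> \<B> prj \<longleftrightarrow>
     smooth_structure \<A> \<and> smooth_structure \<B> \<and>
     (\<forall>b. \<exists>q. is_torus_coords \<A> \<B> prj q \<and> b \<in> tc_base q ` tc_dom q)"

text \<open>The tangent vector \<open>v\<close>, in the chart \<open>c\<close> at \<open>u\<close>, is tangent to the fibre.\<close>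

definition vertical ::
    "(real^4, 'b) chart set \<Rightarrow> ('m \<Rightarrow> 'b) \<Rightarrow> (model, 'm) chart \<Rightarrow> model \<Rightarrow> model \<Rightarrow> bool" where
  "vertical \<B> prj c u v \<longleftrightarrow>
     (\<forall>(V, y)\<in>\<B>. prj (snd c u) \<in> y ` V \<longrightarrow>
        frechet_derivative (inv_into V y \<circ> prj \<circ> snd c) (at u) v = 0)"

definition symplectic :: "('e::euclidean_space, 'm) chart set \<Rightarrow> ('e, 'm) dform \<Rightarrow> bool" where
  "symplectic \<A> J \<longleftrightarrow>
     diff_form_deg \<A> 2 J \<and> everywhere \<A> (\<lambda>c u. real_form (J c u)) \<and> closed_dform \<A> J \<and>
     everywhere \<A> (\<lambda>c u. \<forall>v. v \<noteq> 0 \<longrightarrow> (\<exists>w. J c u [v, w] \<noteq> 0))"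

text \<open>The fibres have half the dimension of the total space, so they are Lagrangian if \<open>J\<close> vanishes
  on them.\<close>

definition lagrangian_torus_bundle ::
    "(model, 'm::topological_space) chart set \<Rightarrow> (real^4, 'b::topological_space) chart set \<Rightarrow>
     ('m \<Rightarrow> 'b) \<Rightarrow> (model, 'm) dform \<Rightarrow> bool" where
  "lagrangian_torus_bundle \<A> \<B> prj J \<longleftrightarrow>
     torus_bundle \<A> \<B> prj \<and> symplectic \<A> J \<and>
     everywhere \<A> (\<lambda>c u. \<forall>v w. vertical \<B> prj c u v \<longrightarrow> vertical \<B> prj c u w \<longrightarrow> J c u [v, w] = 0)"

definition d_r :: "4 \<Rightarrow> model form" where
  "d_r j = one_form (\<lambda>v. complex_of_real (fst v $ j))"

definition d_theta :: "4 \<Rightarrow> model form" where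
  "d_theta j = one_form (\<lambda>v. complex_of_real (snd v $ j))"

text \<open>The local expression of a form in torus coordinates, for all values of the angles.\<close>

definition in_coords :: "(model, 'm) dform \<Rightarrow> ('b, 'm) torus_coords \<Rightarrow> model \<Rightarrow> model form" where
  "in_coords \<omega> q u = \<omega> (tc_chart q (snd u)) u"

definition action_angle ::
    "(model, 'm::topological_space) chart set \<Rightarrow> (real^4, 'b::topological_space) chart set \<Rightarrow>
     ('m \<Rightarrow> 'b) \<Rightarrow> (model, 'm) dform \<Rightarrow> ('b, 'm) torus_coords \<Rightarrow> bool" where
  "action_angle \<A> \<B> prj J q \<longleftrightarrow>
     is_torus_coords \<A> \<B> prj q \<and>
     (\<forall>u\<in>tc_dom q \<times> UNIV. \<forall>vs.
        in_coords J q u vs = (\<Sum>j\<in>UNIV. wedge (d_theta j) (d_r j) vs))"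

text \<open>The changes of base coordinates are (locally) affine
  with linear part in \<open>SL(4, \<int>)\<close>.\<close>

definition action_angle_atlas ::
    "(model, 'm::topological_space) chart set \<Rightarrow> (real^4, 'b::topological_space) chart set \<Rightarrow>
     ('m \<Rightarrow> 'b) \<Rightarrow> (model, 'm) dform \<Rightarrow> ('b, 'm) torus_coords set \<Rightarrow> bool" where
  "action_angle_atlas \<A> \<B> prj J \<P> \<longleftrightarrow>
     (\<forall>q\<in>\<P>. action_angle \<A> \<B> prj J q) \<and>
     (\<forall>b. \<exists>q\<in>\<P>. b \<in> tc_base q ` tc_dom q) \<and>
     (\<forall>q\<in>\<P>. \<forall>q'\<in>\<P>. \<forall>r0\<in>tc_dom q. tc_base q r0 \<in> tc_base q' ` tc_dom q' \<longrightarrow>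
        (\<exists>L :: real^4^4. \<exists>s e. (\<forall>i j. L $ i $ j \<in> \<int>) \<and> det L = 1 \<and> e > 0 \<and>
           (\<forall>r\<in>tc_dom q \<inter> ball r0 e. \<forall>r'\<in>tc_dom q'.
              tc_base q r = tc_base q' r' \<longrightarrow> r' = L *v r + s)))"

definition fibre_invariant :: "('b, 'm) torus_coords set \<Rightarrow> (model, 'm) dform \<Rightarrow> bool" where
  "fibre_invariant \<P> \<omega> \<longleftrightarrow>
     (\<forall>q\<in>\<P>. \<forall>r\<in>tc_dom q. \<forall>\<theta> \<theta>'. in_coords \<omega> q (r, \<theta>) = in_coords \<omega> q (r, \<theta>'))"

definition semi_flat ::
    "('b, 'm) torus_coords set \<Rightarrow> (model, 'm) dform \<Rightarrow> (model, 'm) dform \<Rightarrow> bool" where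
  "semi_flat \<P> J \<Omega> \<longleftrightarrow> fibre_invariant \<P> J \<and> fibre_invariant \<P> \<Omega>"

text \<open>For each action-angle coordinate system \<open>q\<close> the matrices \<open>a q r\<close> and \<open>\<rho> q r\<close> are those of the
  frame \<open>\<zeta>\<^sup>j = d\<theta>\<^sup>j + a\<^sup>j\<^sub>k dr\<^sup>k + \<i> \<rho>\<^sup>j\<^sub>k dr\<^sup>k\<close> of \<open>(1,0)\<close>-forms.\<close>

definition zeta :: "real^4^4 \<Rightarrow> real^4^4 \<Rightarrow> 4 \<Rightarrow> model form" where
  "zeta a \<rho> j vs = d_theta j vs + (\<Sum>k\<in>UNIV. complex_of_real (a $ j $ k) * d_r k vs)
                   + \<i> * (\<Sum>k\<in>UNIV. complex_of_real (\<rho> $ j $ k) * d_r k vs)"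

definition semi_flat_frame ::
    "('b, 'm) torus_coords set \<Rightarrow> (model, 'm) dform \<Rightarrow>
     (('b, 'm) torus_coords \<Rightarrow> real^4 \<Rightarrow> real^4^4) \<Rightarrow>
     (('b, 'm) torus_coords \<Rightarrow> real^4 \<Rightarrow> real^4^4) \<Rightarrow> bool" where
  "semi_flat_frame \<P> \<Omega> a \<rho> \<longleftrightarrow>
     (\<forall>q\<in>\<P>. smooth_on (tc_dom q) (a q) \<and> smooth_on (tc_dom q) (\<rho> q) \<and>
       (\<forall>r\<in>tc_dom q.
          transpose (a q r) = a q r \<and> transpose (\<rho> q r) = \<rho> q r \<and> invertible (\<rho> q r) \<and>
          (\<forall>\<theta> j. form10 (acs 4 (in_coords \<Omega> q (r, \<theta>))) (zeta (a q r) (\<rho> q r) j))))"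

definition flat_connection ::
    "('b, 'm) torus_coords set \<Rightarrow> (('b, 'm) torus_coords \<Rightarrow> real^4 \<Rightarrow> real^4^4) \<Rightarrow> bool" where
  "flat_connection \<P> a \<longleftrightarrow>
     (\<forall>q\<in>\<P>. \<forall>r\<in>tc_dom q. \<forall>j k l.
        frechet_derivative (\<lambda>r. a q r $ l $ k) (at r) (axis j 1) -
        frechet_derivative (\<lambda>r. a q r $ l $ j) (at r) (axis k 1) = 0)"


section \<open>The polarization and the LTY 2A system\<close>

text \<open>The subspaces of the cotangent space spanned by the \<open>dr\<^sup>j\<close> and by the
  \<open>\<delta>\<theta>\<^sup>j = d\<theta>\<^sup>j + a\<^sup>j\<^sub>k dr\<^sup>k\<close>, seen in an arbitrary chart \<open>c\<close> at \<open>u\<close>.\<close>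

definition D_star :: "('b, 'm) torus_coords set \<Rightarrow> (model, 'm) chart \<Rightarrow> model \<Rightarrow> (model \<Rightarrow> real) set" where
  "D_star \<P> c u =
     {\<lambda>v. \<Sum>j\<in>UNIV. k $ j * (fst (chart_jacobian c (tc_chart q \<theta>) u v) $ j) | q r \<theta> k.
        q \<in> \<P> \<and> r \<in> tc_dom q \<and> tc_map q (r, \<theta>) = snd c u}"

definition D_star_perp ::
    "('b, 'm) torus_coords set \<Rightarrow> (('b, 'm) torus_coords \<Rightarrow> real^4 \<Rightarrow> real^4^4) \<Rightarrow>
     (model, 'm) chart \<Rightarrow> model \<Rightarrow> (model \<Rightarrow> real) set" where
  "D_star_perp \<P> a c u =
     {\<lambda>v. \<Sum>j\<in>UNIV. k $ j * ((snd (chart_jacobian c (tc_chart q \<theta>) u v)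
                              + a q r *v fst (chart_jacobian c (tc_chart q \<theta>) u v)) $ j) | q r \<theta> k.
        q \<in> \<P> \<and> r \<in> tc_dom q \<and> tc_map q (r, \<theta>) = snd c u}"

text \<open>The transpose of the projection of the cotangent space onto \<open>\<D>\<^sup>*\<close> along its complement.\<close>

definition proj_D ::
    "('b, 'm) torus_coords set \<Rightarrow> (('b, 'm) torus_coords \<Rightarrow> real^4 \<Rightarrow> real^4^4) \<Rightarrow>
     (model, 'm) chart \<Rightarrow> model \<Rightarrow> model \<Rightarrow> model" where
  "proj_D \<P> a c u =
     (THE P. linear P \<and> (\<forall>\<beta>\<in>D_star \<P> c u. \<forall>v. \<beta> (P v) = \<beta> v) \<and>
             (\<forall>\<beta>\<in>D_star_perp \<P> a c u. \<forall>v. \<beta> (P v) = 0))"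

text \<open>Projection onto the forms with \<open>m\<close> legs in \<open>\<D>\<^sup>*\<close> and \<open>n\<close> legs in the complement: the
  part of \<open>\<omega>\<close> in which \<open>m\<close> of the arguments are projected by \<open>P\<close> and the others by \<open>1 - P\<close>.\<close>

definition pi_D ::
    "('b, 'm) torus_coords set \<Rightarrow> (('b, 'm) torus_coords \<Rightarrow> real^4 \<Rightarrow> real^4^4) \<Rightarrow>
     nat \<Rightarrow> nat \<Rightarrow> (model, 'm) dform \<Rightarrow> (model, 'm) dform" where
  "pi_D \<P> a m n \<omega> c u vs =
     (if length vs = m + n then
        \<Sum>S\<in>{S. S \<subseteq> {..<length vs} \<and> card S = m}.
          \<omega> c u (map (\<lambda>i. if i \<in> S then proj_D \<P> a c u (vs ! i)
                          else vs ! i - proj_D \<P> a c u (vs ! i)) [0..<length vs])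
      else 0)"

definition LTY_2A_system ::
    "(model, 'm) chart set \<Rightarrow> ('b, 'm) torus_coords set \<Rightarrow>
     (('b, 'm) torus_coords \<Rightarrow> real^4 \<Rightarrow> real^4^4) \<Rightarrow>
     ((model, 'm) dform \<Rightarrow> (model, 'm) dform) \<Rightarrow>
     (model, 'm) dform \<Rightarrow> (model, 'm) dform \<Rightarrow> ('m \<Rightarrow> real) \<Rightarrow> (model, 'm) dform \<Rightarrow> bool" where
  "LTY_2A_system \<A> \<P> a dD JA \<Omega>A KA \<rho>A \<longleftrightarrow>
     SU_structure \<A> 4 KA JA \<Omega>A \<and>
     closed_dform \<A> JA \<and>
     closed_dform \<A> (add_dform (pi_D \<P> a 0 4 \<Omega>A) (pi_D \<P> a 3 1 \<Omega>A)) \<and>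
     diff_form \<A> \<rho>A \<and>
     form_eq \<A> \<rho>A
       (scale_dform (\<lambda>m. - \<i>)
         (ext_d (dD (scale_dform (\<lambda>m. complex_of_real (KA m))
            (add_dform (pi_D \<P> a 1 3 \<Omega>A) (pi_D \<P> a 4 0 \<Omega>A))))))"

end

theory Submission
  imports Defs
begin

text \<open>In action-angle coordinates \<open>\<Omega> = f \<zeta>\<^sup>1 \<and> \<dots> \<and> \<zeta>\<^sup>4\<close> with \<open>\<zeta>\<^sup>j = \<delta>\<theta>\<^sup>j + \<i> \<rho>\<^sup>j\<^sub>k dr\<^sup>k\<close>. The LTY structure consists
  of \<open>J\<close> and \<open>\<Omega>\<^sub>A = \<And>(\<delta>\<theta>\<^sup>j + \<i> s \<rho>\<^sup>j\<^sub>k dr\<^sup>k)\<close> with \<open>s\<^sup>3 = |F|\<^sup>2\<close>, \<open>F = e\<^sup>-\<^sup>A f\<close>, that is, \<open>\<Omega>\<^sub>A\<close> is \<open>f\<^sup>-\<^sup>1 S\<^sup>*\<Omega>\<close>, where \<open>S\<close>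
  stretches the horizontal directions by \<open>s\<close>. As \<open>S\<^sup>*J = s J\<close>, this is an \<open>SU(4)\<close>-structure with
  \<open>K\<^sub>A = s\<^sup>4 / |f|\<^sup>2\<close>. Since the connection is flat, the \<open>(0,4)\<close>-part \<open>\<delta>\<theta>\<^sup>1 \<and> \<dots> \<and> \<delta>\<theta>\<^sup>4\<close> is closed, and the
  \<open>(3,1)\<close>-part is closed if \<open>|F|\<^sup>2 C\<close> is divergence free, \<open>C\<close> being the cofactor matrix of \<open>\<rho>\<close>.

  The supersymmetry system gives \<open>d(e\<^sup>-\<^sup>A \<Omega>) = e\<^sup>-\<^sup>A (W\<^sub>2 \<and> J - \<partial>A \<and> \<Omega>)\<close>, on which the almost complex
  structure, applied to all arguments, acts as \<open>\<i>\<close>. It exchanges horizontal and vertical vectors, so it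
  expresses the \<open>(4,1)\<close>-part of this form by its \<open>(1,4)\<close>-part: \<open>\<partial>\<^sub>l (F C\<^sup>l\<^sup>j) = - C\<^sup>l\<^sup>j \<partial>\<^sub>l F\<close>. As \<open>C\<close> is
  real, \<open>\<partial>\<^sub>l (|F|\<^sup>2 C\<^sup>l\<^sup>j) = 0\<close> follows. The function \<open>A\<close> is constant on the fibres because its
  differential is determined by the fibre-invariant \<open>\<Omega>\<close>.\<close>

section \<open>Smooth functions\<close>

text \<open>The power of s comes from counting legs. After division by f, stretching by s multiplies
  a part with m horizontal legs by s^m, so the (3,1)-part of \<Omega>_A is built, up to constants,
  from s^3 C. The supersymmetry relation \<partial>(F C) = - C \<partial>F makes not F C but its
  product with conj F divergence free: that product is real, while its divergence comes out
  imaginary. Hence the choice s^3 = |F|^2. The weight e^-A cancels the one term of d\<Omega> on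
  which the almost complex structure acts by -\<i>.

  The second difficulty is that the objects have to exist on the whole manifold. \<open>acs\<close>
  and \<open>proj_D\<close> are definite descriptions, and f is visible in torus coordinates only.
  The volume equation makes the almost complex structure unique; together with the vertical
  directions it yields the horizontal ones in every coordinate system; and f is invariant because
  changes of base coordinates have determinant 1. Everything is compared in torus charts and carried
  to the remaining charts by the transformation law.\<close>

lemma Ck_on_cong:
  assumes "open S" "\<And>x. x \<in> S \<Longrightarrow> f x = g x" "Ck_on k S f"
  shows "Ck_on k S g"
  using assms(2,3)
proof (induction k arbitrary: f g)
  case 0
  then show ?case by (simp cong: continuous_on_cong)
next
  case (Suc k)
  have d: "g differentiable at x" "frechet_derivative g (at x) = frechet_derivative f (at x)"
    if "x \<in> S" for x
  proof -
    have fx: "f differentiable at x" using Suc.prems that by simp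
    have "(g has_derivative frechet_derivative f (at x)) (at x)"
      using has_derivative_transform_within_open[OF _ assms(1) that, of f _ UNIV g]
        fx Suc.prems(1) by (simp add: frechet_derivative_works)
    then show "g differentiable at x" "frechet_derivative g (at x) = frechet_derivative f (at x)"
      by (auto simp: differentiable_def frechet_derivative_at[symmetric])
  qed
  have "Ck_on k S (\<lambda>x. frechet_derivative g (at x) v)" for v
    using Suc.IH[of "\<lambda>x. frechet_derivative f (at x) v" "\<lambda>x. frechet_derivative g (at x) v"] d Suc.prems
    by simp
  then show ?case using d by simp
qed

lemma Ck_on_differentiable: "Ck_on (Suc k) S f \<Longrightarrow> x \<in> S \<Longrightarrow> f differentiable at x"
  by simp

lemma Ck_on_Suc_imp: "Ck_on (Suc k) S f \<Longrightarrow> Ck_on k S f"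
proof (induction k arbitrary: f)
  case 0
  then show ?case
    by (auto intro!: continuous_at_imp_continuous_on differentiable_imp_continuous_within)
next
  case (Suc k)
  then show ?case by (metis Ck_on.simps(2))
qed

lemma Ck_on_subset: "Ck_on k S f \<Longrightarrow> T \<subseteq> S \<Longrightarrow> Ck_on k T f"
  by (induction k arbitrary: f) (auto intro: continuous_on_subset)

lemma Ck_on_local:
  assumes "\<And>x. x \<in> S \<Longrightarrow> \<exists>T. open T \<and> x \<in> T \<and> Ck_on k T f"
  shows "Ck_on k S f"
  using assms
proof (induction k arbitrary: f)
  case 0
  then show ?case
    unfolding Ck_on.simps
    by (intro continuous_at_imp_continuous_on ballI) (metis continuous_on_eq_continuous_at)
next
  case (Suc k)
  have "Ck_on k S (\<lambda>x. frechet_derivative f (at x) v)" for v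
    using Suc.prems by (intro Suc.IH) (metis Ck_on.simps(2))
  moreover have "f differentiable at x" if "x \<in> S" for x
    using Suc.prems[OF that] by auto
  ultimately show ?case by simp
qed

lemma Ck_on_const [simp]: "Ck_on k S (\<lambda>x. c)"
  by (induction k arbitrary: c) auto

lemma Ck_on_bounded_linear: "bounded_linear f \<Longrightarrow> Ck_on k S f"
proof (induction k)
  case 0
  then show ?case by (simp add: linear_continuous_on)
next
  case (Suc k)
  have "frechet_derivative f (at x) = f" for x
    using bounded_linear_imp_has_derivative[OF Suc.prems] by (metis frechet_derivative_at)
  then show ?case
    using Suc.prems by (simp add: bounded_linear_imp_differentiable)
qed

lemma Ck_on_add:
  assumes "open S" "Ck_on k S f" "Ck_on k S g"
  shows "Ck_on k S (\<lambda>x. f x + g x)"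
  using assms(2,3)
proof (induction k arbitrary: f g)
  case 0
  then show ?case by (simp add: continuous_on_add)
next
  case (Suc k)
  have "Ck_on k S (\<lambda>x. frechet_derivative (\<lambda>x. f x + g x) (at x) v)" for v
  proof (rule Ck_on_cong[OF assms(1)])
    show "Ck_on k S (\<lambda>x. frechet_derivative f (at x) v + frechet_derivative g (at x) v)"
      using Suc by simp
    fix x assume "x \<in> S"
    then have "((\<lambda>x. f x + g x) has_derivative
        (\<lambda>v. frechet_derivative f (at x) v + frechet_derivative g (at x) v)) (at x)"
      using Suc.prems by (auto intro!: has_derivative_add simp: frechet_derivative_works[symmetric])
    from frechet_derivative_at[OF this]
    show "frechet_derivative f (at x) v + frechet_derivative g (at x) v =
        frechet_derivative (\<lambda>x. f x + g x) (at x) v"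
      by metis
  qed
  then show ?case using Suc.prems by (simp add: differentiable_add)
qed

lemma Ck_on_bilinear:
  assumes "open S" "bounded_bilinear p" "Ck_on k S f" "Ck_on k S g"
  shows "Ck_on k S (\<lambda>x. p (f x) (g x))"
  using assms(3,4)
proof (induction k arbitrary: f g)
  case 0
  then show ?case using bounded_bilinear.continuous_on[OF assms(2)] by auto
next
  case (Suc k)
  have der: "((\<lambda>x. p (f x) (g x)) has_derivative
        (\<lambda>v. p (f x) (frechet_derivative g (at x) v) + p (frechet_derivative f (at x) v) (g x))) (at x)"
    if "x \<in> S" for x
    using Suc.prems that
    by (intro bounded_bilinear.FDERIV[OF assms(2)]) (auto simp: frechet_derivative_works[symmetric])
  have "Ck_on k S (\<lambda>x. frechet_derivative (\<lambda>x. p (f x) (g x)) (at x) v)" for v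
  proof (rule Ck_on_cong[OF assms(1)])
    show "Ck_on k S (\<lambda>x. p (f x) (frechet_derivative g (at x) v) + p (frechet_derivative f (at x) v) (g x))"
      using Suc Ck_on_Suc_imp[OF Suc.prems(1)] Ck_on_Suc_imp[OF Suc.prems(2)]
      by (intro Ck_on_add[OF assms(1)] Suc.IH) auto
    fix x assume "x \<in> S"
    from frechet_derivative_at[OF der[OF this]]
    show "p (f x) (frechet_derivative g (at x) v) + p (frechet_derivative f (at x) v) (g x) =
        frechet_derivative (\<lambda>x. p (f x) (g x)) (at x) v"
      by metis
  qed
  then show ?case using der by (auto simp: differentiable_def)
qed

lemma Ck_on_sum:
  assumes "open S" "\<And>i. i \<in> I \<Longrightarrow> Ck_on k S (f i)"
  shows "Ck_on k S (\<lambda>x. \<Sum>i\<in>I. f i x)"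
  using assms(2)
  by (induction I rule: infinite_finite_induct) (auto intro!: Ck_on_add[OF assms(1)])

text \<open>The derivative of \<open>f\<close> at \<open>g x\<close> is applied to a vector that
  varies with x, so the induction hypothesis does not reach it directly. Expanding that vector in
  \<open>Basis\<close> leaves derivatives of \<open>f\<close> in fixed directions, which are what
  the recursive definition of \<open>Ck_on\<close> controls; this is why the middle space is
  Euclidean.\<close>

lemma Ck_on_compose:
  fixes g :: "'a::real_normed_vector \<Rightarrow> 'b::euclidean_space"
  assumes "open S" "open T" "Ck_on k T f" "Ck_on k S g" "g ` S \<subseteq> T"
  shows "Ck_on k S (\<lambda>x. f (g x))"
  using assms(3,4)
proof (induction k arbitrary: f)
  case 0
  then show ?case
    using continuous_on_compose2[of T f S g] assms(5) by simp
next
  case (Suc k)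
  have fd: "(f has_derivative frechet_derivative f (at (g x))) (at (g x))" if "x \<in> S" for x
    using Suc.prems that assms(5) by (auto simp: frechet_derivative_works[symmetric])
  have der: "((\<lambda>x. f (g x)) has_derivative
        (\<lambda>v. frechet_derivative f (at (g x)) (frechet_derivative g (at x) v))) (at x)"
    if "x \<in> S" for x
    by (rule has_derivative_compose[where f = g and g = f, OF _ fd[OF that]])
      (use Suc.prems that in \<open>auto simp: frechet_derivative_works[symmetric]\<close>)
  have "Ck_on k S (\<lambda>x. frechet_derivative (\<lambda>x. f (g x)) (at x) v)" for v
  proof (rule Ck_on_cong[OF assms(1)])
    show "Ck_on k S (\<lambda>x. \<Sum>b\<in>Basis. (frechet_derivative g (at x) v \<bullet> b) *\<^sub>R frechet_derivative f (at (g x)) b)"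
    proof (intro Ck_on_sum[OF assms(1)] Ck_on_bilinear[OF assms(1) bounded_bilinear_scaleR])
      fix b :: 'b
      show "Ck_on k S (\<lambda>x. frechet_derivative g (at x) v \<bullet> b)"
        by (rule Ck_on_bilinear[OF assms(1) bounded_bilinear_inner]) (use Suc.prems in auto)
      show "Ck_on k S (\<lambda>x. frechet_derivative f (at (g x)) b)"
        by (rule Suc.IH) (use Suc.prems(1) Ck_on_Suc_imp[OF Suc.prems(2)] in auto)
    qed
    fix x assume x: "x \<in> S"
    have lin: "linear (frechet_derivative f (at (g x)))"
      using fd[OF x] by (rule has_derivative_linear)
    have "frechet_derivative f (at (g x)) (frechet_derivative g (at x) v) =
        frechet_derivative f (at (g x)) (\<Sum>b\<in>Basis. (frechet_derivative g (at x) v \<bullet> b) *\<^sub>R b)"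
      by (simp add: euclidean_representation)
    also have "\<dots> = (\<Sum>b\<in>Basis. (frechet_derivative g (at x) v \<bullet> b) *\<^sub>R frechet_derivative f (at (g x)) b)"
      by (simp add: linear_sum[OF lin] linear_scale[OF lin])
    finally show "(\<Sum>b\<in>Basis. (frechet_derivative g (at x) v \<bullet> b) *\<^sub>R frechet_derivative f (at (g x)) b) =
        frechet_derivative (\<lambda>x. f (g x)) (at x) v"
      using frechet_derivative_at[OF der[OF x]] by metis
  qed
  then show ?case using der by (auto simp: differentiable_def)
qed

lemma smooth_on_cong:
  "open S \<Longrightarrow> (\<And>x. x \<in> S \<Longrightarrow> f x = g x) \<Longrightarrow> smooth_on S f \<Longrightarrow> smooth_on S g"
  unfolding smooth_on_def using Ck_on_cong[of S f g] by simp

lemma smooth_on_subset: "smooth_on S f \<Longrightarrow> T \<subseteq> S \<Longrightarrow> smooth_on T f"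
  unfolding smooth_on_def using Ck_on_subset[of _ S f T] by simp

lemma smooth_on_local:
  "(\<And>x. x \<in> S \<Longrightarrow> \<exists>T. open T \<and> x \<in> T \<and> smooth_on T f) \<Longrightarrow> smooth_on S f"
  unfolding smooth_on_def by (intro allI Ck_on_local) metis

lemma smooth_on_differentiable: "smooth_on S f \<Longrightarrow> x \<in> S \<Longrightarrow> f differentiable at x"
  unfolding smooth_on_def using Ck_on_differentiable[of 0 S f x] by simp

lemma smooth_on_has_derivative:
  "smooth_on S f \<Longrightarrow> x \<in> S \<Longrightarrow> (f has_derivative frechet_derivative f (at x)) (at x)"
  using smooth_on_differentiable by (simp add: frechet_derivative_works[symmetric])

lemma smooth_on_continuous: "smooth_on S f \<Longrightarrow> continuous_on S f"
  unfolding smooth_on_def using Ck_on.simps(1)[of S f] by (auto dest: spec[of _ 0])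

lemma smooth_on_frechet_derivative:
  "smooth_on S f \<Longrightarrow> smooth_on S (\<lambda>x. frechet_derivative f (at x) v)"
  unfolding smooth_on_def using Ck_on.simps(2)[of _ S f] by simp

lemma smooth_on_const [simp]: "smooth_on S (\<lambda>x. c)"
  unfolding smooth_on_def by simp

lemma smooth_on_bounded_linear: "bounded_linear f \<Longrightarrow> smooth_on S f"
  unfolding smooth_on_def by (simp add: Ck_on_bounded_linear)

lemma smooth_on_add: "open S \<Longrightarrow> smooth_on S f \<Longrightarrow> smooth_on S g \<Longrightarrow> smooth_on S (\<lambda>x. f x + g x)"
  unfolding smooth_on_def by (simp add: Ck_on_add)

lemma smooth_on_sum:
  "open S \<Longrightarrow> (\<And>i. i \<in> I \<Longrightarrow> smooth_on S (f i)) \<Longrightarrow> smooth_on S (\<lambda>x. \<Sum>i\<in>I. f i x)"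
  unfolding smooth_on_def by (simp add: Ck_on_sum)

lemma smooth_on_bilinear:
  "open S \<Longrightarrow> bounded_bilinear p \<Longrightarrow> smooth_on S f \<Longrightarrow> smooth_on S g \<Longrightarrow>
    smooth_on S (\<lambda>x. p (f x) (g x))"
  unfolding smooth_on_def by (simp add: Ck_on_bilinear)

lemmas smooth_on_mult = smooth_on_bilinear[OF _ bounded_bilinear_mult]
lemmas smooth_on_scaleR = smooth_on_bilinear[OF _ bounded_bilinear_scaleR]
lemmas smooth_on_inner = smooth_on_bilinear[OF _ bounded_bilinear_inner]

lemma smooth_on_compose:
  fixes g :: "'a::real_normed_vector \<Rightarrow> 'b::euclidean_space"
  assumes "open S" "open T" "smooth_on T f" "smooth_on S g" "g ` S \<subseteq> T"
  shows "smooth_on S (\<lambda>x. f (g x))"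
  using Ck_on_compose[OF assms(1,2) _ _ assms(5)] assms(3,4) unfolding smooth_on_def by blast

lemma smooth_on_compose_linear:
  fixes g :: "'a::real_normed_vector \<Rightarrow> 'b::euclidean_space"
  assumes "open S" "bounded_linear f" "smooth_on S g"
  shows "smooth_on S (\<lambda>x. f (g x))"
  using smooth_on_compose[OF assms(1) open_UNIV smooth_on_bounded_linear[OF assms(2)] assms(3)] by simp

section \<open>Inverse, exponential and logarithm\<close>

lemma smooth_on_inverse: "smooth_on (- {0}) (inverse :: 'a::real_normed_field \<Rightarrow> 'a)"
proof -
  have op: "open (- {0} :: 'a set)" by (simp add: open_Compl)
  have "Ck_on k (- {0}) (inverse :: 'a \<Rightarrow> 'a)" for k
  proof (induction k)
    case 0
    show ?case by (simp add: continuous_on_inverse)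
  next
    case (Suc k)
    have "Ck_on k (- {0}) (\<lambda>x::'a. frechet_derivative inverse (at x) v)" for v
    proof (rule Ck_on_cong[OF op])
      show "Ck_on k (- {0}) (\<lambda>x::'a. (- v) * (inverse x * inverse x))"
        by (intro Ck_on_bilinear[OF op bounded_bilinear_mult] Suc) auto
      fix x :: 'a assume "x \<in> - {0}"
      then have "(inverse has_derivative (\<lambda>h. - (inverse x * h * inverse x))) (at x)"
        by (auto intro: has_derivative_inverse')
      from frechet_derivative_at[OF this, symmetric]
      show "(- v) * (inverse x * inverse x) = frechet_derivative inverse (at x) v"
        by (simp add: ac_simps)
    qed
    moreover have "(inverse :: 'a \<Rightarrow> 'a) differentiable at x" if "x \<noteq> 0" for x
      using that has_derivative_inverse'[of x UNIV] by (auto simp: differentiable_def)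
    ultimately show ?case by simp
  qed
  then show ?thesis unfolding smooth_on_def by blast
qed

lemma smooth_on_exp: "smooth_on UNIV (exp :: real \<Rightarrow> real)"
proof -
  have der: "(exp has_derivative (\<lambda>v. v * exp x)) (at x)" for x :: real
    using DERIV_exp[of x] by (simp add: has_field_derivative_def mult.commute[of _ "exp x"])
  have "Ck_on k UNIV (exp :: real \<Rightarrow> real)" for k
  proof (induction k)
    case (Suc k)
    have "Ck_on k UNIV (\<lambda>x. v * exp x)" for v :: real
      by (intro Ck_on_bilinear[OF _ bounded_bilinear_mult] Suc) auto
    moreover have "exp differentiable at x" for x :: real
      using der unfolding differentiable_def by blast
    ultimately show ?case by (simp add: frechet_derivative_at[OF der, symmetric])
  qed (simp add: continuous_on_exp)
  then show ?thesis unfolding smooth_on_def by blast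
qed

lemma smooth_on_ln: "smooth_on {0<..} (ln :: real \<Rightarrow> real)"
proof -
  have der: "(ln has_derivative (\<lambda>v. v * inverse x)) (at x)" if "x > 0" for x :: real
    using DERIV_ln[OF that] by (simp add: has_field_derivative_def mult.commute[of _ "inverse x"])
  have "Ck_on k {0<..} (ln :: real \<Rightarrow> real)" for k
  proof (cases k)
    case (Suc k)
    have "Ck_on k {0<..} (inverse :: real \<Rightarrow> real)"
      by (rule Ck_on_subset[of _ "- {0}"]) (use smooth_on_inverse in \<open>auto simp: smooth_on_def\<close>)
    then have "Ck_on k {0<..} (\<lambda>x. v * inverse x)" for v :: real
      by (intro Ck_on_bilinear[OF _ bounded_bilinear_mult]) auto
    then have "Ck_on k {0<..} (\<lambda>x. frechet_derivative ln (at x) v)" for v :: real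
      by (rule Ck_on_cong[rotated 2]) (simp_all add: frechet_derivative_at[OF der, symmetric])
    moreover have "ln differentiable at x" if "x > 0" for x :: real
      using der[OF that] unfolding differentiable_def by blast
    ultimately show ?thesis using Suc by simp
  qed (auto intro!: continuous_on_ln)
  then show ?thesis unfolding smooth_on_def by blast
qed

section \<open>Symmetry of second derivatives\<close>

text \<open>Both iterated derivatives agree with the second difference quotient at intermediate points.\<close>

lemma second_difference_mean_value:
  fixes g :: "'a::real_normed_vector \<Rightarrow> real"
  assumes "h > 0"
    and d1: "\<And>s t. 0 \<le> s \<Longrightarrow> s \<le> h \<Longrightarrow> 0 \<le> t \<Longrightarrow> t \<le> h \<Longrightarrow>
        g differentiable at (u + s *\<^sub>R v + t *\<^sub>R w)"
    and d2: "\<And>s t. 0 \<le> s \<Longrightarrow> s \<le> h \<Longrightarrow> 0 \<le> t \<Longrightarrow> t \<le> h \<Longrightarrow>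
        (\<lambda>x. frechet_derivative g (at x) v) differentiable at (u + s *\<^sub>R v + t *\<^sub>R w)"
  obtains s t where "0 \<le> s" "s \<le> h" "0 \<le> t" "t \<le> h"
    "g (u + h *\<^sub>R v + h *\<^sub>R w) - g (u + h *\<^sub>R v) - g (u + h *\<^sub>R w) + g u =
      h * (h * frechet_derivative (\<lambda>x. frechet_derivative g (at x) v) (at (u + s *\<^sub>R v + t *\<^sub>R w)) w)"
proof -
  have cd: "((\<lambda>s. k (u + s *\<^sub>R v + t *\<^sub>R w)) has_real_derivative
      frechet_derivative k (at (u + s *\<^sub>R v + t *\<^sub>R w)) v) (at s)"
    if "k differentiable at (u + s *\<^sub>R v + t *\<^sub>R w)" for s t :: real and k :: "'a \<Rightarrow> real" and u v w
  proof -
    have "((\<lambda>s. u + s *\<^sub>R v + t *\<^sub>R w) has_derivative (\<lambda>x. x *\<^sub>R v)) (at s)"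
      by (auto intro!: derivative_eq_intros)
    from has_derivative_compose[OF this, of k] that
    have "((\<lambda>s. k (u + s *\<^sub>R v + t *\<^sub>R w)) has_derivative
      (\<lambda>x. frechet_derivative k (at (u + s *\<^sub>R v + t *\<^sub>R w)) (x *\<^sub>R v))) (at s)"
      by (auto simp: frechet_derivative_works[symmetric])
    moreover have "linear (frechet_derivative k (at (u + s *\<^sub>R v + t *\<^sub>R w)))"
      using that by (auto intro: linear_frechet_derivative)
    ultimately show ?thesis
      by (simp add: has_field_derivative_def linear_scale mult_commute_abs)
  qed
  \<comment> \<open>The second difference is the increment of \<open>?f\<close> from 0 to h. The
    mean value theorem in the direction v, then in the direction w, gives the mixed derivative at
    one intermediate point; the term \<open>0 *\<^sub>R w\<close> is kept so that \<open>cd\<close>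
    applies to both summands.\<close>
  let ?f = "\<lambda>s. g (u + s *\<^sub>R v + h *\<^sub>R w) - g (u + s *\<^sub>R v + 0 *\<^sub>R w)"
  have "\<exists>s>0. s < h \<and> ?f h - ?f 0 = (h - 0) *
      (frechet_derivative g (at (u + s *\<^sub>R v + h *\<^sub>R w)) v - frechet_derivative g (at (u + s *\<^sub>R v + 0 *\<^sub>R w)) v)"
    by (rule MVT2[OF assms(1)]) (intro DERIV_diff cd d1, use assms(1) in auto)
  then obtain s where s: "0 < s" "s < h" "?f h - ?f 0 = h *
      (frechet_derivative g (at (u + s *\<^sub>R v + h *\<^sub>R w)) v - frechet_derivative g (at (u + s *\<^sub>R v + 0 *\<^sub>R w)) v)"
    by auto
  let ?k = "\<lambda>x. frechet_derivative g (at x) v"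
  have "((\<lambda>t. ?k (u + s *\<^sub>R v + t *\<^sub>R w)) has_real_derivative
      frechet_derivative ?k (at (u + s *\<^sub>R v + t *\<^sub>R w)) w) (at t)" if "0 \<le> t" "t \<le> h" for t
    using cd[of ?k u t w s v] d2[of s t] that s by (simp add: add.assoc add.commute[of "s *\<^sub>R v"])
  then have "\<exists>t>0. t < h \<and> ?k (u + s *\<^sub>R v + h *\<^sub>R w) - ?k (u + s *\<^sub>R v + 0 *\<^sub>R w) =
      (h - 0) * frechet_derivative ?k (at (u + s *\<^sub>R v + t *\<^sub>R w)) w"
    by (intro MVT2[OF assms(1)]) auto
  then obtain t where t: "0 < t" "t < h" "?k (u + s *\<^sub>R v + h *\<^sub>R w) - ?k (u + s *\<^sub>R v + 0 *\<^sub>R w) =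
      h * frechet_derivative ?k (at (u + s *\<^sub>R v + t *\<^sub>R w)) w"
    by auto
  show ?thesis
    by (rule that[of s t]) (use s t in auto)
qed

lemma second_derivative_symmetric_real:
  fixes g :: "'a::real_normed_vector \<Rightarrow> real"
  assumes "open S" "smooth_on S g" "u \<in> S"
  shows "frechet_derivative (\<lambda>x. frechet_derivative g (at x) v) (at u) w =
    frechet_derivative (\<lambda>x. frechet_derivative g (at x) w) (at u) v"
proof -
  let ?D = "\<lambda>v w x. frechet_derivative (\<lambda>x. frechet_derivative g (at x) v) (at x) w"
  have cont: "isCont (?D v w) u" for v w
    using smooth_on_continuous[OF smooth_on_frechet_derivative[OF smooth_on_frechet_derivative[OF assms(2)]]]
      assms by (simp add: continuous_on_eq_continuous_at)
  have "dist (?D v w u) (?D w v u) < e" if "e > 0" for e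
  proof -
    obtain d1 where d1: "d1 > 0" "\<And>x. dist x u < d1 \<Longrightarrow> dist (?D v w x) (?D v w u) < e / 2"
      using cont[of v w] half_gt_zero[OF \<open>e > 0\<close>] unfolding continuous_at_eps_delta by blast
    obtain d2 where d2: "d2 > 0" "\<And>x. dist x u < d2 \<Longrightarrow> dist (?D w v x) (?D w v u) < e / 2"
      using cont[of w v] half_gt_zero[OF \<open>e > 0\<close>] unfolding continuous_at_eps_delta by blast
    obtain d3 where d3: "d3 > 0" "\<And>x. dist x u < d3 \<Longrightarrow> x \<in> S"
      using assms(1,3) unfolding open_dist by blast
    define d where "d = min d1 (min d2 d3)"
    \<comment> \<open>Keeps the parallelogram spanned by h v and h w within distance d / 2 of u; the
      summand 1 keeps the denominator positive when v and w vanish.\<close>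
    define h where "h = d / (2 * (norm v + norm w + 1))"
    have d: "d > 0" using d1 d2 d3 by (simp add: d_def)
    have nn: "norm v + norm w + 1 > 0" by (simp add: add_nonneg_pos)
    have h: "h > 0" using d nn by (simp add: h_def)
    have near: "dist (u + s *\<^sub>R x + t *\<^sub>R y) u < d"
      if "0 \<le> s" "s \<le> h" "0 \<le> t" "t \<le> h" "norm x + norm y = norm v + norm w" for s t x y
    proof -
      have "dist (u + s *\<^sub>R x + t *\<^sub>R y) u \<le> s * norm x + t * norm y"
        using that norm_triangle_ineq[of "s *\<^sub>R x" "t *\<^sub>R y"] by (simp add: dist_norm add.assoc)
      also have "\<dots> \<le> h * norm x + h * norm y"
        using that by (intro add_mono mult_right_mono) auto
      also have "\<dots> \<le> h * (norm v + norm w + 1)"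
        using that h by (simp flip: distrib_left)
      also have "\<dots> = d / 2"
        using nn by (simp add: h_def field_simps)
      finally show ?thesis using d by simp
    qed
    have nearS: "u + s *\<^sub>R x + t *\<^sub>R y \<in> S"
      if "0 \<le> s" "s \<le> h" "0 \<le> t" "t \<le> h" "norm x + norm y = norm v + norm w" for s t x y
      using near[OF that] d3 by (simp add: d_def)
    have diff: "g differentiable at x" "(\<lambda>x. frechet_derivative g (at x) v) differentiable at x" if "x \<in> S" for x v
      using smooth_on_differentiable[OF assms(2) that]
        smooth_on_differentiable[OF smooth_on_frechet_derivative[OF assms(2)] that] .
    obtain s t where st: "0 \<le> s" "s \<le> h" "0 \<le> t" "t \<le> h"
      "g (u + h *\<^sub>R v + h *\<^sub>R w) - g (u + h *\<^sub>R v) - g (u + h *\<^sub>R w) + g u =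
        h * (h * ?D v w (u + s *\<^sub>R v + t *\<^sub>R w))"
      by (rule second_difference_mean_value[OF h, of g u v w]) (rule diff nearS refl | assumption)+
    obtain s' t' where st': "0 \<le> s'" "s' \<le> h" "0 \<le> t'" "t' \<le> h"
      "g (u + h *\<^sub>R w + h *\<^sub>R v) - g (u + h *\<^sub>R w) - g (u + h *\<^sub>R v) + g u =
        h * (h * ?D w v (u + s' *\<^sub>R w + t' *\<^sub>R v))"
      by (rule second_difference_mean_value[OF h, of g u w v]) (rule diff nearS add.commute | assumption)+
    have "h * (h * ?D v w (u + s *\<^sub>R v + t *\<^sub>R w)) = h * (h * ?D w v (u + s' *\<^sub>R w + t' *\<^sub>R v))"
      unfolding st(5)[symmetric] st'(5)[symmetric] by (simp add: algebra_simps)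
    then have eq: "?D v w (u + s *\<^sub>R v + t *\<^sub>R w) = ?D w v (u + s' *\<^sub>R w + t' *\<^sub>R v)"
      using h by simp
    have "dist (?D v w (u + s *\<^sub>R v + t *\<^sub>R w)) (?D v w u) < e / 2"
      using near[OF st(1-4)] d1(2) by (simp add: d_def)
    moreover have "dist (?D w v (u + s' *\<^sub>R w + t' *\<^sub>R v)) (?D w v u) < e / 2"
      using near[OF st'(1-4), of w v] d2(2) by (simp add: d_def add.commute)
    ultimately show ?thesis
      unfolding eq dist_real_def by linarith
  qed
  then have "\<not> dist (?D v w u) (?D w v u) > 0" by blast
  then show ?thesis by simp
qed

lemma frechet_derivative_compose_linear:
  assumes "bounded_linear L" "f differentiable at x"
  shows "frechet_derivative (\<lambda>x. L (f x)) (at x) = (\<lambda>v. L (frechet_derivative f (at x) v))"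
proof -
  have "((\<lambda>x. L (f x)) has_derivative (\<lambda>v. L (frechet_derivative f (at x) v))) (at x)"
    by (rule bounded_linear.has_derivative[OF assms(1)]) (simp add: assms(2) frechet_derivative_works[symmetric])
  then show ?thesis by (rule frechet_derivative_at[symmetric])
qed

lemma second_derivative_symmetric:
  fixes g :: "'a::real_normed_vector \<Rightarrow> 'b::euclidean_space"
  assumes "open S" "smooth_on S g" "u \<in> S"
  shows "frechet_derivative (\<lambda>x. frechet_derivative g (at x) v) (at u) w =
    frechet_derivative (\<lambda>x. frechet_derivative g (at x) w) (at u) v"
proof (rule euclidean_eqI)
  fix b :: 'b
  have bl: "bounded_linear (\<lambda>y::'b. y \<bullet> b)" by (rule bounded_linear_inner_left)
  have sm: "smooth_on S (\<lambda>x. g x \<bullet> b)"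
    by (rule smooth_on_compose_linear[OF assms(1) bl assms(2)])
  have 1: "frechet_derivative (\<lambda>x. g x \<bullet> b) (at x) v = frechet_derivative g (at x) v \<bullet> b" if "x \<in> S" for x v
    by (simp add: frechet_derivative_compose_linear[OF bl smooth_on_differentiable[OF assms(2) that]])
  have "frechet_derivative (\<lambda>x. frechet_derivative (\<lambda>x. g x \<bullet> b) (at x) v) (at u) w =
      frechet_derivative (\<lambda>x. frechet_derivative g (at x) v) (at u) w \<bullet> b" for v w
  proof -
    have "frechet_derivative (\<lambda>x. frechet_derivative (\<lambda>x. g x \<bullet> b) (at x) v) (at u) =
        frechet_derivative (\<lambda>x. frechet_derivative g (at x) v \<bullet> b) (at u)"
      by (rule frechet_derivative_transform_within_open[OF
            smooth_on_differentiable[OF smooth_on_frechet_derivative[OF sm] assms(3)] assms(1,3)]) (rule 1)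
    also have "\<dots> = (\<lambda>w. frechet_derivative (\<lambda>x. frechet_derivative g (at x) v) (at u) w \<bullet> b)"
      by (rule frechet_derivative_compose_linear[OF bl
            smooth_on_differentiable[OF smooth_on_frechet_derivative[OF assms(2)] assms(3)]])
    finally show ?thesis by simp
  qed
  then show "frechet_derivative (\<lambda>x. frechet_derivative g (at x) v) (at u) w \<bullet> b =
      frechet_derivative (\<lambda>x. frechet_derivative g (at x) w) (at u) v \<bullet> b"
    using second_derivative_symmetric_real[OF assms(1) sm assms(3), of v w] by simp
qed


section \<open>Exterior algebra\<close>

definition multilinear :: "'v::real_vector form \<Rightarrow> bool" where
  "multilinear \<omega> \<longleftrightarrow> (\<forall>us vs. linear (\<lambda>v. \<omega> (us @ v # vs)))"

lemma alternating_multilinear: "alternating \<omega> \<Longrightarrow> multilinear \<omega>"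
  by (simp add: alternating_def multilinear_def)

lemma multilinear_linear: "multilinear \<omega> \<Longrightarrow> linear (\<lambda>v. \<omega> (us @ v # vs))"
  by (simp add: multilinear_def)

lemma multilinear_add: "multilinear \<omega> \<Longrightarrow> \<omega> (us @ (v + w) # vs) = \<omega> (us @ v # vs) + \<omega> (us @ w # vs)"
  by (rule linear_add[OF multilinear_linear])

lemma multilinear_scale: "multilinear \<omega> \<Longrightarrow> \<omega> (us @ (r *\<^sub>R v) # vs) = of_real r * \<omega> (us @ v # vs)"
  using linear_scale[OF multilinear_linear[of \<omega> us vs], of r v] by (simp add: scaleR_conv_of_real)

lemma multilinear_sum:
  "multilinear \<omega> \<Longrightarrow> \<omega> (us @ (\<Sum>i\<in>A. f i) # vs) = (\<Sum>i\<in>A. \<omega> (us @ f i # vs))"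
  by (rule linear_sum[OF multilinear_linear])

lemma multilinearI:
  assumes "\<And>us v w vs. \<omega> (us @ (v + w) # vs) = \<omega> (us @ v # vs) + \<omega> (us @ w # vs)"
    and "\<And>us r v vs. \<omega> (us @ (r *\<^sub>R v) # vs) = of_real r * \<omega> (us @ v # vs)"
  shows "multilinear \<omega>"
  unfolding multilinear_def by (intro allI linearI) (simp_all add: assms scaleR_conv_of_real)

lemma alternating_repeat: "alternating \<omega> \<Longrightarrow> \<omega> (us @ v # vs @ v # ws) = 0"
  by (simp add: alternating_def)

lemma adjacent_swap:
  assumes "multilinear \<omega>" "\<And>us v ws. \<omega> (us @ v # v # ws) = 0"
  shows "\<omega> (us @ v # w # ws) = - \<omega> (us @ w # v # ws)"
proof -
  have "0 = \<omega> (us @ (v + w) # (v + w) # ws)" using assms(2) by simp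
  also have "\<dots> = \<omega> (us @ v # (v + w) # ws) + \<omega> (us @ w # (v + w) # ws)"
    by (rule multilinear_add[OF assms(1)])
  also have "\<dots> = \<omega> (us @ v # w # ws) + \<omega> (us @ w # v # ws)"
    using multilinear_add[OF assms(1), of "us @ [v]" v w ws] multilinear_add[OF assms(1), of "us @ [w]" v w ws]
    by (simp add: assms(2))
  finally show ?thesis by (simp add: eq_neg_iff_add_eq_0)
qed

text \<open>A repeated vector is carried next to its twin by neighbouring transpositions, each of
  which only changes the sign. Proofs of alternation then have to treat equal neighbours
  only.\<close>

lemma alternatingI_adjacent:
  assumes "multilinear \<omega>" "\<And>us v ws. \<omega> (us @ v # v # ws) = 0"
  shows "alternating \<omega>"
proof -
  have "\<omega> (us @ v # vs @ v # ws) = 0" for us vs ws v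
  proof (induction vs arbitrary: us)
    case (Cons a vs)
    show ?case
      using adjacent_swap[OF assms, of us v a "vs @ v # ws"] Cons[of "us @ [a]"] by simp
  qed (simp add: assms(2))
  then show ?thesis using assms(1) by (simp add: alternating_def multilinear_def)
qed

lemma alternating_adjacent: "alternating \<omega> \<Longrightarrow> \<omega> (us @ v # v # ws) = 0"
  using alternating_repeat[of \<omega> us v "[]" ws] by simp

lemma alternating_swap: "alternating \<omega> \<Longrightarrow> \<omega> (us @ v # w # ws) = - \<omega> (us @ w # v # ws)"
  by (rule adjacent_swap[OF alternating_multilinear]) (assumption, rule alternating_adjacent)

lemma alternating_move: "alternating \<omega> \<Longrightarrow> \<omega> (us @ v # vs @ ws) = (-1) ^ length vs * \<omega> (us @ vs @ v # ws)"
proof (induction vs arbitrary: us)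
  case (Cons a vs)
  then show ?case
    using alternating_swap[OF Cons.prems, of us v a "vs @ ws"] Cons.IH[of "us @ [a]"] by simp
qed simp

text \<open>Only the vanishing of a value is tracked, since \<open>alternating_move\<close>
  preserves the value up to a sign; no sign of a permutation has to be computed.\<close>

lemma alternating_zero_mset:
  assumes "alternating \<omega>" "mset xs = mset ys"
  shows "\<omega> (pre @ xs) = 0 \<longleftrightarrow> \<omega> (pre @ ys) = 0"
  using assms(2)
proof (induction xs arbitrary: pre ys)
  case (Cons x xs)
  then have "x \<in> set ys" by (metis list.set_intros(1) set_mset_mset)
  then obtain as bs where ys: "ys = as @ x # bs" by (meson split_list)
  then have "mset xs = mset (as @ bs)" using Cons.prems by simp
  then have "\<omega> ((pre @ [x]) @ xs) = 0 \<longleftrightarrow> \<omega> ((pre @ [x]) @ as @ bs) = 0" by (rule Cons.IH)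
  also have "\<dots> \<longleftrightarrow> \<omega> (pre @ ys) = 0"
    using alternating_move[OF assms(1), of pre x as bs] ys by simp
  finally show ?case by simp
qed simp

lemma multilinear_zero_on_span:
  assumes "multilinear \<omega>" "span B = UNIV"
    and "\<And>xs. set xs \<subseteq> B \<Longrightarrow> length xs = n \<Longrightarrow> \<omega> (pre @ xs) = 0"
  shows "length vs = n \<Longrightarrow> \<omega> (pre @ vs) = 0"
  using assms(3)
proof (induction n arbitrary: pre vs)
  case (Suc n)
  obtain v vs' where vs: "vs = v # vs'" "length vs' = n" using Suc.prems(1) by (cases vs) auto
  have "\<omega> (pre @ b # vs') = 0" if "b \<in> B" for b
  proof -
    have "\<omega> ((pre @ [b]) @ xs) = 0" if "set xs \<subseteq> B" "length xs = n" for xs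
      using Suc.prems(2)[of "b # xs"] that \<open>b \<in> B\<close> by simp
    from Suc.IH[OF vs(2) this] show ?thesis by simp
  qed
  then have "\<omega> (pre @ v # vs') = 0"
    using linear_eq_0_on_span[OF multilinear_linear[OF assms(1), of pre vs'], of B v] assms(2) by blast
  then show ?case using vs by simp
next
  case 0
  then show ?case using 0(2)[of vs] by auto
qed

text \<open>Lists with a repetition give zero and reordering does not affect vanishing, so only
  sublists in the order of \<open>bs\<close> are left. The shape \<open>filter P bs\<close> lets a
  basis made of horizontal and vertical vectors be cut into its two halves.\<close>

lemma alternating_zero_on_basis:
  assumes "alternating \<omega>" "distinct bs" "span (set bs) = UNIV"
    and "\<And>P. length (filter P bs) = n \<Longrightarrow> \<omega> (filter P bs) = 0" "length vs = n"
  shows "\<omega> vs = 0"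
proof -
  have "\<omega> xs = 0" if xs: "set xs \<subseteq> set bs" "length xs = n" for xs
  proof (cases "distinct xs")
    case True
    let ?ys = "filter (\<lambda>x. x \<in> set xs) bs"
    have eq: "mset xs = mset ?ys"
      using True assms(2) xs by (subst set_eq_iff_mset_eq_distinct[symmetric]) auto
    then have "length ?ys = n" using xs(2) by (metis size_mset)
    then show ?thesis
      using alternating_zero_mset[OF assms(1) eq, of "[]"] assms(4) by simp
  next
    case False
    then obtain us v vs ws where "xs = us @ [v] @ vs @ [v] @ ws" using not_distinct_decomp by blast
    then show ?thesis using alternating_repeat[OF assms(1), of us v vs ws] by simp
  qed
  then show ?thesis
    using multilinear_zero_on_span[OF alternating_multilinear[OF assms(1)] assms(3), of n "[]" vs] assms(5)
    by simp
qed

section \<open>Wedge products by recursion on the first argument\<close>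

lemma Pow_lessThan_Suc:
  "Pow {..<Suc n} = (`) Suc ` Pow {..<n} \<union> (\<lambda>S. insert 0 (Suc ` S)) ` Pow {..<n}"
proof -
  have "Pow (Suc ` {..<n}) = (`) Suc ` Pow {..<n}" by (rule image_Pow_surj[symmetric]) simp
  then show ?thesis by (simp add: lessThan_Suc_eq_insert_0 Pow_insert image_image)
qed

lemma sum_Pow_lessThan_Suc:
  fixes g :: "nat set \<Rightarrow> 'a::comm_monoid_add"
  shows "(\<Sum>S\<in>Pow {..<Suc n}. g S) = (\<Sum>S\<in>Pow {..<n}. g (Suc ` S)) + (\<Sum>S\<in>Pow {..<n}. g (insert 0 (Suc ` S)))"
proof -
  have i1: "inj_on ((`) Suc) (Pow {..<n})"
    by (auto simp: inj_on_def inj_image_eq_iff)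
  have i2: "inj_on (\<lambda>S. insert 0 (Suc ` S)) (Pow {..<n})"
  proof (rule inj_onI)
    fix S T assume "insert 0 (Suc ` S) = insert 0 (Suc ` T)"
    moreover have "0 \<notin> Suc ` S" "0 \<notin> Suc ` T" by auto
    ultimately have "Suc ` S = Suc ` T" by (metis insert_ident)
    then show "S = T" by (simp add: inj_image_eq_iff)
  qed
  have "(\<Sum>S\<in>Pow {..<Suc n}. g S) = (\<Sum>S\<in>(`) Suc ` Pow {..<n}. g S) + (\<Sum>S\<in>(\<lambda>S. insert 0 (Suc ` S)) ` Pow {..<n}. g S)"
    unfolding Pow_lessThan_Suc by (rule sum.union_disjoint) auto
  then show ?thesis by (simp add: sum.reindex[OF i1] sum.reindex[OF i2] o_def)
qed

text \<open>Position 0 belongs to the second factor and forms an inversion with each element of the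
  shifted S; this is the source of the degree sign in \<open>wedge_Cons\<close>.\<close>

lemma shuffle_sign_Suc_image:
  assumes "S \<subseteq> {..<n}"
  shows "shuffle_sign (Suc ` S) (Suc n) = (-1) ^ card S * shuffle_sign S n"
proof -
  let ?T = "{(i, j). i \<in> S \<and> j \<in> {..<n} - S \<and> j < i}"
  have fin: "finite S" using assms finite_subset by blast
  have finT: "finite ?T" by (rule finite_subset[of _ "S \<times> {..<n}"]) (use fin in auto)
  have eq: "{(i, j). i \<in> Suc ` S \<and> j \<in> {..<Suc n} - Suc ` S \<and> j < i} = (\<lambda>i. (Suc i, 0)) ` S \<union> map_prod Suc Suc ` ?T"
  proof (intro equalityI subsetI)
    fix x assume "x \<in> {(i, j). i \<in> Suc ` S \<and> j \<in> {..<Suc n} - Suc ` S \<and> j < i}"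
    then obtain i j where x: "x = (Suc i, j)" "i \<in> S" "j < Suc n" "j \<notin> Suc ` S" "j < Suc i" by auto
    show "x \<in> (\<lambda>i. (Suc i, 0)) ` S \<union> map_prod Suc Suc ` ?T"
    proof (cases j)
      case (Suc k)
      then have "(i, k) \<in> ?T" using x by auto
      then have "map_prod Suc Suc (i, k) \<in> map_prod Suc Suc ` ?T" by (rule imageI)
      then show ?thesis using x Suc by simp
    qed (use x in auto)
  qed auto
  have "card ((\<lambda>i. (Suc i, 0::nat)) ` S \<union> map_prod Suc Suc ` ?T) = card S + card ?T"
    using fin finT by (subst card_Un_disjoint) (auto simp: card_image inj_on_def)
  then show ?thesis unfolding shuffle_sign_def eq by (simp add: power_add)
qed

lemma shuffle_sign_insert_0:
  assumes "S \<subseteq> {..<n}"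
  shows "shuffle_sign (insert 0 (Suc ` S)) (Suc n) = shuffle_sign S n"
proof -
  let ?T = "{(i, j). i \<in> S \<and> j \<in> {..<n} - S \<and> j < i}"
  have eq: "{(i, j). i \<in> insert 0 (Suc ` S) \<and> j \<in> {..<Suc n} - insert 0 (Suc ` S) \<and> j < i} = map_prod Suc Suc ` ?T"
  proof (intro equalityI subsetI)
    fix x assume "x \<in> {(i, j). i \<in> insert 0 (Suc ` S) \<and> j \<in> {..<Suc n} - insert 0 (Suc ` S) \<and> j < i}"
    then obtain i j where x: "x = (i, j)" "i \<in> Suc ` S" "j < Suc n" "j \<noteq> 0" "j \<notin> Suc ` S" "j < i"
      by (cases x) auto
    then obtain i' k where ik: "i = Suc i'" "i' \<in> S" "j = Suc k" by (cases j) auto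
    with x have "(i', k) \<in> ?T" by auto
    then have "map_prod Suc Suc (i', k) \<in> map_prod Suc Suc ` ?T" by (rule imageI)
    then show "x \<in> map_prod Suc Suc ` ?T" using x ik by simp
  qed auto
  have "card (map_prod Suc Suc ` ?T) = card ?T" by (rule card_image) (auto simp: inj_on_def)
  then show ?thesis unfolding shuffle_sign_def eq by simp
qed

lemma wedge_Nil [simp]: "wedge \<alpha> \<beta> [] = \<alpha> [] * \<beta> []"
  by (simp add: wedge_def shuffle_sign_def)

text \<open>Contraction with a vector is an antiderivation; the sign is that of the degree of \<open>\<alpha>\<close>.\<close>

lemma wedge_Cons:
  "wedge \<alpha> \<beta> (v # vs) = wedge (\<lambda>ws. \<alpha> (v # ws)) \<beta> vs + wedge (\<lambda>ws. (-1) ^ length ws * \<alpha> ws) (\<lambda>ws. \<beta> (v # ws)) vs"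
proof -
  let ?n = "length vs"
  have s: "Suc ` S = {i. i \<in> Suc ` S}" for S by simp
  have e: "{j. Suc j \<in> - Suc ` S} = - S" "{j. Suc j \<in> Suc ` S} = S"
    "{j. Suc j \<notin> Suc ` S} = - S" "{j. Suc j \<in> - insert 0 (Suc ` S)} = - S" "{j. Suc j \<in> insert 0 (Suc ` S)} = S" for S
    by auto
  have l: "length (nths vs S) = card S" if "S \<in> Pow {..<?n}" for S
  proof -
    have "{i. i < ?n \<and> i \<in> S} = S" using that by auto
    then show ?thesis by (simp add: length_nths)
  qed
  show ?thesis
    unfolding wedge_def
    by (simp add: sum_Pow_lessThan_Suc nths_Cons e shuffle_sign_Suc_image shuffle_sign_insert_0 l add.commute
        mult.assoc mult.left_commute)
qed

lemma wedge_add_left: "wedge (\<lambda>ws. \<alpha> ws + \<alpha>' ws) \<beta> vs = wedge \<alpha> \<beta> vs + wedge \<alpha>' \<beta> vs"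
  by (simp add: wedge_def algebra_simps sum.distrib)

lemma wedge_add_right: "wedge \<alpha> (\<lambda>ws. \<beta> ws + \<beta>' ws) vs = wedge \<alpha> \<beta> vs + wedge \<alpha> \<beta>' vs"
  by (simp add: wedge_def algebra_simps sum.distrib)

lemma wedge_scale_left: "wedge (\<lambda>ws. k * \<alpha> ws) \<beta> vs = k * wedge \<alpha> \<beta> vs"
  by (simp add: wedge_def sum_distrib_left ac_simps)

lemma wedge_scale_right: "wedge \<alpha> (\<lambda>ws. k * \<beta> ws) vs = k * wedge \<alpha> \<beta> vs"
  by (simp add: wedge_def sum_distrib_left ac_simps)

lemma wedge_zero_left: "wedge (\<lambda>ws. 0) \<beta> vs = 0"
  by (simp add: wedge_def)

lemma wedge_zero_right: "wedge \<alpha> (\<lambda>ws. 0) vs = 0"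
  by (simp add: wedge_def)

lemma wedge_neg_left: "wedge (\<lambda>ws. - \<alpha> ws) \<beta> vs = - wedge \<alpha> \<beta> vs"
  using wedge_scale_left[of "-1"] by simp

lemma multilinear_contract: "multilinear \<alpha> \<Longrightarrow> multilinear (\<lambda>ws. \<alpha> (v # ws))"
proof -
  assume a: "multilinear \<alpha>"
  show ?thesis
    unfolding multilinear_def
  proof (intro allI)
    fix us vs show "linear (\<lambda>w. \<alpha> (v # us @ w # vs))"
      using multilinear_linear[OF a, of "v # us" vs] by simp
  qed
qed

lemma multilinear_sign: "multilinear \<alpha> \<Longrightarrow> multilinear (\<lambda>ws. (-1) ^ length ws * \<alpha> ws)"
  by (rule multilinearI) (simp_all add: multilinear_add[of \<alpha>] multilinear_scale[of \<alpha>] algebra_simps)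

text \<open>Induction on the position of the slot: by \<open>wedge_Cons\<close> each argument in
  front of it is absorbed into the factors, by contraction or by a degree sign, and both operations
  preserve multilinearity.\<close>

lemma multilinear_wedge:
  assumes "multilinear \<alpha>" "multilinear \<beta>"
  shows "multilinear (wedge \<alpha> \<beta>)"
proof (rule multilinearI)
  fix us vs :: "'a list" and v w :: 'a
  show "wedge \<alpha> \<beta> (us @ (v + w) # vs) = wedge \<alpha> \<beta> (us @ v # vs) + wedge \<alpha> \<beta> (us @ w # vs)"
    using assms
  proof (induction us arbitrary: \<alpha> \<beta>)
    case Nil
    then show ?case
      using multilinear_add[OF Nil(1), of "[]"] multilinear_add[OF Nil(2), of "[]"]
      by (simp add: wedge_Cons wedge_add_left wedge_add_right)
  qed (simp add: wedge_Cons multilinear_contract multilinear_sign)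
next
  fix us vs :: "'a list" and v :: 'a and r
  show "wedge \<alpha> \<beta> (us @ (r *\<^sub>R v) # vs) = of_real r * wedge \<alpha> \<beta> (us @ v # vs)"
    using assms
  proof (induction us arbitrary: \<alpha> \<beta>)
    case Nil
    then show ?case
      using multilinear_scale[OF Nil(1), of "[]"] multilinear_scale[OF Nil(2), of "[]"]
      by (simp add: wedge_Cons wedge_scale_left wedge_scale_right algebra_simps)
  qed (simp add: wedge_Cons multilinear_contract multilinear_sign distrib_left)
qed

lemma alternating_wedge:
  assumes "alternating \<alpha>" "alternating \<beta>"
  shows "alternating (wedge \<alpha> \<beta>)"
proof (rule alternatingI_adjacent)
  show "multilinear (wedge \<alpha> \<beta>)" using assms by (intro multilinear_wedge alternating_multilinear)
  fix us ws :: "'a list" and v :: 'a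
  have "\<And>us v ws. \<alpha> (us @ v # v # ws) = 0" "\<And>us v ws. \<beta> (us @ v # v # ws) = 0"
    using assms[THEN alternating_adjacent] .
  then show "wedge \<alpha> \<beta> (us @ v # v # ws) = 0"
  proof (induction us arbitrary: \<alpha> \<beta>)
    case Nil
    \<comment> \<open>The two terms in which both copies of v meet the same factor vanish; the two
      mixed terms differ by the degree sign and cancel.\<close>
    from Nil(1)[of "[]"] Nil(2)[of "[]"] show ?case
      by (simp add: wedge_Cons wedge_zero_left wedge_zero_right wedge_neg_left)
  next
    case (Cons u us)
    from Cons.prems(1)[of "u # us" for us] Cons.prems(2)[of "u # us" for us] Cons.prems
    show ?case by (simp add: wedge_Cons Cons.IH)
  qed
qed

text \<open>For k = \<i> this is complex linearity in every slot, the property of forms of type (p,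
  0); for a constant map and k = 0 it says that a fixed vector annihilates the form. One induction
  over \<open>wedge\<close> serves both.\<close>

definition slotwise :: "('v \<Rightarrow> 'v) \<Rightarrow> complex \<Rightarrow> 'v form \<Rightarrow> bool" where
  "slotwise I k \<omega> \<longleftrightarrow> (\<forall>us v vs. \<omega> (us @ I v # vs) = k * \<omega> (us @ v # vs))"

lemma slotwise_wedge:
  assumes "slotwise I k \<alpha>" "slotwise I k \<beta>"
  shows "slotwise I k (wedge \<alpha> \<beta>)"
  unfolding slotwise_def
proof (intro allI)
  fix us v vs
  have "(\<And>us v vs. \<alpha> (us @ I v # vs) = k * \<alpha> (us @ v # vs)) \<Longrightarrow>
    (\<And>us v vs. \<beta> (us @ I v # vs) = k * \<beta> (us @ v # vs)) \<Longrightarrow>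
    wedge \<alpha> \<beta> (us @ I v # vs) = k * wedge \<alpha> \<beta> (us @ v # vs)"
  proof (induction us arbitrary: \<alpha> \<beta>)
    case Nil
    from Nil(1)[of "[]"] Nil(2)[of "[]"] show ?case
      by (simp add: wedge_Cons wedge_scale_left wedge_scale_right algebra_simps)
  next
    case (Cons u us)
    from Cons.prems(1)[of "u # us" for us] Cons.prems(2)[of "u # us" for us] Cons.prems
    show ?case by (simp add: wedge_Cons Cons.IH algebra_simps)
  qed
  then show "wedge \<alpha> \<beta> (us @ I v # vs) = k * wedge \<alpha> \<beta> (us @ v # vs)"
    using assms unfolding slotwise_def by blast
qed

lemma wedge_zero_vector:
  assumes "\<And>us vs. \<alpha> (us @ v # vs) = 0" "\<And>us vs. \<beta> (us @ v # vs) = 0"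
  shows "wedge \<alpha> \<beta> (us @ v # vs) = 0"
  using slotwise_wedge[of "\<lambda>_. v" 0 \<alpha> \<beta>] assms by (simp add: slotwise_def)

section \<open>Pullbacks and closure properties of alternating forms\<close>

definition pull :: "('v \<Rightarrow> 'w) \<Rightarrow> 'w form \<Rightarrow> 'v form" where
  "pull T \<omega> vs = \<omega> (map T vs)"

lemma wedge_pull: "wedge (pull T \<alpha>) (pull T \<beta>) vs = wedge \<alpha> \<beta> (map T vs)"
  by (simp add: wedge_def pull_def nths_map)

lemma pull_wedge: "pull T (wedge \<alpha> \<beta>) = wedge (pull T \<alpha>) (pull T \<beta>)"
  by (rule ext) (simp add: wedge_pull, simp add: pull_def)

lemma pull_unit: "pull T unit_form = unit_form"
  by (rule ext) (simp add: pull_def unit_form_def)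

lemma wedge_list_Nil [simp]: "wedge_list [] = unit_form"
  by (simp add: wedge_list_def)

lemma wedge_list_Cons [simp]: "wedge_list (\<alpha> # \<alpha>s) = wedge \<alpha> (wedge_list \<alpha>s)"
  by (simp add: wedge_list_def)

lemma pull_wedge_list: "pull T (wedge_list \<alpha>s) = wedge_list (map (pull T) \<alpha>s)"
  by (induction \<alpha>s) (simp_all add: pull_unit pull_wedge)

lemma alternating_pull: "linear T \<Longrightarrow> alternating \<omega> \<Longrightarrow> alternating (pull T \<omega>)"
  unfolding alternating_def pull_def
  by (auto intro!: linear_compose[of T, unfolded o_def])

lemma alternating_scale:
  assumes "alternating \<omega>" shows "alternating (\<lambda>vs. k * \<omega> vs)"
  by (rule alternatingI_adjacent[OF multilinearI])
    (simp_all add: multilinear_add[OF alternating_multilinear[OF assms]]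
      multilinear_scale[OF alternating_multilinear[OF assms]] alternating_adjacent[OF assms] algebra_simps)

lemma alternating_add:
  assumes "alternating \<omega>" "alternating \<eta>" shows "alternating (\<lambda>vs. \<omega> vs + \<eta> vs)"
  by (rule alternatingI_adjacent[OF multilinearI])
    (simp_all add: assms[THEN alternating_multilinear, THEN multilinear_add]
      assms[THEN alternating_multilinear, THEN multilinear_scale] assms[THEN alternating_adjacent] algebra_simps)

lemma alternating_conj_form:
  assumes "alternating \<omega>" shows "alternating (conj_form \<omega>)"
  unfolding conj_form_def
  by (rule alternatingI_adjacent[OF multilinearI])
    (simp_all add: multilinear_add[OF alternating_multilinear[OF assms]]
      multilinear_scale[OF alternating_multilinear[OF assms]] alternating_adjacent[OF assms])

text \<open>The maps P and Q are arbitrary, so that one notion covers the global projection in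
  \<open>pi_D\<close> and the plain splitting into base and fibre components in a flat
  frame.\<close>

definition split_part :: "('v \<Rightarrow> 'v) \<Rightarrow> ('v \<Rightarrow> 'v) \<Rightarrow> nat \<Rightarrow> 'v form \<Rightarrow> 'v form" where
  "split_part P Q m \<omega> vs = (\<Sum>S\<in>{S. S \<subseteq> {..<length vs} \<and> card S = m}.
     \<omega> (map (\<lambda>i. if i \<in> S then P (vs ! i) else Q (vs ! i)) [0..<length vs]))"

lemma multilinear_binomial:
  assumes "multilinear \<omega>"
  shows "\<omega> (pre @ map (\<lambda>v. t *\<^sub>R P v + Q v) vs) = (\<Sum>S\<in>Pow {..<length vs}. of_real t ^ card S *
     \<omega> (pre @ map (\<lambda>i. if i \<in> S then P (vs ! i) else Q (vs ! i)) [0..<length vs]))"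
proof (induction vs arbitrary: pre)
  case (Cons v vs)
  let ?g = "\<lambda>pre S. of_real t ^ card S * \<omega> (pre @ map (\<lambda>i. if i \<in> S then P (vs ! i) else Q (vs ! i)) [0..<length vs])"
  have m: "map (\<lambda>i. if i \<in> S then P ((v # vs) ! i) else Q ((v # vs) ! i)) [0..<length (v # vs)] =
     (if 0 \<in> S then P v else Q v) # map (\<lambda>i. if Suc i \<in> S then P (vs ! i) else Q (vs ! i)) [0..<length vs]" for S
    unfolding list.size(4) add_Suc_right add_0_right map_upt_Suc by simp
  have c: "card (Suc ` S) = card S" "card (insert 0 (Suc ` S)) = Suc (card S)" if "S \<in> Pow {..<length vs}" for S
  proof -
    have "finite S" using that finite_subset by blast
    then show "card (Suc ` S) = card S" "card (insert 0 (Suc ` S)) = Suc (card S)"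
      by (simp_all add: card_image)
  qed
  have "\<omega> (pre @ map (\<lambda>v. t *\<^sub>R P v + Q v) (v # vs)) =
      of_real t * \<omega> ((pre @ [P v]) @ map (\<lambda>v. t *\<^sub>R P v + Q v) vs) + \<omega> ((pre @ [Q v]) @ map (\<lambda>v. t *\<^sub>R P v + Q v) vs)"
    by (simp add: multilinear_add[OF assms] multilinear_scale[OF assms])
  also have "\<dots> = of_real t * (\<Sum>S\<in>Pow {..<length vs}. ?g (pre @ [P v]) S) + (\<Sum>S\<in>Pow {..<length vs}. ?g (pre @ [Q v]) S)"
    by (simp only: Cons.IH)
  also have "\<dots> = (\<Sum>S\<in>Pow {..<length (v # vs)}. of_real t ^ card S *
     \<omega> (pre @ map (\<lambda>i. if i \<in> S then P ((v # vs) ! i) else Q ((v # vs) ! i)) [0..<length (v # vs)]))"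
    unfolding m by (simp add: sum_Pow_lessThan_Suc c sum_distrib_left mult.assoc image_iff add.commute)
  finally show ?case .
qed simp

text \<open>All slots are expanded at once. Alternation of the parts, their values on sorted lists
  and the effect of scaling are later obtained by comparing powers of t instead of manipulating sums
  over subsets.\<close>

lemma split_part_generating:
  assumes "multilinear \<omega>"
  shows "\<omega> (map (\<lambda>v. t *\<^sub>R P v + Q v) vs) = (\<Sum>m\<le>length vs. split_part P Q m \<omega> vs * of_real t ^ m)"
proof -
  let ?g = "\<lambda>S. of_real t ^ card S * \<omega> (map (\<lambda>i. if i \<in> S then P (vs ! i) else Q (vs ! i)) [0..<length vs])"
  have "\<omega> (map (\<lambda>v. t *\<^sub>R P v + Q v) vs) = (\<Sum>S\<in>Pow {..<length vs}. ?g S)"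
    using multilinear_binomial[OF assms, of "[]"] by simp
  also have "\<dots> = (\<Sum>m\<le>length vs. \<Sum>S\<in>{S\<in>Pow {..<length vs}. card S = m}. ?g S)"
    by (rule sum.group[symmetric]) (auto intro: subset_eq_atLeast0_lessThan_card simp: lessThan_atLeast0)
  also have "\<dots> = (\<Sum>m\<le>length vs. split_part P Q m \<omega> vs * of_real t ^ m)"
    unfolding split_part_def sum_distrib_right
    by (intro sum.cong) (auto simp: mult.commute)
  finally show ?thesis .
qed

text \<open>The variable is real but the coefficients are complex, so the identity is split into two
  real polynomials.\<close>

lemma real_poly_zero_coeffs:
  fixes c :: "nat \<Rightarrow> complex"
  assumes "\<And>t::real. (\<Sum>m\<le>n. c m * of_real t ^ m) = 0" "m \<le> n"
  shows "c m = 0"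
proof -
  have "(\<Sum>m\<le>n. Re (c m) * t ^ m) = Re (\<Sum>m\<le>n. c m * of_real t ^ m)"
    "(\<Sum>m\<le>n. Im (c m) * t ^ m) = Im (\<Sum>m\<le>n. c m * of_real t ^ m)" for t
    by (simp_all flip: of_real_power)
  then have "\<forall>t. (\<Sum>m\<le>n. Re (c m) * t ^ m) = 0" "\<forall>t. (\<Sum>m\<le>n. Im (c m) * t ^ m) = 0"
    by (simp_all add: assms(1))
  then show ?thesis using assms(2) by (simp add: polyfun_eq_0 complex_eq_iff)
qed

lemma split_part_too_large: "length vs < m \<Longrightarrow> split_part P Q m \<omega> vs = 0"
proof -
  assume "length vs < m"
  then have "\<not> (S \<subseteq> {..<length vs} \<and> card S = m)" for S
    using card_mono[of "{..<length vs}" S] by auto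
  then have "{S. S \<subseteq> {..<length vs} \<and> card S = m} = {}" by blast
  then show ?thesis unfolding split_part_def by (simp only: sum.empty)
qed

text \<open>The parts are the coefficients of a polynomial in \<open>t\<close> with values in alternating forms.\<close>

lemma alternating_split_part:
  assumes "alternating \<omega>" "linear P" "linear Q"
  shows "alternating (split_part P Q m \<omega>)"
proof -
  let ?T = "\<lambda>t v. t *\<^sub>R P v + Q v"
  have lin: "linear (?T t)" for t
    using assms(2,3) by (intro linear_compose_add linear_compose_scale_right)
  have alt: "alternating (pull (?T t) \<omega>)" for t
    by (rule alternating_pull[OF lin assms(1)])
  have gen: "pull (?T t) \<omega> vs = (\<Sum>m\<le>length vs. split_part P Q m \<omega> vs * of_real t ^ m)" for t vs
    unfolding pull_def by (rule split_part_generating[OF alternating_multilinear[OF assms(1)]])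
  show ?thesis
  proof (rule alternatingI_adjacent[OF multilinearI])
    fix us vs :: "'a list" and v w :: 'a
    let ?c = "\<lambda>m. split_part P Q m \<omega> (us @ (v + w) # vs) - (split_part P Q m \<omega> (us @ v # vs) + split_part P Q m \<omega> (us @ w # vs))"
    have "(\<Sum>m\<le>length (us @ v # vs). ?c m * of_real t ^ m) = 0" for t
      using gen[of t "us @ (v + w) # vs"] gen[of t "us @ v # vs"] gen[of t "us @ w # vs"]
        multilinear_add[OF alternating_multilinear[OF alt[of t]], of us v w vs]
      by (simp add: algebra_simps sum_subtractf sum.distrib)
    then have "?c m = 0" if "m \<le> length (us @ v # vs)" for m
      using real_poly_zero_coeffs[of ?c "length (us @ v # vs)" m] that by blast
    then show "split_part P Q m \<omega> (us @ (v + w) # vs) = split_part P Q m \<omega> (us @ v # vs) + split_part P Q m \<omega> (us @ w # vs)"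
      by (cases "m \<le> length (us @ v # vs)") (simp_all add: split_part_too_large)
  next
    fix us vs :: "'a list" and v :: 'a and r
    let ?c = "\<lambda>m. split_part P Q m \<omega> (us @ (r *\<^sub>R v) # vs) - of_real r * split_part P Q m \<omega> (us @ v # vs)"
    have "(\<Sum>m\<le>length (us @ v # vs). ?c m * of_real t ^ m) = 0" for t
      using gen[of t "us @ (r *\<^sub>R v) # vs"] gen[of t "us @ v # vs"]
        multilinear_scale[OF alternating_multilinear[OF alt[of t]], of us r v vs]
      by (simp add: algebra_simps sum_subtractf sum_distrib_left)
    then have "?c m = 0" if "m \<le> length (us @ v # vs)" for m
      using real_poly_zero_coeffs[of ?c "length (us @ v # vs)" m] that by blast
    then show "split_part P Q m \<omega> (us @ (r *\<^sub>R v) # vs) = of_real r * split_part P Q m \<omega> (us @ v # vs)"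
      by (cases "m \<le> length (us @ v # vs)") (simp_all add: split_part_too_large)
  next
    fix us ws :: "'a list" and v :: 'a
    let ?xs = "us @ v # v # ws"
    have "(\<Sum>m\<le>length ?xs. split_part P Q m \<omega> ?xs * of_real t ^ m) = 0" for t
      using gen[of t ?xs] alternating_repeat[OF alt, of t us v "[]" ws] by simp
    then have "split_part P Q m \<omega> ?xs = 0" if "m \<le> length ?xs" for m
      using real_poly_zero_coeffs[of "\<lambda>m. split_part P Q m \<omega> ?xs" "length ?xs" m] that by blast
    then show "split_part P Q m \<omega> ?xs = 0"
      by (cases "m \<le> length ?xs") (simp_all add: split_part_too_large)
  qed
qed

text \<open>A map that intertwines the two pairs of projections passes through each summand. It is
  applied to chart changes and to the passage to the flat frame.\<close>

lemma split_part_pull: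
  assumes "\<And>v. D (P v) = P' (D v)" "\<And>v. D (Q v) = Q' (D v)"
  shows "split_part P Q m (pull D \<omega>) vs = split_part P' Q' m \<omega> (map D vs)"
  unfolding split_part_def pull_def
  by (intro sum.cong) (auto simp: o_def assms if_distrib intro!: arg_cong[of _ _ \<omega>])


section \<open>The exterior derivative at a point\<close>

text \<open>Smoothness of a form is known for constant arguments only; moving arguments are expanded
  in \<open>Basis\<close> one at a time, the positions in front being collected in
  \<open>pre\<close>.\<close>

lemma smooth_on_form_args:
  fixes ws :: "('a::real_normed_vector \<Rightarrow> 'e::euclidean_space) list"
  assumes "open U" "\<And>u. u \<in> U \<Longrightarrow> multilinear (\<omega> u)" "\<And>vs. smooth_on U (\<lambda>u. \<omega> u vs)"
    and "\<And>w. w \<in> set ws \<Longrightarrow> smooth_on U w"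
  shows "smooth_on U (\<lambda>u. \<omega> u (pre @ map (\<lambda>w. w u) ws))"
  using assms(4)
proof (induction ws arbitrary: pre)
  case Nil
  show ?case using assms(3) by simp
next
  case (Cons w ws)
  show ?case
  proof (rule smooth_on_cong[OF assms(1)])
    show "smooth_on U (\<lambda>u. \<Sum>b\<in>Basis. (w u \<bullet> b) *\<^sub>R \<omega> u ((pre @ [b]) @ map (\<lambda>w. w u) ws))"
      by (intro smooth_on_sum[OF assms(1)] smooth_on_scaleR[OF assms(1)] smooth_on_inner[OF assms(1)]
          Cons.IH Cons.prems smooth_on_const) simp_all
    fix u assume u: "u \<in> U"
    have "\<omega> u (pre @ w u # map (\<lambda>w. w u) ws) =
        \<omega> u (pre @ (\<Sum>b\<in>Basis. (w u \<bullet> b) *\<^sub>R b) # map (\<lambda>w. w u) ws)"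
      by (simp add: euclidean_representation)
    also have "\<dots> = (\<Sum>b\<in>Basis. (w u \<bullet> b) *\<^sub>R \<omega> u ((pre @ [b]) @ map (\<lambda>w. w u) ws))"
      by (simp only: multilinear_sum[OF assms(2)[OF u]] multilinear_scale[OF assms(2)[OF u]])
        (simp add: scaleR_conv_of_real)
    finally show "(\<Sum>b\<in>Basis. (w u \<bullet> b) *\<^sub>R \<omega> u ((pre @ [b]) @ map (\<lambda>w. w u) ws)) =
        \<omega> u (pre @ map (\<lambda>w. w u) (w # ws))" by simp
  qed
qed

lemma multilinear_derivative:
  assumes "open U" "u \<in> U" "\<And>z. z \<in> U \<Longrightarrow> multilinear (\<omega> z)"
    and "\<And>vs. (\<lambda>z. \<omega> z vs) differentiable (at u)"
  shows "multilinear (\<lambda>vs. frechet_derivative (\<lambda>z. \<omega> z vs) (at u) h)"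
proof (rule multilinearI)
  have d: "((\<lambda>z. \<omega> z vs) has_derivative frechet_derivative (\<lambda>z. \<omega> z vs) (at u)) (at u)" for vs
    using assms(4) by (simp add: frechet_derivative_works)
  fix us vs v w
  have "((\<lambda>z. \<omega> z (us @ v # vs) + \<omega> z (us @ w # vs)) has_derivative
      (\<lambda>h. frechet_derivative (\<lambda>z. \<omega> z (us @ v # vs)) (at u) h + frechet_derivative (\<lambda>z. \<omega> z (us @ w # vs)) (at u) h)) (at u)"
    by (rule has_derivative_add[OF d d])
  then have "((\<lambda>z. \<omega> z (us @ (v + w) # vs)) has_derivative
      (\<lambda>h. frechet_derivative (\<lambda>z. \<omega> z (us @ v # vs)) (at u) h + frechet_derivative (\<lambda>z. \<omega> z (us @ w # vs)) (at u) h)) (at u)"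
    by (rule has_derivative_transform_within_open[OF _ assms(1,2)]) (simp add: multilinear_add[OF assms(3)])
  from frechet_derivative_at[OF this]
  show "frechet_derivative (\<lambda>z. \<omega> z (us @ (v + w) # vs)) (at u) h =
     frechet_derivative (\<lambda>z. \<omega> z (us @ v # vs)) (at u) h + frechet_derivative (\<lambda>z. \<omega> z (us @ w # vs)) (at u) h"
    by (simp add: fun_eq_iff)
  fix r
  have "((\<lambda>z. of_real r * \<omega> z (us @ v # vs)) has_derivative
      (\<lambda>h. of_real r * frechet_derivative (\<lambda>z. \<omega> z (us @ v # vs)) (at u) h)) (at u)"
    by (rule has_derivative_mult_right[OF d])
  then have "((\<lambda>z. \<omega> z (us @ (r *\<^sub>R v) # vs)) has_derivative
      (\<lambda>h. of_real r * frechet_derivative (\<lambda>z. \<omega> z (us @ v # vs)) (at u) h)) (at u)"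
    by (rule has_derivative_transform_within_open[OF _ assms(1,2)]) (simp add: multilinear_scale[OF assms(3)])
  from frechet_derivative_at[OF this]
  show "frechet_derivative (\<lambda>z. \<omega> z (us @ (r *\<^sub>R v) # vs)) (at u) h =
     of_real r * frechet_derivative (\<lambda>z. \<omega> z (us @ v # vs)) (at u) h"
    by (simp add: fun_eq_iff)
qed

text \<open>Product rule: one term from the form and one from each argument. Expanding an argument
  in \<open>Basis\<close> turns its contribution into products of scalar functions with values of
  the form at a fixed vector.\<close>

lemma form_args_has_derivative:
  fixes \<omega> :: "'a::real_normed_vector \<Rightarrow> 'e::euclidean_space form" and B :: "'a \<Rightarrow> 'c \<Rightarrow> 'e"
  assumes U: "open U" "u \<in> U" "\<And>z. z \<in> U \<Longrightarrow> multilinear (\<omega> z)"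
    and d: "\<And>vs. (\<lambda>z. \<omega> z vs) differentiable (at u)"
    and B: "\<And>v. ((\<lambda>z. B z v) has_derivative (\<lambda>h. B' h v)) (at u)"
  shows "((\<lambda>z. \<omega> z (pre @ map (B z) vs)) has_derivative
    (\<lambda>h. frechet_derivative (\<lambda>z. \<omega> z (pre @ map (B u) vs)) (at u) h +
      (\<Sum>i<length vs. \<omega> u (pre @ map (B u) (take i vs) @ B' h (vs ! i) # map (B u) (drop (Suc i) vs))))) (at u)"
proof (induction vs arbitrary: pre)
  case Nil
  show ?case using d[of pre] by (simp add: frechet_derivative_works)
next
  case (Cons v vs)
  let ?D = "\<lambda>pre h. frechet_derivative (\<lambda>z. \<omega> z (pre @ map (B u) vs)) (at u) h +
      (\<Sum>i<length vs. \<omega> u (pre @ map (B u) (take i vs) @ B' h (vs ! i) # map (B u) (drop (Suc i) vs)))"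
  have expand: "\<omega> z (us @ x # ys) = (\<Sum>b\<in>Basis. (x \<bullet> b) *\<^sub>R \<omega> z (us @ b # ys))" if "z \<in> U" for z us x ys
  proof -
    have "\<omega> z (us @ x # ys) = \<omega> z (us @ (\<Sum>b\<in>Basis. (x \<bullet> b) *\<^sub>R b) # ys)"
      by (simp add: euclidean_representation)
    also have "\<dots> = (\<Sum>b\<in>Basis. (x \<bullet> b) *\<^sub>R \<omega> z (us @ b # ys))"
      by (simp only: multilinear_sum[OF U(3)[OF that]] multilinear_scale[OF U(3)[OF that]])
        (simp add: scaleR_conv_of_real)
    finally show ?thesis .
  qed
  have expand_d: "frechet_derivative (\<lambda>z. \<omega> z (us @ x # ys)) (at u) h =
      (\<Sum>b\<in>Basis. (x \<bullet> b) *\<^sub>R frechet_derivative (\<lambda>z. \<omega> z (us @ b # ys)) (at u) h)" for us x ys h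
  proof -
    have ml: "multilinear (\<lambda>vs. frechet_derivative (\<lambda>z. \<omega> z vs) (at u) h)"
      by (rule multilinear_derivative[OF U d])
    have "frechet_derivative (\<lambda>z. \<omega> z (us @ x # ys)) (at u) h =
        frechet_derivative (\<lambda>z. \<omega> z (us @ (\<Sum>b\<in>Basis. (x \<bullet> b) *\<^sub>R b) # ys)) (at u) h"
      by (simp add: euclidean_representation)
    also have "\<dots> = (\<Sum>b\<in>Basis. (x \<bullet> b) *\<^sub>R frechet_derivative (\<lambda>z. \<omega> z (us @ b # ys)) (at u) h)"
      by (simp only: multilinear_sum[OF ml] multilinear_scale[OF ml]) (simp add: scaleR_conv_of_real)
    finally show ?thesis .
  qed
  have "((\<lambda>z. \<Sum>b\<in>Basis. (B z v \<bullet> b) *\<^sub>R \<omega> z ((pre @ [b]) @ map (B z) vs)) has_derivative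
     (\<lambda>h. \<Sum>b\<in>Basis. (B u v \<bullet> b) *\<^sub>R ?D (pre @ [b]) h + (B' h v \<bullet> b) *\<^sub>R \<omega> u ((pre @ [b]) @ map (B u) vs))) (at u)"
    by (intro has_derivative_sum has_derivative_scaleR has_derivative_inner_left B Cons.IH)
  then have "((\<lambda>z. \<omega> z (pre @ map (B z) (v # vs))) has_derivative
     (\<lambda>h. \<Sum>b\<in>Basis. (B u v \<bullet> b) *\<^sub>R ?D (pre @ [b]) h + (B' h v \<bullet> b) *\<^sub>R \<omega> u ((pre @ [b]) @ map (B u) vs))) (at u)"
  proof (rule has_derivative_transform_within_open[OF _ U(1,2)])
    fix z assume "z \<in> U"
    then show "(\<Sum>b\<in>Basis. (B z v \<bullet> b) *\<^sub>R \<omega> z ((pre @ [b]) @ map (B z) vs)) = \<omega> z (pre @ map (B z) (v # vs))"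
      using expand[of z pre "B z v" "map (B z) vs"] by simp
  qed
  moreover have "(\<Sum>b\<in>Basis. (B u v \<bullet> b) *\<^sub>R ?D (pre @ [b]) h + (B' h v \<bullet> b) *\<^sub>R \<omega> u ((pre @ [b]) @ map (B u) vs)) =
      frechet_derivative (\<lambda>z. \<omega> z (pre @ map (B u) (v # vs))) (at u) h +
      (\<Sum>i<length (v # vs). \<omega> u (pre @ map (B u) (take i (v # vs)) @ B' h ((v # vs) ! i) # map (B u) (drop (Suc i) (v # vs))))"
    (is "?L = ?R") for h
  proof -
    have "?L = (\<Sum>b\<in>Basis. (B u v \<bullet> b) *\<^sub>R frechet_derivative (\<lambda>z. \<omega> z (pre @ b # map (B u) vs)) (at u) h) +
      (\<Sum>b\<in>Basis. \<Sum>i<length vs. (B u v \<bullet> b) *\<^sub>R \<omega> u (pre @ b # map (B u) (take i vs) @ B' h (vs ! i) # map (B u) (drop (Suc i) vs))) +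
      (\<Sum>b\<in>Basis. (B' h v \<bullet> b) *\<^sub>R \<omega> u (pre @ b # map (B u) vs))"
      by (simp add: sum.distrib scaleR_add_right scaleR_sum_right add.assoc)
    also have "\<dots> = frechet_derivative (\<lambda>z. \<omega> z (pre @ B u v # map (B u) vs)) (at u) h +
      (\<Sum>i<length vs. \<omega> u (pre @ B u v # map (B u) (take i vs) @ B' h (vs ! i) # map (B u) (drop (Suc i) vs))) +
      \<omega> u (pre @ B' h v # map (B u) vs)"
      by (subst sum.swap) (simp only: expand[OF U(2), symmetric] expand_d[symmetric])
    also have "\<dots> = ?R"
      by (simp add: sum.lessThan_Suc_shift del: sum.lessThan_Suc)
    finally show ?thesis .
  qed
  ultimately show ?case by simp
qed

definition omit :: "nat \<Rightarrow> 'a list \<Rightarrow> 'a list" where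
  "omit i vs = take i vs @ drop (Suc i) vs"

lemma length_omit: "i < length vs \<Longrightarrow> length (omit i vs) = length vs - 1"
  by (auto simp: omit_def)

lemma map_omit: "map f (omit i vs) = omit i (map f vs)"
  by (simp add: omit_def take_map drop_map)

text \<open>The exterior derivative of a family of forms on the model space, detached from charts so
  that it also applies to expressions that exist in one coordinate system only.\<close>

definition alt_deriv :: "('e::real_normed_vector \<Rightarrow> 'e form) \<Rightarrow> 'e \<Rightarrow> 'e form" where
  "alt_deriv \<omega> u vs = (\<Sum>i<length vs. (-1) ^ i * frechet_derivative (\<lambda>z. \<omega> z (omit i vs)) (at u) (vs ! i))"

lemma ext_d_alt_deriv: "ext_d \<omega> c u = alt_deriv (\<omega> c) u"
  by (rule ext) (simp add: ext_d_def alt_deriv_def omit_def)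

lemma alt_deriv_cong:
  assumes "open U" "u \<in> U" "\<And>z vs. z \<in> U \<Longrightarrow> \<omega> z vs = \<eta> z vs"
    and "\<And>vs. (\<lambda>z. \<omega> z vs) differentiable (at u)"
  shows "alt_deriv \<omega> u vs = alt_deriv \<eta> u vs"
  unfolding alt_deriv_def
  by (intro sum.cong refl arg_cong2[of _ _ _ _ "(*)"] fun_cong[OF
        frechet_derivative_transform_within_open[OF assms(4) assms(1,2)]] assms(3))

text \<open>The terms that are cancelled come from the derivatives of the arguments; they cancel in pairs
  when these derivatives are symmetric.\<close>

lemma symmetric_terms_cancel:
  assumes alt: "alternating \<omega>" and sym: "\<And>v w. s v w = s w v"
  shows "(\<Sum>i<length vs. (-1) ^ i * (\<Sum>k<length (omit i vs).
     \<omega> (map f (take k (omit i vs)) @ s (vs ! i) (omit i vs ! k) # map f (drop (Suc k) (omit i vs))))) = 0"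
proof -
  let ?n = "length vs"
  let ?h = "\<lambda>i k. (-1) ^ i * \<omega> (map f (take k (omit i vs)) @ s (vs ! i) (omit i vs ! k) # map f (drop (Suc k) (omit i vs)))"
  let ?A = "{(i, k). i \<le> k \<and> k < ?n - 1}" and ?B = "{(i, k). k < i \<and> i < ?n}"
  have finA: "finite ?A" by (rule finite_subset[of _ "{..<?n} \<times> {..<?n}"]) auto
  have finB: "finite ?B" by (rule finite_subset[of _ "{..<?n} \<times> {..<?n}"]) auto
  \<comment> \<open>\<open>omit i vs\<close> has lost one entry, so for i \<le> k its k-th entry is
    \<open>vs ! Suc k\<close>. The pair (Suc k, i) thus involves the same two vectors in the other
    order, with the inserted vector moved past the k - i vectors between them.\<close>
  have cancel: "?h (Suc k) i = - ?h i k" if "i \<le> k" "k < ?n - 1" for i k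
  proof -
    define a m b where "a = take i vs" and "m = drop (Suc i) (take (Suc k) vs)" and "b = drop (Suc (Suc k)) vs"
    have la: "length a = i" "length m = k - i" using that by (auto simp: a_def m_def)
    have "vs = take (Suc k) vs @ drop (Suc k) vs" by simp
    moreover have "take (Suc k) vs = take i (take (Suc k) vs) @ (take (Suc k) vs) ! i # drop (Suc i) (take (Suc k) vs)"
      using that by (intro id_take_nth_drop) simp
    moreover have "drop (Suc k) vs = vs ! Suc k # drop (Suc (Suc k)) vs"
      using that by (simp add: Cons_nth_drop_Suc)
    ultimately have vs: "vs = a @ vs ! i # m @ vs ! Suc k # b"
      using that unfolding a_def m_def b_def by (simp add: min_def) (metis append.assoc append_Cons)
    define x y where "x = vs ! i" and "y = vs ! Suc k"
    have vs': "vs = a @ x # m @ y # b" using vs by (simp add: x_def y_def)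
    have o1: "omit i vs = a @ m @ y # b" using la by (simp add: vs' omit_def)
    have "Suc k = length (a @ x # m)" using la that by simp
    then have o2: "omit (Suc k) vs = a @ x # m @ b" unfolding vs' omit_def by simp
    have h1: "?h i k = (-1) ^ i * \<omega> (map f a @ map f m @ s x y # map f b)"
    proof -
      have "k = length (a @ m)" using la that by simp
      then have "take k (omit i vs) = a @ m" "omit i vs ! k = y" "drop (Suc k) (omit i vs) = b"
        unfolding o1 by (simp_all add: nth_append)
      then show ?thesis by (simp add: x_def)
    qed
    have h2: "?h (Suc k) i = (-1) ^ Suc k * \<omega> (map f a @ s y x # map f m @ map f b)"
      using la by (simp add: o2 nth_append y_def)
    show ?thesis
      unfolding h1 h2 alternating_move[OF alt] sym[of y x] using la that
      by (simp flip: power_add) (auto simp: le_iff_add minus_one_power_iff)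
  qed
  have "(\<Sum>i<?n. (-1) ^ i * (\<Sum>k<length (omit i vs).
     \<omega> (map f (take k (omit i vs)) @ s (vs ! i) (omit i vs ! k) # map f (drop (Suc k) (omit i vs))))) =
     (\<Sum>i<?n. \<Sum>k<?n - 1. ?h i k)"
    by (simp add: sum_distrib_left length_omit)
  also have "\<dots> = (\<Sum>(i, k)\<in>{..<?n} \<times> {..<?n - 1}. ?h i k)"
    by (simp add: sum.cartesian_product)
  also have "{..<?n} \<times> {..<?n - 1} = ?A \<union> ?B" by auto
  also have "(\<Sum>(i, k)\<in>?A \<union> ?B. ?h i k) = (\<Sum>(i, k)\<in>?A. ?h i k) + (\<Sum>(i, k)\<in>?B. ?h i k)"
    by (rule sum.union_disjoint[OF finA finB]) auto
  also have "(\<Sum>(i, k)\<in>?B. ?h i k) = (\<Sum>(i, k)\<in>?A. ?h (Suc k) i)"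
  proof (rule sum.reindex_bij_witness[of _ "\<lambda>(i, k). (Suc k, i)" "\<lambda>(i, k). (k, i - 1)"])
    fix p assume "p \<in> ?B"
    then obtain i k where p: "p = (Suc i, k)" by (cases p, cases "fst p") auto
    show "(case case p of (i, k) \<Rightarrow> (k, i - 1) of (i, k) \<Rightarrow> ?h (Suc k) i) = (case p of (i, k) \<Rightarrow> ?h i k)"
      unfolding p by simp
  qed auto
  also have "\<dots> = - (\<Sum>(i, k)\<in>?A. ?h i k)"
    unfolding sum_negf[symmetric]
  proof (rule sum.cong[OF refl])
    fix p assume "p \<in> ?A"
    then obtain i k where p: "p = (i, k)" "i \<le> k" "k < ?n - 1" by auto
    show "(case p of (i, k) \<Rightarrow> ?h (Suc k) i) = - (case p of (i, k) \<Rightarrow> ?h i k)"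
      unfolding p(1) prod.case by (rule cancel[OF p(2,3)])
  qed
  finally show ?thesis by simp
qed

text \<open>The field B plays the role of a Jacobian: its derivative is symmetric like a second
  derivative, and this removes all terms in which B is differentiated. It is applied to transition
  maps, and to the shear that removes the connection, where flatness provides the symmetry.\<close>

lemma alt_deriv_pull:
  fixes \<omega> :: "'a::real_normed_vector \<Rightarrow> 'e::euclidean_space form" and B :: "'a \<Rightarrow> 'a \<Rightarrow> 'e"
  assumes U: "open U" "u \<in> U" "\<And>z. z \<in> U \<Longrightarrow> alternating (\<omega> z)"
    and d: "\<And>vs. (\<lambda>z. \<omega> z vs) differentiable (at u)"
    and B: "\<And>v. ((\<lambda>z. B z v) has_derivative (\<lambda>h. B' h v)) (at u)"
    and sym: "\<And>v w. B' v w = B' w v"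
  shows "alt_deriv (\<lambda>z vs. \<omega> z (map (B z) vs)) u vs =
    (\<Sum>i<length vs. (-1) ^ i * frechet_derivative (\<lambda>z. \<omega> z (map (B u) (omit i vs))) (at u) (vs ! i))"
proof -
  have "frechet_derivative (\<lambda>z. \<omega> z (map (B z) xs)) (at u) =
    (\<lambda>h. frechet_derivative (\<lambda>z. \<omega> z (map (B u) xs)) (at u) h +
      (\<Sum>i<length xs. \<omega> u (map (B u) (take i xs) @ B' h (xs ! i) # map (B u) (drop (Suc i) xs))))" for xs
    using form_args_has_derivative[OF U(1,2) alternating_multilinear[OF U(3)] d B, where pre = "[]" and vs = xs]
    by (intro frechet_derivative_at[symmetric]) simp
  then show ?thesis
    using symmetric_terms_cancel[OF U(3)[OF U(2)], where s = B' and vs = vs and f = "B u"] sym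
    by (simp add: alt_deriv_def distrib_left sum.distrib)
qed

lemma omit_split:
  assumes "i \<noteq> length us"
  shows "\<exists>us' vs'. \<forall>x. omit i (us @ x # vs) = us' @ x # vs'"
proof (cases "i < length us")
  case True
  then show ?thesis
    by (intro exI[of _ "omit i us"] exI[of _ vs]) (simp add: omit_def)
next
  case False
  then obtain k where "i = length us + Suc k" using assms
    by (metis less_imp_Suc_add linorder_neqE_nat add_Suc_right)
  then show ?thesis
    by (intro exI[of _ us] exI[of _ "omit k vs"]) (simp add: omit_def)
qed

lemma nth_append_other: "i \<noteq> length us \<Longrightarrow> (us @ x # vs) ! i = (us @ y # vs) ! i"
  by (auto simp: nth_append nth_Cons split: nat.split)

lemma alternating_alt_deriv:
  fixes \<omega> :: "'e::real_normed_vector \<Rightarrow> 'e form"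
  assumes U: "open U" "u \<in> U" "\<And>z. z \<in> U \<Longrightarrow> alternating (\<omega> z)"
    and d: "\<And>vs. (\<lambda>z. \<omega> z vs) differentiable (at u)"
  shows "alternating (alt_deriv \<omega> u)"
proof (rule alternatingI_adjacent[OF multilinearI])
  have ml: "multilinear (\<lambda>vs. frechet_derivative (\<lambda>z. \<omega> z vs) (at u) h)" for h
    by (rule multilinear_derivative[OF U(1,2) alternating_multilinear[OF U(3)] d])
  have lin: "linear (frechet_derivative (\<lambda>z. \<omega> z vs) (at u))" for vs
    using d by (rule linear_frechet_derivative)
  let ?t = "\<lambda>vs i. (-1) ^ i * frechet_derivative (\<lambda>z. \<omega> z (omit i vs)) (at u) (vs ! i)"
  have om: "omit (length us) (us @ x # vs) = us @ vs" for us x vs by (simp add: omit_def)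
  {
    fix us vs v w
    have "?t (us @ (v + w) # vs) i = ?t (us @ v # vs) i + ?t (us @ w # vs) i" for i
    proof (cases "i = length us")
      case True
      then show ?thesis by (simp add: om linear_add[OF lin] distrib_left)
    next
      case False
      from omit_split[OF this, of vs] obtain us' vs' where o: "\<And>x. omit i (us @ x # vs) = us' @ x # vs'" by blast
      have n: "(us @ x # vs) ! i = (us @ v # vs) ! i" for x by (rule nth_append_other[OF False])
      show ?thesis unfolding o n[of "v + w"] n[of w] multilinear_add[OF ml] by (rule distrib_left)
    qed
    then show "alt_deriv \<omega> u (us @ (v + w) # vs) = alt_deriv \<omega> u (us @ v # vs) + alt_deriv \<omega> u (us @ w # vs)"
      unfolding alt_deriv_def by (simp add: sum.distrib)
  next
    fix us vs v r
    have "?t (us @ (r *\<^sub>R v) # vs) i = of_real r * ?t (us @ v # vs) i" for i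
    proof (cases "i = length us")
      case True
      then show ?thesis by (simp add: om linear_scale[OF lin] scaleR_conv_of_real)
    next
      case False
      from omit_split[OF this, of vs] obtain us' vs' where o: "\<And>x. omit i (us @ x # vs) = us' @ x # vs'" by blast
      have n: "(us @ x # vs) ! i = (us @ v # vs) ! i" for x by (rule nth_append_other[OF False])
      show ?thesis unfolding o n[of "r *\<^sub>R v"] multilinear_scale[OF ml] by (rule mult.left_commute)
    qed
    then show "alt_deriv \<omega> u (us @ (r *\<^sub>R v) # vs) = of_real r * alt_deriv \<omega> u (us @ v # vs)"
      unfolding alt_deriv_def by (simp add: sum_distrib_left mult.left_commute del: sum.lessThan_Suc)
  next
    fix us ws :: "'e list" and v :: 'e
    let ?vs = "us @ v # v # ws" and ?p = "length us"
    \<comment> \<open>Omitting any other position leaves both copies of v in place, so the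
      differentiated function vanishes on all of U. The two remaining terms omit one copy each,
      which leaves the same list, and carry opposite signs.\<close>
    have zero: "?t ?vs i = 0" if i: "i \<notin> {?p, Suc ?p}" for i
    proof -
      have "\<exists>as bs cs. omit i ?vs = as @ v # bs @ v # cs"
      proof (cases "i < ?p")
        case True
        then have "omit i ?vs = omit i us @ v # [] @ v # ws" by (simp add: omit_def)
        then show ?thesis by blast
      next
        case False
        then have "i = ?p + Suc (Suc (i - ?p - 2))" using i by auto
        then obtain k where "i = ?p + Suc (Suc k)" by blast
        then have "omit i ?vs = us @ v # [] @ v # omit k ws" by (simp add: omit_def numeral_3_eq_3)
        then show ?thesis by blast
      qed
      then obtain as bs cs where o: "omit i ?vs = as @ v # bs @ v # cs" by blast
      have "((\<lambda>z. \<omega> z (omit i ?vs)) has_derivative (\<lambda>h. 0)) (at u)"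
        by (rule has_derivative_transform_within_open[OF has_derivative_const U(1,2)])
          (simp add: o alternating_repeat[OF U(3)])
      from frechet_derivative_at[OF this, symmetric] show ?thesis by simp
    qed
    have "alt_deriv \<omega> u ?vs = (\<Sum>i\<in>{?p, Suc ?p}. ?t ?vs i)"
      unfolding alt_deriv_def by (rule sum.mono_neutral_right) (use zero in auto)
    also have "\<dots> = 0"
      by (simp add: omit_def nth_append)
    finally show "alt_deriv \<omega> u ?vs = 0" .
  }
qed


section \<open>Differential forms on manifolds\<close>

lemma is_chart_open: "is_chart c \<Longrightarrow> open (fst c)"
  by (cases c) simp

lemma overlapI: "u \<in> fst c \<Longrightarrow> u' \<in> fst c' \<Longrightarrow> snd c u = snd c' u' \<Longrightarrow> u \<in> overlap c c'"
  by (auto simp: overlap_def)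

lemma overlap_fst: "u \<in> overlap c c' \<Longrightarrow> u \<in> fst c"
  by (simp add: overlap_def)

lemma overlap_self: "u \<in> fst c \<Longrightarrow> u \<in> overlap c c"
  by (simp add: overlap_def)

lemma transition_eqI:
  "is_chart c' \<Longrightarrow> u' \<in> fst c' \<Longrightarrow> snd c' u' = snd c u \<Longrightarrow> transition c c' u = u'"
  by (cases c; cases c') (simp add: inv_into_f_eq)

lemma transition_in:
  assumes "is_chart c'" "u \<in> overlap c c'"
  shows "transition c c' u \<in> fst c'" "snd c' (transition c c' u) = snd c u"
proof -
  obtain u' where "u' \<in> fst c'" "snd c' u' = snd c u"
    using assms(2) by (auto simp: overlap_def)
  then show "transition c c' u \<in> fst c'" "snd c' (transition c c' u) = snd c u"
    using transition_eqI[OF assms(1)] by simp_all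
qed

lemma transition_overlap: "is_chart c' \<Longrightarrow> u \<in> overlap c c' \<Longrightarrow> transition c c' u \<in> overlap c' c"
  using transition_in[of c' u c] by (auto intro: overlapI[where u' = u] simp: overlap_fst)

lemma transition_back:
  "is_chart c \<Longrightarrow> is_chart c' \<Longrightarrow> u \<in> overlap c c' \<Longrightarrow> transition c' c (transition c c' u) = u"
  using transition_in[of c' u c] by (intro transition_eqI) (auto simp: overlap_fst)

lemma open_overlap:
  assumes "is_chart c" "is_chart c'"
  shows "open (overlap c c')"
proof -
  obtain U x U' x' where c: "c = (U, x)" "c' = (U', x')" by (cases c; cases c') auto
  have "continuous_on U x" "open U" "open (x' ` U')"
    using assms by (auto simp: c homeomorphism_def)
  then have "open (x -` (x' ` U') \<inter> U)"
    by (metis continuous_on_open_vimage)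
  moreover have "overlap c c' = x -` (x' ` U') \<inter> U"
    by (auto simp: overlap_def c)
  ultimately show ?thesis by simp
qed

lemma smooth_structure_chart: "smooth_structure \<A> \<Longrightarrow> c \<in> \<A> \<Longrightarrow> is_chart c"
  by (simp add: smooth_structure_def)

lemma smooth_transition:
  "smooth_structure \<A> \<Longrightarrow> c \<in> \<A> \<Longrightarrow> c' \<in> \<A> \<Longrightarrow> smooth_on (overlap c c') (transition c c')"
  by (simp add: smooth_structure_def smoothly_compatible_def)

lemma chart_jacobian_has_derivative:
  "smooth_structure \<A> \<Longrightarrow> c \<in> \<A> \<Longrightarrow> c' \<in> \<A> \<Longrightarrow> u \<in> overlap c c' \<Longrightarrow>
    (transition c c' has_derivative chart_jacobian c c' u) (at u)"
  unfolding chart_jacobian_def by (rule smooth_on_has_derivative[OF smooth_transition])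

lemma linear_chart_jacobian:
  "smooth_structure \<A> \<Longrightarrow> c \<in> \<A> \<Longrightarrow> c' \<in> \<A> \<Longrightarrow> u \<in> overlap c c' \<Longrightarrow> linear (chart_jacobian c c' u)"
  using chart_jacobian_has_derivative has_derivative_linear by blast

lemma overlap_triple:
  "is_chart c' \<Longrightarrow> u \<in> overlap c c' \<Longrightarrow> u \<in> overlap c c'' \<Longrightarrow> transition c c' u \<in> overlap c' c''"
  using transition_in[of c' u c] by (auto simp: overlap_def)

lemma transition_triple:
  assumes "is_chart c'" "is_chart c''" "u \<in> overlap c c'" "u \<in> overlap c c''"
  shows "transition c' c'' (transition c c' u) = transition c c'' u"
  using transition_in[OF assms(1,3)] transition_in[OF assms(2,4)]
  by (intro transition_eqI[OF assms(2)]) auto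

lemma chart_jacobian_chain:
  assumes A: "smooth_structure \<A>" "c \<in> \<A>" "c' \<in> \<A>" "c'' \<in> \<A>" and u: "u \<in> overlap c c'" "u \<in> overlap c c''"
  shows "chart_jacobian c c'' u v = chart_jacobian c' c'' (transition c c' u) (chart_jacobian c c' u v)"
proof -
  have ch: "is_chart c" "is_chart c'" "is_chart c''" using smooth_structure_chart[OF A(1)] A(2-) by blast+
  have "((\<lambda>z. transition c' c'' (transition c c' z)) has_derivative
      (\<lambda>v. chart_jacobian c' c'' (transition c c' u) (chart_jacobian c c' u v))) (at u)"
    by (rule has_derivative_compose[OF chart_jacobian_has_derivative[OF A(1,2,3) u(1)]
          chart_jacobian_has_derivative[OF A(1,3,4) overlap_triple[OF ch(2) u]]])
  then have "(transition c c'' has_derivative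
      (\<lambda>v. chart_jacobian c' c'' (transition c c' u) (chart_jacobian c c' u v))) (at u)"
    by (rule has_derivative_transform_within_open[where s = "overlap c c' \<inter> overlap c c''"])
      (use ch u in \<open>auto simp: open_overlap transition_triple\<close>)
  from has_derivative_unique[OF this chart_jacobian_has_derivative[OF A(1,2,4) u(2)]]
  show ?thesis by metis
qed

text \<open>Torus charts restrict one map to different balls of angles; between two of them the
  coordinates do not change.\<close>

lemma chart_jacobian_same_map:
  assumes "is_chart (U, x)" "is_chart (U', x)" "u \<in> U" "u \<in> U'"
  shows "transition (U, x) (U', x) u = u" "chart_jacobian (U, x) (U', x) u = (\<lambda>v. v)"
proof -
  have tr: "transition (U, x) (U', x) z = z" if "z \<in> U \<inter> U'" for z
    using that by (intro transition_eqI[OF assms(2)]) auto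
  show "transition (U, x) (U', x) u = u" using tr assms by simp
  have "(transition (U, x) (U', x) has_derivative (\<lambda>v. v)) (at u)"
    by (rule has_derivative_transform_within_open[OF has_derivative_ident, of "U \<inter> U'"])
      (use assms in \<open>auto simp: tr\<close>)
  then show "chart_jacobian (U, x) (U', x) u = (\<lambda>v. v)"
    unfolding chart_jacobian_def by (rule frechet_derivative_at[symmetric])
qed

lemma chart_jacobian_back:
  assumes A: "smooth_structure \<A>" "c \<in> \<A>" "c' \<in> \<A>" and u: "u \<in> overlap c c'"
  shows "chart_jacobian c' c (transition c c' u) (chart_jacobian c c' u v) = v"
    and "chart_jacobian c c' u (chart_jacobian c' c (transition c c' u) v) = v"
proof -
  have ch: "is_chart c" "is_chart c'" using smooth_structure_chart[OF A(1)] A(2-) by blast+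
  have self: "chart_jacobian c c u = (\<lambda>v. v)" if "is_chart c" "u \<in> fst c" for c :: "('a, 'b) chart" and u
    using chart_jacobian_same_map(2)[of "fst c" "snd c" "fst c" u] that by simp
  have u': "transition c c' u \<in> overlap c' c" by (rule transition_overlap[OF ch(2) u])
  show "chart_jacobian c' c (transition c c' u) (chart_jacobian c c' u v) = v"
    using chart_jacobian_chain[OF A(1,2,3,2) u overlap_self[OF overlap_fst[OF u]], of v]
    by (simp add: self[OF ch(1) overlap_fst[OF u]])
  show "chart_jacobian c c' u (chart_jacobian c' c (transition c c' u) v) = v"
    using chart_jacobian_chain[OF A(1,3,2,3) u' overlap_self[OF overlap_fst[OF u']], of v]
    by (simp add: self[OF ch(2) overlap_fst[OF u']] transition_back[OF ch u])
qed

lemma bij_chart_jacobian: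
  assumes "smooth_structure \<A>" "c \<in> \<A>" "c' \<in> \<A>" "u \<in> overlap c c'"
  shows "bij (chart_jacobian c c' u)"
  by (rule o_bij[of "chart_jacobian c' c (transition c c' u)"])
    (auto simp: fun_eq_iff chart_jacobian_back[OF assms])

section \<open>Local criteria and naturality for differential forms\<close>

lemma diff_form_alternating: "diff_form \<A> \<omega> \<Longrightarrow> c \<in> \<A> \<Longrightarrow> u \<in> fst c \<Longrightarrow> alternating (\<omega> c u)"
  by (simp add: diff_form_def everywhere_def)

lemma diff_form_smooth: "diff_form \<A> \<omega> \<Longrightarrow> c \<in> \<A> \<Longrightarrow> smooth_on (fst c) (\<lambda>u. \<omega> c u vs)"
  by (simp add: diff_form_def)

lemma diff_form_transition:
  "diff_form \<A> \<omega> \<Longrightarrow> c \<in> \<A> \<Longrightarrow> c' \<in> \<A> \<Longrightarrow> u \<in> overlap c c' \<Longrightarrow>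
    \<omega> c u vs = \<omega> c' (transition c c' u) (map (chart_jacobian c c' u) vs)"
  by (simp add: diff_form_def)

lemma diff_form_differentiable:
  "diff_form \<A> \<omega> \<Longrightarrow> c \<in> \<A> \<Longrightarrow> u \<in> fst c \<Longrightarrow> (\<lambda>u. \<omega> c u vs) differentiable at u"
  using diff_form_smooth smooth_on_differentiable by blast

lemma smooth_near_transition:
  fixes f :: "'e::euclidean_space \<Rightarrow> 'a::real_normed_vector"
  assumes A: "smooth_structure \<A>" "c \<in> \<A>" "c' \<in> \<A>" and u: "u \<in> overlap c c'"
    and V: "open V" "transition c c' u \<in> V" "smooth_on V f"
  obtains W where "open W" "u \<in> W" "W \<subseteq> overlap c c'" "\<And>z. z \<in> W \<Longrightarrow> transition c c' z \<in> V"
    "smooth_on W (\<lambda>z. f (transition c c' z))"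
proof -
  have op: "open (overlap c c')" using A smooth_structure_chart open_overlap by blast
  have sm: "smooth_on (overlap c c') (transition c c')" by (rule smooth_transition[OF A])
  let ?W = "transition c c' -` V \<inter> overlap c c'"
  have W: "open ?W"
    using smooth_on_continuous[OF sm] op V(1) by (metis continuous_on_open_vimage)
  have "smooth_on ?W (\<lambda>z. f (transition c c' z))"
    by (rule smooth_on_compose[OF W V(1,3) smooth_on_subset[OF sm]]) auto
  then show ?thesis using that[of ?W] W u V by auto
qed

text \<open>The atlas is maximal, so explicit formulas are available in few of its charts. The
  transformation law carries smoothness from one convenient chart near each point to all
  others.\<close>

lemma diff_formI_local:
  fixes \<A> :: "('e::euclidean_space, 'm::topological_space) chart set"
  assumes A: "smooth_structure \<A>"
    and alt: "\<And>c u. c \<in> \<A> \<Longrightarrow> u \<in> fst c \<Longrightarrow> alternating (\<omega> c u)"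
    and law: "\<And>c c' u vs. c \<in> \<A> \<Longrightarrow> c' \<in> \<A> \<Longrightarrow> u \<in> overlap c c' \<Longrightarrow>
        \<omega> c u vs = \<omega> c' (transition c c' u) (map (chart_jacobian c c' u) vs)"
    and loc: "\<And>m. \<exists>c u V. c \<in> \<A> \<and> u \<in> fst c \<and> snd c u = m \<and> open V \<and> u \<in> V \<and> V \<subseteq> fst c \<and> (\<forall>vs. smooth_on V (\<lambda>z. \<omega> c z vs))"
  shows "diff_form \<A> \<omega>"
proof -
  have "smooth_on (fst c) (\<lambda>u. \<omega> c u vs)" if c: "c \<in> \<A>" for c vs
  proof (rule smooth_on_local)
    fix u assume u: "u \<in> fst c"
    obtain c' u' V where c': "c' \<in> \<A>" "u' \<in> fst c'" "snd c' u' = snd c u" "open V" "u' \<in> V" "V \<subseteq> fst c'"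
      "\<forall>vs. smooth_on V (\<lambda>z. \<omega> c' z vs)"
      using loc[of "snd c u"] by (elim exE conjE) (rule that)
    have ov: "u \<in> overlap c c'" using u c' by (intro overlapI[of _ _ u']) auto
    have t: "transition c c' u \<in> V"
      using transition_eqI[OF smooth_structure_chart[OF A c'(1)] c'(2,3)] c'(5) by simp
    \<comment> \<open>Only the neighbourhood W is wanted here; the constant function is a
      placeholder.\<close>
    obtain W where W: "open W" "u \<in> W" "W \<subseteq> overlap c c'" "\<And>z. z \<in> W \<Longrightarrow> transition c c' z \<in> V"
      by (rule smooth_near_transition[OF A c c'(1) ov c'(4) t smooth_on_const[of V "0::real"]])
        (rule that)
    have V: "smooth_on W (\<lambda>z. \<omega> c' (transition c c' z) xs)" for xs
      by (rule smooth_on_compose[OF W(1) c'(4) spec[OF c'(7)] smooth_on_subset[OF smooth_transition[OF A c c'(1)] W(3)]])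
        (use W(4) in auto)
    have "smooth_on W (\<lambda>z. \<omega> c' (transition c c' z) ([] @ map (\<lambda>w. w z) (map (\<lambda>v z. chart_jacobian c c' z v) vs)))"
    proof (rule smooth_on_form_args[OF W(1) _ V])
      fix z assume "z \<in> W"
      then show "multilinear (\<omega> c' (transition c c' z))"
        using W(4) c'(6) by (intro alternating_multilinear alt[OF c'(1)]) auto
    next
      fix w assume "w \<in> set (map (\<lambda>v z. chart_jacobian c c' z v) vs)"
      then obtain v where w: "w = (\<lambda>z. chart_jacobian c c' z v)" by auto
      show "smooth_on W w"
        unfolding w chart_jacobian_def
        by (rule smooth_on_subset[OF smooth_on_frechet_derivative[OF smooth_transition[OF A c c'(1)]] W(3)])
    qed
    then have "smooth_on W (\<lambda>z. \<omega> c z vs)"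
    proof (rule smooth_on_cong[OF W(1), rotated])
      fix z assume "z \<in> W"
      then have "z \<in> overlap c c'" using W(3) by auto
      from law[OF c c'(1) this, of vs]
      show "\<omega> c' (transition c c' z) ([] @ map (\<lambda>w. w z) (map (\<lambda>v z. chart_jacobian c c' z v) vs)) = \<omega> c z vs"
        by (simp add: o_def)
    qed
    then show "\<exists>T. open T \<and> u \<in> T \<and> smooth_on T (\<lambda>u. \<omega> c u vs)" using W by blast
  qed
  then show ?thesis using alt law by (simp add: diff_form_def everywhere_def)
qed

lemma smooth_funI_local:
  fixes \<A> :: "('e::euclidean_space, 'm::topological_space) chart set"
  assumes A: "smooth_structure \<A>"
    and loc: "\<And>m. \<exists>c u V. c \<in> \<A> \<and> u \<in> fst c \<and> snd c u = m \<and> open V \<and> u \<in> V \<and> V \<subseteq> fst c \<and> smooth_on V (\<lambda>z. h (snd c z))"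
  shows "smooth_fun \<A> h"
proof -
  have "smooth_on (fst c) (\<lambda>u. h (snd c u))" if c: "c \<in> \<A>" for c
  proof (rule smooth_on_local)
    fix u assume u: "u \<in> fst c"
    obtain c' u' V where c': "c' \<in> \<A>" "u' \<in> fst c'" "snd c' u' = snd c u" "open V" "u' \<in> V" "V \<subseteq> fst c'"
      "smooth_on V (\<lambda>z. h (snd c' z))"
      using loc[of "snd c u"] by (elim exE conjE) (rule that)
    have ov: "u \<in> overlap c c'" using u c' by (intro overlapI[of _ _ u']) auto
    have ch: "is_chart c'" using smooth_structure_chart[OF A c'(1)] .
    have t: "transition c c' u \<in> V"
      using transition_eqI[OF ch c'(2,3)] c'(5) by simp
    obtain W where W: "open W" "u \<in> W" "W \<subseteq> overlap c c'" "smooth_on W (\<lambda>z. h (snd c' (transition c c' z)))"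
      by (rule smooth_near_transition[OF A c c'(1) ov c'(4) t c'(7)])
    then have "smooth_on W (\<lambda>z. h (snd c z))"
      by (intro smooth_on_cong[OF W(1) _ W(4)]) (auto simp: transition_in[OF ch])
    then show "\<exists>T. open T \<and> u \<in> T \<and> smooth_on T (\<lambda>u. h (snd c u))" using W by blast
  qed
  then show ?thesis unfolding smooth_fun_def o_def by fastforce
qed

lemma smooth_funD: "smooth_fun \<A> h \<Longrightarrow> c \<in> \<A> \<Longrightarrow> smooth_on (fst c) (\<lambda>u. h (snd c u))"
  unfolding smooth_fun_def o_def by (cases c) auto

text \<open>The arguments of the transformed form depend on the point through the Jacobian. The
  derivative of the Jacobian is a second derivative of the transition map, hence symmetric, and
  drops out by \<open>alt_deriv_pull\<close>.\<close>

lemma ext_d_transition: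
  fixes \<A> :: "('e::euclidean_space, 'm::topological_space) chart set"
  assumes A: "smooth_structure \<A>" "c \<in> \<A>" "c' \<in> \<A>" and w: "diff_form \<A> \<omega>" and u: "u \<in> overlap c c'"
  shows "ext_d \<omega> c u vs = ext_d \<omega> c' (transition c c' u) (map (chart_jacobian c c' u) vs)"
proof -
  have ch: "is_chart c" "is_chart c'" using smooth_structure_chart[OF A(1)] A(2-) by blast+
  have op: "open (overlap c c')" using open_overlap[OF ch] .
  have sm: "smooth_on (overlap c c') (transition c c')" by (rule smooth_transition[OF A])
  have d': "(\<lambda>z. \<omega> c' z xs) differentiable at (transition c c' u)" for xs
    using diff_form_differentiable[OF w A(3)] transition_in[OF ch(2) u] by blast
  have der: "((\<lambda>z. \<omega> c' (transition c c' z) xs) has_derivative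
      (\<lambda>h. frechet_derivative (\<lambda>z. \<omega> c' z xs) (at (transition c c' u)) (chart_jacobian c c' u h))) (at u)" for xs
    by (rule has_derivative_compose[OF chart_jacobian_has_derivative[OF A u]])
      (use d' in \<open>simp add: frechet_derivative_works\<close>)
  let ?B' = "\<lambda>h v. frechet_derivative (\<lambda>z. chart_jacobian c c' z v) (at u) h"
  have "ext_d \<omega> c u vs = alt_deriv (\<lambda>z vs. \<omega> c' (transition c c' z) (map (chart_jacobian c c' z) vs)) u vs"
    unfolding ext_d_alt_deriv
    by (rule alt_deriv_cong[OF op u diff_form_transition[OF w A(2,3)]
          diff_form_differentiable[OF w A(2) overlap_fst[OF u]]])
  also have "\<dots> = (\<Sum>i<length vs. (-1) ^ i * frechet_derivative
      (\<lambda>z. \<omega> c' (transition c c' z) (map (chart_jacobian c c' u) (omit i vs))) (at u) (vs ! i))"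
  proof (rule alt_deriv_pull[OF op u])
    show "alternating (\<omega> c' (transition c c' z))" if "z \<in> overlap c c'" for z
      using diff_form_alternating[OF w A(3)] transition_in[OF ch(2) that] by blast
    show "(\<lambda>z. \<omega> c' (transition c c' z) xs) differentiable at u" for xs
      using der[of xs] by (auto simp: differentiable_def)
    show "((\<lambda>z. chart_jacobian c c' z v) has_derivative (\<lambda>h. ?B' h v)) (at u)" for v
      unfolding chart_jacobian_def
      by (rule smooth_on_has_derivative[OF smooth_on_frechet_derivative[OF sm] u])
    show "?B' v w = ?B' w v" for v w
      unfolding chart_jacobian_def by (rule second_derivative_symmetric[OF op sm u])
  qed
  also have "\<dots> = (\<Sum>i<length vs. (-1) ^ i * frechet_derivative (\<lambda>z. \<omega> c' z (map (chart_jacobian c c' u) (omit i vs)))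
      (at (transition c c' u)) (chart_jacobian c c' u (vs ! i)))"
    by (simp add: frechet_derivative_at[OF der, symmetric])
  also have "\<dots> = ext_d \<omega> c' (transition c c' u) (map (chart_jacobian c c' u) vs)"
    by (simp add: ext_d_alt_deriv alt_deriv_def map_omit)
  finally show ?thesis .
qed

lemma diff_form_ext_d:
  fixes \<A> :: "('e::euclidean_space, 'm::topological_space) chart set"
  assumes A: "smooth_structure \<A>" and w: "diff_form \<A> \<omega>"
  shows "diff_form \<A> (ext_d \<omega>)"
  unfolding diff_form_def everywhere_def
proof (intro conjI ballI allI)
  fix c u assume c: "c \<in> \<A>" "u \<in> fst c"
  show "alternating (ext_d \<omega> c u)"
    unfolding ext_d_alt_deriv
    by (rule alternating_alt_deriv[OF is_chart_open[OF smooth_structure_chart[OF A c(1)]] c(2)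
          diff_form_alternating[OF w c(1)] diff_form_differentiable[OF w c]])
next
  fix c vs assume c: "c \<in> \<A>"
  have op: "open (fst c)" using is_chart_open[OF smooth_structure_chart[OF A c(1)]] .
  show "smooth_on (fst c) (\<lambda>u. ext_d \<omega> c u vs)"
    unfolding ext_d_def
    by (intro smooth_on_sum[OF op] smooth_on_mult[OF op] smooth_on_const smooth_on_frechet_derivative
        diff_form_smooth[OF w c])
qed (rule ext_d_transition[OF A _ _ w])

lemma closed_dformI_local:
  fixes \<A> :: "('e::euclidean_space, 'm::topological_space) chart set"
  assumes A: "smooth_structure \<A>" and w: "diff_form \<A> \<omega>"
    and loc: "\<And>m. \<exists>c u. c \<in> \<A> \<and> u \<in> fst c \<and> snd c u = m \<and> (\<forall>vs. ext_d \<omega> c u vs = 0)"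
  shows "closed_dform \<A> \<omega>"
  unfolding closed_dform_def form_eq_def everywhere_def
proof (intro ballI ext)
  fix c u vs assume c: "c \<in> \<A>" "u \<in> fst c"
  obtain c' u' where c': "c' \<in> \<A>" "u' \<in> fst c'" "snd c' u' = snd c u" "\<forall>vs. ext_d \<omega> c' u' vs = 0"
    using loc[of "snd c u"] by (elim exE conjE) (rule that)
  have "u \<in> overlap c c'" using c c' by (intro overlapI[of _ _ u']) auto
  moreover have "transition c c' u = u'"
    by (rule transition_eqI[OF smooth_structure_chart[OF A c'(1)] c'(2,3)])
  ultimately show "ext_d \<omega> c u vs = zero_dform c u vs"
    using ext_d_transition[OF A c(1) c'(1) w] c'(4) by (simp add: zero_dform_def)
qed

lemma diff_form_scale:
  assumes A: "smooth_structure \<A>" and w: "diff_form \<A> \<omega>" and h: "smooth_fun \<A> h"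
  shows "diff_form \<A> (scale_dform h \<omega>)"
  unfolding diff_form_def everywhere_def scale_dform_def
proof (intro conjI ballI allI)
  fix c u assume c: "c \<in> \<A>" "u \<in> fst c"
  show "alternating (\<lambda>vs. h (snd c u) * \<omega> c u vs)"
    by (rule alternating_scale[OF diff_form_alternating[OF w c]])
next
  fix c vs assume c: "c \<in> \<A>"
  have op: "open (fst c)" using is_chart_open[OF smooth_structure_chart[OF A c(1)]] .
  show "smooth_on (fst c) (\<lambda>u. h (snd c u) * \<omega> c u vs)"
    by (rule smooth_on_mult[OF op smooth_funD[OF h c] diff_form_smooth[OF w c]])
next
  fix c c' u vs assume c: "c \<in> \<A>" "c' \<in> \<A>" "u \<in> overlap c c'"
  show "h (snd c u) * \<omega> c u vs =
      h (snd c' (transition c c' u)) * \<omega> c' (transition c c' u) (map (chart_jacobian c c' u) vs)"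
    by (simp add: transition_in(2)[OF smooth_structure_chart[OF A c(2)] c(3)] flip: diff_form_transition[OF w c])
qed

lemma diff_form_add:
  assumes A: "smooth_structure \<A>" and w: "diff_form \<A> \<omega>" "diff_form \<A> \<eta>"
  shows "diff_form \<A> (add_dform \<omega> \<eta>)"
  unfolding diff_form_def everywhere_def add_dform_def
proof (intro conjI ballI allI)
  fix c u assume c: "c \<in> \<A>" "u \<in> fst c"
  show "alternating (\<lambda>vs. \<omega> c u vs + \<eta> c u vs)"
    by (intro alternating_add diff_form_alternating[OF _ c] w)
next
  fix c vs assume c: "c \<in> \<A>"
  have op: "open (fst c)" using is_chart_open[OF smooth_structure_chart[OF A c(1)]] .
  show "smooth_on (fst c) (\<lambda>u. \<omega> c u vs + \<eta> c u vs)"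
    by (intro smooth_on_add[OF op] diff_form_smooth[OF _ c] w)
next
  fix c c' u vs assume c: "c \<in> \<A>" "c' \<in> \<A>" "u \<in> overlap c c'"
  show "\<omega> c u vs + \<eta> c u vs = \<omega> c' (transition c c' u) (map (chart_jacobian c c' u) vs) +
      \<eta> c' (transition c c' u) (map (chart_jacobian c c' u) vs)"
    by (simp flip: diff_form_transition[OF w(1) c] diff_form_transition[OF w(2) c])
qed


section \<open>The almost complex structure of a decomposable form\<close>

lemma wedge_unit_left: "wedge unit_form \<beta> vs = \<beta> vs"
proof (induction vs arbitrary: \<beta>)
  case (Cons v vs)
  have "(\<lambda>ws. (-1) ^ length ws * unit_form ws) = (unit_form :: 'a form)"
    by (auto simp: unit_form_def)
  moreover have "(\<lambda>ws. unit_form (v # ws)) = (\<lambda>ws. 0)"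
    by (simp add: unit_form_def)
  ultimately show ?case by (simp add: wedge_Cons Cons wedge_zero_left)
qed (simp add: unit_form_def)

lemma wedge_zero_sublists:
  assumes "\<And>S. \<alpha> (nths vs S) = 0" shows "wedge \<alpha> \<beta> vs = 0"
  by (simp add: wedge_def assms)

text \<open>For a pair e, f that J does not link to the other arguments, either J consumes both
  vectors or the other factor does. Repeated use evaluates powers of J on a symplectic
  basis.\<close>

lemma wedge_pair:
  assumes J: "has_degree 2 J" and orth: "\<forall>x\<in>set vs. J [e, x] = 0 \<and> J [f, x] = 0"
  shows "wedge J \<beta> (e # f # vs) = J [e, f] * \<beta> vs + wedge J (\<lambda>ws. \<beta> (e # f # ws)) vs"
proof -
  have z: "J (x # nths vs S) = 0" if "x = e \<or> x = f" for x S
  proof (cases "length (nths vs S) = 1")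
    case True
    then obtain y where y: "nths vs S = [y]" by (cases "nths vs S") auto
    then have "y \<in> set vs" using set_nths_subset[of vs S] by auto
    then show ?thesis using orth that y by auto
  next
    case False
    then show ?thesis using J by (simp add: has_degree_def)
  qed
  have u: "(\<lambda>ws. J (e # f # ws)) = (\<lambda>ws. J [e, f] * unit_form ws)"
    using J by (auto simp: fun_eq_iff has_degree_def unit_form_def)
  have s: "(\<lambda>ws. (-1) ^ length ws * ((-1) ^ length ws * J ws)) = J"
    by (simp add: fun_eq_iff mult.assoc[symmetric] power_mult_distrib[symmetric])
  have "wedge (\<lambda>ws. (-1) ^ length ws * J (e # ws)) (\<lambda>ws. \<beta> (f # ws)) vs = 0"
    by (rule wedge_zero_sublists) (simp add: z)
  moreover have "wedge (\<lambda>ws. (-1) ^ length (f # ws) * J (f # ws)) (\<lambda>ws. \<beta> (e # ws)) vs = 0"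
    by (rule wedge_zero_sublists) (simp add: z)
  ultimately show ?thesis
    by (simp add: wedge_Cons u s wedge_scale_left wedge_unit_left)
qed

lemma wedge_one_Cons:
  assumes "is_one_form \<alpha>"
  shows "wedge \<alpha> \<beta> (v # vs) = \<alpha> [v] * \<beta> vs - wedge \<alpha> (\<lambda>ws. \<beta> (v # ws)) vs"
proof -
  have u: "(\<lambda>ws. \<alpha> (v # ws)) = (\<lambda>ws. \<alpha> [v] * unit_form ws)"
    using assms by (auto simp: fun_eq_iff is_one_form_def has_degree_def unit_form_def)
  have s: "(\<lambda>ws. (-1) ^ length ws * \<alpha> ws) = (\<lambda>ws. - \<alpha> ws)"
  proof
    fix ws show "(-1) ^ length ws * \<alpha> ws = - \<alpha> ws"
      using assms by (cases "length ws = 1") (auto simp: is_one_form_def has_degree_def)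
  qed
  show ?thesis by (simp add: wedge_Cons u s wedge_scale_left wedge_unit_left wedge_neg_left)
qed

lemma wedge_one_Nil: "is_one_form \<alpha> \<Longrightarrow> wedge \<alpha> \<beta> [] = 0"
  by (simp add: is_one_form_def has_degree_def)

lemma wedge_diff_right: "wedge \<alpha> (\<lambda>ws. \<beta> ws - \<beta>' ws) vs = wedge \<alpha> \<beta> vs - wedge \<alpha> \<beta>' vs"
  by (simp add: wedge_def algebra_simps sum_subtractf)

lemma is_one_form_Nil: "is_one_form \<alpha> \<Longrightarrow> \<alpha> [] = 0"
  by (simp add: is_one_form_def has_degree_def)

section \<open>Action of the almost complex structure on forms of pure type\<close>

lemma pq_type_slotwise: "pq_type I p 0 \<omega> \<Longrightarrow> slotwise I \<i> \<omega>"
proof (induction rule: pq_type.induct)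
  case (product \<alpha>s \<beta>s)
  have one: "slotwise I \<i> \<alpha>" if "form10 I \<alpha>" for \<alpha>
    unfolding slotwise_def
  proof (intro allI)
    fix us v vs
    show "\<alpha> (us @ I v # vs) = \<i> * \<alpha> (us @ v # vs)"
      using that by (cases "us = [] \<and> vs = []") (auto simp: form10_def is_one_form_def has_degree_def)
  qed
  have "slotwise I \<i> (wedge_list \<alpha>s)" if "\<forall>\<alpha>\<in>set \<alpha>s. form10 I \<alpha>" for \<alpha>s
    using that by (induction \<alpha>s) (auto simp: slotwise_wedge one, simp add: slotwise_def unit_form_def)
  then show ?case using product by simp
qed (auto simp: slotwise_def algebra_simps)

text \<open>For mixed type no slot can be treated alone, as it may hold a leg of either kind;
  letting I act on all arguments at once still gives a scalar.\<close>

lemma pq_type_scaled: "pq_type I p q \<omega> \<Longrightarrow> \<omega> (map I vs) = \<i> ^ p * (- \<i>) ^ q * \<omega> vs"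
proof (induction arbitrary: vs rule: pq_type.induct)
  case (product \<alpha>s \<beta>s)
  have one: "pull I \<alpha> = (\<lambda>vs. k * \<alpha> vs)" if "is_one_form \<alpha>" "\<And>v. \<alpha> [I v] = k * \<alpha> [v]" for \<alpha> k
  proof
    fix vs show "pull I \<alpha> vs = k * \<alpha> vs"
    proof (cases "length vs = 1")
      case True
      then obtain v where "vs = [v]" by (cases vs) auto
      then show ?thesis using that(2) by (simp add: pull_def)
    next
      case False
      then show ?thesis using that(1) by (simp add: pull_def is_one_form_def has_degree_def)
    qed
  qed
  have b: "pull I (wedge_list \<beta>s) = (\<lambda>vs. (- \<i>) ^ length \<beta>s * wedge_list \<beta>s vs)" if "\<forall>\<beta>\<in>set \<beta>s. form01 I \<beta>" for \<beta>s
    using that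
  proof (induction \<beta>s)
    case (Cons \<beta> \<beta>s)
    then have e1: "pull I \<beta> = (\<lambda>vs. - \<i> * \<beta> vs)" by (intro one) (auto simp: form01_def)
    have e2: "pull I (wedge_list \<beta>s) = (\<lambda>vs. (- \<i>) ^ length \<beta>s * wedge_list \<beta>s vs)" using Cons by simp
    show ?case
      unfolding wedge_list_Cons pull_wedge e1 e2 wedge_scale_left wedge_scale_right by (simp add: mult.assoc)
  qed (simp add: pull_unit)
  have "pull I (wedge_list (\<alpha>s @ \<beta>s)) = (\<lambda>vs. \<i> ^ length \<alpha>s * (- \<i>) ^ length \<beta>s * wedge_list (\<alpha>s @ \<beta>s) vs)"
    if "\<forall>\<alpha>\<in>set \<alpha>s. form10 I \<alpha>" for \<alpha>s
    using that
  proof (induction \<alpha>s)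
    case (Cons \<alpha> \<alpha>s)
    then have e1: "pull I \<alpha> = (\<lambda>vs. \<i> * \<alpha> vs)" by (intro one) (auto simp: form10_def)
    have e2: "pull I (wedge_list (\<alpha>s @ \<beta>s)) =
        (\<lambda>vs. \<i> ^ length \<alpha>s * (- \<i>) ^ length \<beta>s * wedge_list (\<alpha>s @ \<beta>s) vs)"
      using Cons by simp
    show ?case
      unfolding append_Cons wedge_list_Cons pull_wedge e1 e2 wedge_scale_left wedge_scale_right
      by (simp add: mult.assoc)
  qed (use b product in simp)
  from fun_cong[OF this[of \<alpha>s], of vs] product show ?case by (simp add: pull_def)
qed (auto simp: algebra_simps)

text \<open>The condition under which the definite description in \<open>acs\<close> is
  meaningful.\<close>

definition acs_determined :: "nat \<Rightarrow> 'v::real_vector form \<Rightarrow> bool" where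
  "acs_determined n \<Omega> \<longleftrightarrow> (\<exists>!I. almost_complex I \<and> pq_type I n 0 \<Omega>)"

lemma acs_props:
  assumes "acs_determined n \<Omega>"
  shows "almost_complex (acs n \<Omega>)" "pq_type (acs n \<Omega>) n 0 \<Omega>"
  using theI'[OF assms[unfolded acs_determined_def]] by (simp_all add: acs_def)

lemma acs_eqI: "acs_determined n \<Omega> \<Longrightarrow> almost_complex I \<Longrightarrow> pq_type I n 0 \<Omega> \<Longrightarrow> acs n \<Omega> = I"
  unfolding acs_determined_def acs_def by (rule the1_equality) auto

lemma wedge_list_zero_vector:
  assumes "\<forall>\<eta>\<in>set \<eta>s. is_one_form \<eta> \<and> \<eta> [v] = 0"
  shows "wedge_list \<eta>s (us @ v # vs) = 0"
  using assms
proof (induction \<eta>s arbitrary: us vs)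
  case (Cons \<eta> \<eta>s)
  have "\<eta> (us @ v # vs) = 0" for us vs
    using Cons.prems by (cases "us = [] \<and> vs = []") (auto simp: is_one_form_def has_degree_def)
  then show ?case using Cons by (simp add: wedge_zero_vector)
qed (simp add: unit_form_def)

text \<open>The four factors of \<Omega> form a real linear map into four copies of the complex
  numbers. It is an isomorphism because a vector in its kernel would annihilate \<Omega> and its
  conjugate, hence their product, which is nonzero on a basis. The almost complex structure is
  multiplication by \<i> carried over by this map.\<close>

lemma acs_determinedI:
  fixes \<Omega> :: "'v::euclidean_space form"
  assumes dim: "DIM('v) = 8" and dec: "decomposable 4 \<Omega>" and alt: "alternating \<Omega>"
    and xs: "distinct xs" "set xs = Basis" "wedge \<Omega> (conj_form \<Omega>) xs \<noteq> 0"
  shows "acs_determined 4 \<Omega>"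
proof -
  obtain \<eta>s where \<eta>s: "length \<eta>s = 4" "\<forall>\<eta>\<in>set \<eta>s. is_one_form \<eta>" "\<Omega> = wedge_list \<eta>s"
    using dec by (auto simp: decomposable_def)
  obtain a b c d where abcd: "\<eta>s = [a, b, c, d]"
    using \<eta>s(1) by (auto simp: length_Suc_conv numeral_eq_Suc)
  have one: "is_one_form a" "is_one_form b" "is_one_form c" "is_one_form d"
    using \<eta>s(2) abcd by auto
  then have lin: "linear (\<lambda>v. a [v])" "linear (\<lambda>v. b [v])" "linear (\<lambda>v. c [v])" "linear (\<lambda>v. d [v])"
    by (auto simp: is_one_form_def)
  define \<Phi> where "\<Phi> v = (a [v], b [v], c [v], d [v])" for v
  have lin\<Phi>: "linear \<Phi>"
    by (rule linearI) (simp_all add: \<Phi>_def linear_add[OF lin(1)] linear_add[OF lin(2)] linear_add[OF lin(3)]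
        linear_add[OF lin(4)] linear_scale[OF lin(1)] linear_scale[OF lin(2)] linear_scale[OF lin(3)] linear_scale[OF lin(4)])
  let ?W = "wedge \<Omega> (conj_form \<Omega>)"
  have altW: "alternating ?W" by (rule alternating_wedge[OF alt alternating_conj_form[OF alt]])
  have "v = 0" if v: "\<Phi> v = 0" for v
  proof (rule ccontr)
    assume "v \<noteq> 0"
    then obtain b where b: "b \<in> Basis" "v \<bullet> b \<noteq> 0" by (metis euclidean_all_zero_iff)
    have "\<Omega> (us @ v # vs) = 0" for us vs
      unfolding \<eta>s(3) by (rule wedge_list_zero_vector) (use one v abcd in \<open>auto simp: \<Phi>_def zero_prod_def\<close>)
    then have W0: "?W (us @ v # vs) = 0" for us vs
      by (intro wedge_zero_vector) (simp_all add: conj_form_def)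
    obtain us vs where xs': "xs = us @ b # vs" using b xs(2) by (metis split_list)
    \<comment> \<open>The kernel vector replaces a basis vector along which it has a nonzero
      component; its other components repeat an entry of \<open>xs\<close> and contribute
      nothing.\<close>
    have "0 = ?W (us @ (\<Sum>b'\<in>Basis. (v \<bullet> b') *\<^sub>R b') # vs)" by (simp add: euclidean_representation W0)
    also have "\<dots> = (\<Sum>b'\<in>Basis. of_real (v \<bullet> b') * ?W (us @ b' # vs))"
      by (simp only: multilinear_sum[OF alternating_multilinear[OF altW]] multilinear_scale[OF alternating_multilinear[OF altW]])
    also have "\<dots> = (\<Sum>b'\<in>{b}. of_real (v \<bullet> b') * ?W (us @ b' # vs))"
    proof (rule sum.mono_neutral_right)
      show "\<forall>b'\<in>Basis - {b}. of_real (v \<bullet> b') * ?W (us @ b' # vs) = 0"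
      proof
        fix b' assume "b' \<in> Basis - {b}"
        then have "b' \<in> set us \<or> b' \<in> set vs" using xs(2) xs' by auto
        then have "?W (us @ b' # vs) = 0"
        proof
          assume "b' \<in> set us"
          then obtain p q where "us = p @ b' # q" by (metis split_list)
          then show ?thesis using alternating_repeat[OF altW, of p b' q vs] by simp
        next
          assume "b' \<in> set vs"
          then obtain p q where "vs = p @ b' # q" by (metis split_list)
          then show ?thesis using alternating_repeat[OF altW, of us b' p q] by simp
        qed
        then show "of_real (v \<bullet> b') * ?W (us @ b' # vs) = 0" by simp
      qed
    qed (use b in auto)
    finally show False using b xs(3) xs' by simp
  qed
  then have inj: "inj \<Phi>" using linear_injective_0[OF lin\<Phi>] by blast
  have surj: "surj \<Phi>" by (rule eucl.linear_injective_imp_surjective[OF lin\<Phi> inj]) (simp add: dim)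
  define \<Psi> where "\<Psi> = inv \<Phi>"
  have \<Phi>\<Psi>: "\<Phi> (\<Psi> x) = x" for x unfolding \<Psi>_def by (rule surj_f_inv_f[OF surj])
  define I where "I v = \<Psi> (\<i> * a [v], \<i> * b [v], \<i> * c [v], \<i> * d [v])" for v
  have \<Phi>I: "\<Phi> (I v) = (\<i> * a [v], \<i> * b [v], \<i> * c [v], \<i> * d [v])" for v
    by (simp add: I_def \<Phi>\<Psi>)
  have Iabcd: "a [I v] = \<i> * a [v]" "b [I v] = \<i> * b [v]" "c [I v] = \<i> * c [v]" "d [I v] = \<i> * d [v]" for v
    using \<Phi>I[of v] by (simp_all add: \<Phi>_def)
  have linI: "linear I"
  proof (rule linearI)
    show "I (v + w) = I v + I w" for v w
      by (rule injD[OF inj]) (simp add: \<Phi>I linear_add[OF lin\<Phi>], simp add: linear_add[OF lin(1)] linear_add[OF lin(2)] linear_add[OF lin(3)] linear_add[OF lin(4)] distrib_left)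
    show "I (r *\<^sub>R v) = r *\<^sub>R I v" for r v
      by (rule injD[OF inj]) (simp add: \<Phi>I linear_scale[OF lin\<Phi>], simp add: linear_scale[OF lin(1)] linear_scale[OF lin(2)] linear_scale[OF lin(3)] linear_scale[OF lin(4)])
  qed
  have "I (I v) = - v" for v
    by (rule injD[OF inj]) (simp add: \<Phi>I linear_neg[OF lin\<Phi>], simp add: \<Phi>_def Iabcd mult.assoc[symmetric])
  then have ac: "almost_complex I" using linI by (simp add: almost_complex_def)
  have f10: "form10 I a" "form10 I b" "form10 I c" "form10 I d"
    using one Iabcd by (auto simp: form10_def)
  have pq: "pq_type I 4 0 \<Omega>"
    using pq_type.product[of \<eta>s 4 "[]" 0 I] f10 \<eta>s abcd by simp
  have "I' = I" if I': "almost_complex I'" "pq_type I' 4 0 \<Omega>" for I'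
  proof
    fix w
    have sl: "\<Omega> (us @ I' v # vs) = \<i> * \<Omega> (us @ v # vs)" for us v vs
      using pq_type_slotwise[OF I'(2)] by (simp add: slotwise_def)
    \<comment> \<open>The frame dual to the four factors: inserted in three slots of \<Omega> it
      isolates one factor, so slotwise linearity of \<Omega> under \<open>I'\<close> forces every
      factor to be of type (1,0) for \<open>I'\<close>.\<close>
    define e1 e2 e3 e4 where "e1 = \<Psi> (1, 0, 0, 0)" and "e2 = \<Psi> (0, 1, 0, 0)" and "e3 = \<Psi> (0, 0, 1, 0)" and "e4 = \<Psi> (0, 0, 0, 1)"
    have "\<Phi> e1 = (1, 0, 0, 0)" "\<Phi> e2 = (0, 1, 0, 0)" "\<Phi> e3 = (0, 0, 1, 0)" "\<Phi> e4 = (0, 0, 0, 1)"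
      by (simp_all add: e1_def e2_def e3_def e4_def \<Phi>\<Psi>)
    then have e: "a [e1] = 1" "b [e1] = 0" "c [e1] = 0" "d [e1] = 0" "a [e2] = 0" "b [e2] = 1" "c [e2] = 0" "d [e2] = 0"
       "a [e3] = 0" "b [e3] = 0" "c [e3] = 1" "d [e3] = 0" "a [e4] = 0" "b [e4] = 0" "c [e4] = 0" "d [e4] = 1"
      by (simp_all add: \<Phi>_def)
    note ev = \<eta>s(3) abcd wedge_one_Cons one wedge_one_Nil e wedge_zero_right wedge_scale_right wedge_diff_right
      is_one_form_Nil unit_form_def
    have "\<Omega> [v, e2, e3, e4] = a [v]" "\<Omega> [e1, v, e3, e4] = b [v]" "\<Omega> [e1, e2, v, e4] = c [v]" "\<Omega> [e1, e2, e3, v] = d [v]" for v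
      by (simp_all add: ev)
    then have "\<Phi> (I' w) = \<Phi> (I w)"
      using sl[of "[]" w "[e2, e3, e4]"] sl[of "[e1]" w "[e3, e4]"] sl[of "[e1, e2]" w "[e4]"] sl[of "[e1, e2, e3]" w "[]"]
      by (simp add: \<Phi>_def Iabcd)
    then show "I' w = I w" by (rule injD[OF inj])
  qed
  then show ?thesis using ac pq by (auto simp: acs_determined_def)
qed

section \<open>Naturality of the almost complex structure\<close>

lemma form10_pull:
  assumes "linear D" "bij D" "form10 I \<alpha>"
  shows "form10 (inv D \<circ> I \<circ> D) (pull D \<alpha>)"
  using assms linear_compose[OF assms(1), of "\<lambda>v. \<alpha> [v]"]
  by (auto simp: form10_def is_one_form_def has_degree_def pull_def o_def bij_is_surj surj_f_inv_f)

lemma form01_pull: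
  assumes "linear D" "bij D" "form01 I \<alpha>"
  shows "form01 (inv D \<circ> I \<circ> D) (pull D \<alpha>)"
  using assms linear_compose[OF assms(1), of "\<lambda>v. \<alpha> [v]"]
  by (auto simp: form01_def is_one_form_def has_degree_def pull_def o_def bij_is_surj surj_f_inv_f)

lemma pq_type_pull:
  assumes "linear D" "bij D" "pq_type I p q \<omega>"
  shows "pq_type (inv D \<circ> I \<circ> D) p q (pull D \<omega>)"
  using assms(3)
proof (induction rule: pq_type.induct)
  case (product \<alpha>s \<beta>s)
  have "pq_type (inv D \<circ> I \<circ> D) p q (wedge_list (map (pull D) \<alpha>s @ map (pull D) \<beta>s))"
    using product form10_pull[OF assms(1,2)] form01_pull[OF assms(1,2)]
    by (intro pq_type.product) auto
  then show ?case by (simp only: pull_wedge_list map_append)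
qed (auto simp: pull_def intro: pq_type.intros)

lemma linear_inv_bij:
  fixes D :: "'a::real_vector \<Rightarrow> 'b::real_vector"
  assumes "linear D" "bij D" shows "linear (inv D)"
proof (rule linearI)
  have r: "D (inv D x) = x" for x using assms(2) by (simp add: bij_is_surj surj_f_inv_f)
  have inj: "inj D" using assms(2) by (rule bij_is_inj)
  show "inv D (x + y) = inv D x + inv D y" for x y
    by (rule injD[OF inj]) (simp add: r linear_add[OF assms(1)])
  show "inv D (k *\<^sub>R x) = k *\<^sub>R inv D x" for k x
    by (rule injD[OF inj]) (simp add: r linear_scale[OF assms(1)])
qed

lemma almost_complex_conjugate:
  assumes "linear D" "bij D" "almost_complex I"
  shows "almost_complex (inv D \<circ> I \<circ> D)"
  using assms linear_inv_bij[OF assms(1,2)]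
  by (auto simp: almost_complex_def intro!: linear_compose simp: bij_is_surj surj_f_inv_f bij_is_inj inv_f_f linear_neg)

lemma acs_pull:
  fixes D :: "'a::real_vector \<Rightarrow> 'b::real_vector"
  assumes D: "linear D" "bij D" and ok: "acs_determined n \<Omega>"
  shows "acs_determined n (pull D \<Omega>)" "acs n (pull D \<Omega>) = inv D \<circ> acs n \<Omega> \<circ> D"
proof -
  let ?I = "inv D \<circ> acs n \<Omega> \<circ> D"
  have i: "inv D (D v) = v" "D (inv D w) = w" for v w
    using D(2) by (simp_all add: bij_is_surj surj_f_inv_f bij_is_inj inv_f_f)
  have ac: "almost_complex ?I" "pq_type ?I n 0 (pull D \<Omega>)"
    using acs_props[OF ok] D by (auto intro: almost_complex_conjugate pq_type_pull)
  have un: "I = ?I" if I: "almost_complex I" "pq_type I n 0 (pull D \<Omega>)" for I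
  proof -
    have D': "linear (inv D)" "bij (inv D)" using linear_inv_bij[OF D] D(2) by (auto simp: bij_imp_bij_inv)
    have inv2: "inv (inv D) = D" using D(2) by (rule inv_inv_eq)
    have "pull (inv D) (pull D \<Omega>) = \<Omega>" by (auto simp: fun_eq_iff pull_def o_def i)
    then have "pq_type (D \<circ> I \<circ> inv D) n 0 \<Omega>" "almost_complex (D \<circ> I \<circ> inv D)"
      using pq_type_pull[OF D' I(2)] almost_complex_conjugate[OF D' I(1)] by (simp_all add: inv2)
    from acs_eqI[OF ok this(2,1)] show ?thesis by (auto simp: fun_eq_iff i)
  qed
  show ok': "acs_determined n (pull D \<Omega>)"
    unfolding acs_determined_def using ac un by blast
  show "acs n (pull D \<Omega>) = ?I" by (rule acs_eqI[OF ok' ac])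
qed

lemma acs_scale:
  assumes "k \<noteq> 0" shows "acs_determined n (\<lambda>vs. k * \<Omega> vs) = acs_determined n \<Omega>" "acs n (\<lambda>vs. k * \<Omega> vs) = acs n \<Omega>"
proof -
  have "pq_type I n 0 (\<lambda>vs. k * \<Omega> vs) \<longleftrightarrow> pq_type I n 0 \<Omega>" for I
    using pq_type.scale[of I n 0 \<Omega> k] pq_type.scale[of I n 0 "\<lambda>vs. k * \<Omega> vs" "1 / k"] assms by auto
  then show "acs_determined n (\<lambda>vs. k * \<Omega> vs) = acs_determined n \<Omega>" "acs n (\<lambda>vs. k * \<Omega> vs) = acs n \<Omega>"
    by (simp_all add: acs_determined_def acs_def)
qed

lemma wedge_power_scale: "wedge_power (\<lambda>vs. k * J vs) n vs = k ^ n * wedge_power J n vs"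
proof (induction n arbitrary: vs)
  case (Suc n)
  then have "wedge_power (\<lambda>vs. k * J vs) n = (\<lambda>vs. k ^ n * wedge_power J n vs)" by (rule ext)
  then show ?case by (simp add: wedge_power_def wedge_scale_left wedge_scale_right)
qed (simp add: wedge_power_def)

lemma pull_wedge_power: "pull T (wedge_power J n) = wedge_power (pull T J) n"
  by (simp add: wedge_power_def pull_wedge_list)

text \<open>S multiplies J by s, so all conditions pass from \<Omega> to its pullback: the new
  metric on v is the old one on S v divided by s, the n-th power of J contributes
  \<open>s ^ n\<close>, and k contributes its squared modulus. For decomposability k is absorbed
  into the first factor.\<close>

lemma SU_structure_at_rescale:
  assumes SU: "SU_structure_at n K J \<Omega>" and ok: "acs_determined n \<Omega>" and n: "n > 0"
    and S: "linear S" "bij S" "pull S J = (\<lambda>vs. of_real s * J vs)" and s: "s > 0" and k: "k \<noteq> 0"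
  shows "SU_structure_at n ((cmod k)\<^sup>2 * s ^ n * K) J (\<lambda>vs. k * \<Omega> (map S vs))"
    and "acs_determined n (\<lambda>vs. k * \<Omega> (map S vs))"
proof -
  have i: "inv S (S v) = v" "S (inv S w) = w" for v w
    using S(2) by (simp_all add: bij_is_surj surj_f_inv_f bij_is_inj inv_f_f)
  have acs: "acs_determined n (\<lambda>vs. k * pull S \<Omega> vs)" "acs n (\<lambda>vs. k * pull S \<Omega> vs) = inv S \<circ> acs n \<Omega> \<circ> S"
    using acs_pull[OF S(1,2) ok] by (simp_all add: acs_scale[OF k])
  obtain \<zeta>s where \<zeta>s: "length \<zeta>s = n" "\<forall>\<zeta>\<in>set \<zeta>s. is_one_form \<zeta>" "\<Omega> = wedge_list \<zeta>s"
    using SU by (auto simp: SU_structure_at_def decomposable_def)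
  then obtain \<zeta> \<zeta>s' where c: "\<zeta>s = \<zeta> # \<zeta>s'" using n by (cases \<zeta>s) auto
  have pl: "is_one_form (pull S \<alpha>)" if "is_one_form \<alpha>" for \<alpha>
    using that linear_compose[OF S(1), of "\<lambda>v. \<alpha> [v]"]
    by (auto simp: is_one_form_def has_degree_def pull_def o_def)
  have sc: "is_one_form (\<lambda>vs. k * \<alpha> vs)" if "is_one_form \<alpha>" for \<alpha>
    using that linear_compose[of "\<lambda>v. \<alpha> [v]" "\<lambda>z. k * z"]
    by (auto simp: is_one_form_def has_degree_def o_def linear_times)
  have dec: "decomposable n (\<lambda>vs. k * pull S \<Omega> vs)"
    unfolding decomposable_def
  proof (intro exI conjI)
    show "length ((\<lambda>vs. k * pull S \<zeta> vs) # map (pull S) \<zeta>s') = n" using \<zeta>s c by simp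
    show "\<forall>\<alpha>\<in>set ((\<lambda>vs. k * pull S \<zeta> vs) # map (pull S) \<zeta>s'). is_one_form \<alpha>"
      using \<zeta>s c pl sc by auto
    show "(\<lambda>vs. k * pull S \<Omega> vs) = wedge_list ((\<lambda>vs. k * pull S \<zeta> vs) # map (pull S) \<zeta>s')"
      by (simp add: \<zeta>s(3) c pull_wedge pull_wedge_list wedge_scale_left fun_eq_iff)
  qed
  obtain xs where "\<Omega> xs \<noteq> 0" using SU by (auto simp: SU_structure_at_def)
  then have nz: "\<exists>vs. k * pull S \<Omega> vs \<noteq> 0"
    by (intro exI[of _ "map (inv S) xs"]) (simp add: pull_def o_def i k)
  have met: "metric J (acs n (\<lambda>vs. k * pull S \<Omega> vs)) v v > 0" if "v \<noteq> 0" for v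
  proof -
    have "S v \<noteq> 0" using that i by (metis S(1) linear_0)
    then have "0 < Re (J [S v, acs n \<Omega> (S v)])"
      using SU by (simp add: SU_structure_at_def metric_def)
    also have "J [S v, acs n \<Omega> (S v)] = pull S J [v, inv S (acs n \<Omega> (S v))]"
      by (simp add: pull_def i)
    also have "\<dots> = of_real s * J [v, inv S (acs n \<Omega> (S v))]" by (simp add: S(3))
    finally show ?thesis using s by (simp add: metric_def acs zero_less_mult_iff)
  qed
  have "of_real s * wedge J (\<lambda>vs. k * pull S \<Omega> vs) vs = k * wedge (pull S J) (pull S \<Omega>) vs" for vs
    by (simp add: S(3) wedge_scale_left wedge_scale_right)
  then have JO: "wedge J (\<lambda>vs. k * pull S \<Omega> vs) vs = 0" for vs
    using SU s by (simp add: SU_structure_at_def wedge_pull)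
  have vol: "1 / 2 ^ n * wedge (\<lambda>vs. k * pull S \<Omega> vs) (conj_form (\<lambda>vs. k * pull S \<Omega> vs)) vs =
      \<i> ^ n / fact n * complex_of_real ((cmod k)\<^sup>2 * s ^ n * K) * wedge_power J n vs" for vs
  proof -
    have c: "conj_form (\<lambda>vs. k * pull S \<Omega> vs) = (\<lambda>vs. cnj k * pull S (conj_form \<Omega>) vs)"
      by (simp add: conj_form_def pull_def fun_eq_iff)
    have "1 / 2 ^ n * wedge (\<lambda>vs. k * pull S \<Omega> vs) (conj_form (\<lambda>vs. k * pull S \<Omega> vs)) vs =
        k * cnj k * (1 / 2 ^ n * wedge \<Omega> (conj_form \<Omega>) (map S vs))"
      by (simp add: c wedge_scale_left wedge_scale_right wedge_pull)
    also have "\<dots> = k * cnj k * (\<i> ^ n / fact n * complex_of_real K * wedge_power J n (map S vs))"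
      using SU unfolding SU_structure_at_def by metis
    also have "wedge_power J n (map S vs) = of_real s ^ n * wedge_power J n vs"
      using fun_cong[OF pull_wedge_power[of S J n], of vs] by (simp add: pull_def[of S "wedge_power J n"] S(3) wedge_power_scale)
    also have "k * cnj k = of_real ((cmod k)\<^sup>2)"
      by (simp add: complex_mult_cnj cmod_power2)
    finally show ?thesis by (simp add: ac_simps)
  qed
  show "SU_structure_at n ((cmod k)\<^sup>2 * s ^ n * K) J (\<lambda>vs. k * \<Omega> (map S vs))"
    using dec nz met JO vol unfolding SU_structure_at_def pull_def[symmetric] by simp
  show "acs_determined n (\<lambda>vs. k * \<Omega> (map S vs))" using acs(1) by (simp add: pull_def)
qed

section \<open>The determinant as a four-form\<close>

definition index4 :: "4 \<Rightarrow> nat" where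
  "index4 i = (if i = 1 then 0 else if i = 2 then 1 else if i = 3 then 2 else 3)"

lemma index4_simps [simp]: "index4 1 = 0" "index4 2 = 1" "index4 3 = 2" "index4 4 = 3"
  by (simp_all add: index4_def)

lemma index4_inj: "index4 i = index4 j \<Longrightarrow> i = j"
  using exhaust_4[of i] exhaust_4[of j] by auto

lemma index4_surj: "p < 4 \<Longrightarrow> \<exists>i. index4 i = p"
proof -
  assume "p < 4"
  then consider "p = 0" | "p = 1" | "p = 2" | "p = 3" by linarith
  then show ?thesis by cases (metis index4_simps)+
qed

text \<open>The vectors are the rows. \<open>index4\<close> matches the indices 1, 2, 3, 4 with list
  positions by cases, because 4 equals 0 in the type \<open>4\<close>.\<close>

definition det_form :: "(real^4) form" where
  "det_form vs = (if length vs = 4 then of_real (det (\<chi> i. vs ! index4 i)) else 0)"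

lemma det_form_slot:
  assumes "index4 k = length us"
  shows "(us @ x # vs) ! index4 i = (if i = k then x else (us @ 0 # vs) ! index4 i)"
proof (cases "i = k")
  case False
  then have "index4 i \<noteq> length us" using assms index4_inj by metis
  then show ?thesis using False nth_append_other by metis
qed (simp add: assms)

lemma alternating_det_form: "alternating det_form"
proof (rule alternatingI_adjacent[OF multilinearI])
  fix us vs :: "(real^4) list" and v w :: "real^4"
  show "det_form (us @ (v + w) # vs) = det_form (us @ v # vs) + det_form (us @ w # vs)"
  proof (cases "length us + length vs = 3")
    case True
    then obtain k where k: "index4 k = length us" using index4_surj[of "length us"] by auto
    show ?thesis
      using True det_row_add[of k "\<lambda>_. v" "\<lambda>_. w" "\<lambda>i. (us @ 0 # vs) ! index4 i"]
      by (simp add: det_form_def det_form_slot[OF k, of v] det_form_slot[OF k, of w] det_form_slot[OF k, of "v + w"])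
  qed (simp add: det_form_def)
next
  fix us vs :: "(real^4) list" and v :: "real^4" and r
  show "det_form (us @ (r *\<^sub>R v) # vs) = of_real r * det_form (us @ v # vs)"
  proof (cases "length us + length vs = 3")
    case True
    then obtain k where k: "index4 k = length us" using index4_surj[of "length us"] by auto
    show ?thesis
      using True det_row_mul[of k r "\<lambda>_. v" "\<lambda>i. (us @ 0 # vs) ! index4 i"] unfolding scalar_mult_eq_scaleR
      by (simp add: det_form_def det_form_slot[OF k, of v] det_form_slot[OF k, of "r *\<^sub>R v"])
  qed (simp add: det_form_def)
next
  fix us ws :: "(real^4) list" and v :: "real^4"
  show "det_form (us @ v # v # ws) = 0"
  proof (cases "length us + length ws = 2")
    case True
    then obtain k where k: "index4 k = length us" using index4_surj[of "length us"] by auto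
    obtain l where l: "index4 l = Suc (length us)" using index4_surj[of "Suc (length us)"] True by auto
    have "k \<noteq> l" using k l by auto
    then have "det (\<chi> i. (us @ v # v # ws) ! index4 i) = 0"
      by (rule det_identical_rows) (simp add: row_def k l nth_append)
    then show ?thesis by (simp add: det_form_def)
  qed (simp add: det_form_def)
qed

definition axes4 :: "(real^4) list" where
  "axes4 = map (\<lambda>j. axis j 1) [1, 2, 3, 4]"

lemma filter_full: "length (filter P xs) = length xs \<Longrightarrow> filter P xs = xs"
  by (metis filter_True length_filter_less less_irrefl)

lemma set_axes4: "set axes4 = Basis"
proof -
  have "(Basis :: (real^4) set) = range (\<lambda>i. axis i 1)" by (auto simp: Basis_vec_def)
  then show ?thesis by (simp add: axes4_def UNIV_4)
qed

lemma distinct_axes4: "distinct axes4"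
  by (simp add: axes4_def axis_eq_axis)

lemma det_form_axes4: "det_form axes4 = 1"
proof -
  have "(\<chi> i. axes4 ! index4 i) = (mat 1 :: real^4^4)"
    by (simp add: vec_eq_iff axes4_def forall_4 mat_def axis_def)
  then show ?thesis by (simp add: det_form_def axes4_def)
qed

text \<open>Four-forms on a four-dimensional space form a line: the difference of both sides is
  alternating and vanishes on \<open>axes4\<close>, the only sublist of length four.\<close>

lemma alternating_det_form_eq:
  assumes "alternating \<omega>" "linear \<phi>" "length xs = 4"
  shows "\<omega> (map \<phi> xs) = det_form xs * \<omega> (map \<phi> axes4)"
proof -
  let ?\<eta> = "\<lambda>vs. pull \<phi> \<omega> vs + (- \<omega> (map \<phi> axes4)) * det_form vs"
  have "?\<eta> xs = 0"
  proof (rule alternating_zero_on_basis[where bs = axes4 and n = 4])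
    show "alternating ?\<eta>"
      by (intro alternating_add alternating_scale alternating_pull assms alternating_det_form)
    show "distinct axes4" by (rule distinct_axes4)
    show "span (set axes4) = UNIV" by (simp add: set_axes4)
    fix P :: "real^4 \<Rightarrow> bool" assume "length (filter P axes4) = 4"
    then have "filter P axes4 = axes4" by (intro filter_full) (simp add: axes4_def)
    then show "?\<eta> (filter P axes4) = 0" by (simp add: det_form_axes4 pull_def)
  qed (simp add: assms)
  then show ?thesis by (simp add: pull_def)
qed

lemma det_form_matrix: "det_form (map (\<lambda>x. N *v x) axes4) = of_real (det N)"
proof -
  have "(\<chi> i. map (\<lambda>x. N *v x) axes4 ! index4 i) = transpose N"
    by (simp add: vec_eq_iff axes4_def forall_4 transpose_def matrix_vector_mult_basis column_def)
  then show ?thesis by (simp add: det_form_def axes4_def)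
qed

lemma alternating_det:
  assumes "alternating \<omega>" "linear \<phi>"
  shows "\<omega> (map (\<lambda>x. \<phi> (N *v x)) axes4) = of_real (det N) * \<omega> (map \<phi> axes4)"
  using alternating_det_form_eq[OF assms, of "map (\<lambda>x. N *v x) axes4"]
  by (simp add: det_form_matrix o_def) (simp add: axes4_def)


section \<open>Semi-flat Lagrangian torus bundles\<close>

definition std_symp :: "model form" where
  "std_symp vs = (\<Sum>j\<in>UNIV. wedge (d_theta j) (d_r j) vs)"

lemma std_symp_2: "std_symp [v, w] = of_real (snd v \<bullet> fst w - snd w \<bullet> fst v)"
  by (simp add: std_symp_def wedge_Cons d_theta_def d_r_def one_form_def inner_vec_def sum_subtractf)

abbreviation vert :: "real^4 \<Rightarrow> model" where "vert y \<equiv> (0, y)"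

abbreviation horiz :: "real^4 \<Rightarrow> model" where "horiz x \<equiv> (x, 0)"

lemma linear_vert: "linear vert"
  by (rule linearI) simp_all

text \<open>Angle and base vectors alternate so that conjugate pairs are neighbours and
  \<open>wedge_pair\<close> can remove them one after another; in this order J takes the value 1 on
  each pair.\<close>

definition darboux_basis :: "model list" where
  "darboux_basis = concat (map (\<lambda>j. [vert (axis j 1), horiz (axis j 1)]) [1, 2, 3, 4])"

lemma set_darboux_basis: "set darboux_basis = Basis"
proof -
  have "(Basis :: (real^4) set) = range (\<lambda>i. axis i 1)" by (auto simp: Basis_vec_def)
  then show ?thesis by (auto simp: darboux_basis_def Basis_prod_def UNIV_4)
qed

lemma distinct_darboux_basis: "distinct darboux_basis"
  by (simp add: darboux_basis_def axis_eq_axis axis_eq_0_iff)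

text \<open>The value is 4!, the number of ways to distribute the four conjugate pairs among the
  four factors J.\<close>

lemma wedge_power_darboux:
  assumes "has_degree 2 J" "\<And>v w. J [v, w] = std_symp [v, w]"
  shows "wedge_power J 4 darboux_basis = 24"
proof -
  have J: "J [vert x, horiz y] = of_real (x \<bullet> y)" "J [horiz y, vert x] = of_real (- (x \<bullet> y))"
    "J [vert x, vert y] = 0" "J [horiz x, horiz y] = 0" for x y
    by (simp_all add: assms(2) std_symp_2)
  have Z: "J [] = 0" using assms(1) by (simp add: has_degree_def)
  have "wedge_power J 4 = wedge J (wedge J (wedge J (wedge J unit_form)))"
    by (simp add: wedge_power_def numeral_eq_Suc)
  then show ?thesis
    by (simp add: darboux_basis_def wedge_pair[OF assms(1)] J inner_axis_axis Z unit_form_def)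
qed

text \<open>Vertical vectors and their images under I span, and each image is traded for its
  preimage at the price of a factor k. A form of type (n, 0) is therefore determined by its
  restriction to the fibre.\<close>

lemma slotwise_zero:
  assumes ml: "multilinear \<omega>" and sl: "slotwise I k \<omega>" and zero: "\<And>ys. length ys = n \<Longrightarrow> \<omega> (map vert ys) = 0"
    and span: "\<And>v. \<exists>y y'. v = vert y + I (vert y')"
  shows "length vs = n \<Longrightarrow> \<omega> vs = 0"
proof -
  have red: "\<exists>ys k'. length ys = length xs \<and> \<omega> (pre @ xs) = k' * \<omega> (pre @ map vert ys)"
    if "set xs \<subseteq> range vert \<union> (I \<circ> vert) ` UNIV" for pre xs
    using that
  proof (induction xs arbitrary: pre)
    case Nil
    then show ?case by (intro exI[of _ "[]"] exI[of _ 1]) simp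
  next
    case (Cons x xs)
    obtain y l where y: "\<And>vs. \<omega> (pre @ x # vs) = l * \<omega> (pre @ vert y # vs)"
    proof -
      consider y where "x = vert y" | y where "x = I (vert y)" using Cons.prems by auto
      then show ?thesis
      proof cases
        case 1
        show ?thesis by (rule that[of 1 y]) (simp add: 1)
      next
        case 2
        show ?thesis by (rule that[of k y]) (use sl in \<open>simp add: 2 slotwise_def\<close>)
      qed
    qed
    obtain ys k' where ys: "length ys = length xs" "\<omega> ((pre @ [vert y]) @ xs) = k' * \<omega> ((pre @ [vert y]) @ map vert ys)"
      using Cons.IH[where pre = "pre @ [vert y]", OF subset_trans[OF set_subset_Cons Cons.prems]]
      by (elim exE conjE) (rule that)
    have "\<omega> (pre @ x # xs) = (l * k') * \<omega> (pre @ map vert (y # ys))"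
      using y[of xs] ys(2) by simp
    moreover have "length (y # ys) = length (x # xs)" using ys(1) by simp
    ultimately show ?case by blast
  qed
  have "span (range vert \<union> (I \<circ> vert) ` UNIV) = UNIV"
  proof (intro equalityI subsetI UNIV_I)
    fix v :: model
    obtain y y' where "v = vert y + I (vert y')" using span by blast
    moreover have "vert y \<in> range vert \<union> (I \<circ> vert) ` UNIV" "I (vert y') \<in> range vert \<union> (I \<circ> vert) ` UNIV"
      by auto
    ultimately show "v \<in> span (range vert \<union> (I \<circ> vert) ` UNIV)"
      by (simp only: span_add span_base)
  qed
  moreover have "\<omega> ([] @ xs) = 0" if xs: "set xs \<subseteq> range vert \<union> (I \<circ> vert) ` UNIV" "length xs = n" for xs
  proof -
    obtain ys k' where "length ys = length xs" "\<omega> ([] @ xs) = k' * \<omega> ([] @ map vert ys)"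
      using red[OF xs(1), of "[]"] by blast
    then show ?thesis using zero[of ys] xs(2) by simp
  qed
  ultimately show "length vs = n \<Longrightarrow> \<omega> vs = 0"
    using multilinear_zero_on_span[OF ml, of "range vert \<union> (I \<circ> vert) ` UNIV" n "[]" vs]
    by (simp only: append_Nil simp_thms)
qed

lemma invertible_eqD:
  fixes M :: "real^4^4"
  assumes "invertible M" "M *v x = M *v y" shows "x = y"
proof -
  obtain M' where "M' ** M = mat 1" using assms(1) by (auto simp: invertible_def)
  then have "z = M' *v (M *v z)" for z by (simp add: matrix_vector_mul_assoc)
  from this[of x, unfolded assms(2)] this[of y, symmetric] show ?thesis by (rule trans)
qed

locale semiflat_bundle =
  fixes \<A> :: "(model, 'm::{t2_space, second_countable_topology}) chart set"
    and \<B> :: "(real^4, 'b::{t2_space, second_countable_topology}) chart set"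
    and prj :: "'m \<Rightarrow> 'b"
    and \<P> :: "('b, 'm) torus_coords set"
    and J \<Omega> :: "(model, 'm) dform"
    and a \<rho> :: "('b, 'm) torus_coords \<Rightarrow> real^4 \<Rightarrow> real^4^4"
  assumes torus_bdl: "lagrangian_torus_bundle \<A> \<B> prj J"
    and atlas: "action_angle_atlas \<A> \<B> prj J \<P>"
    and SU4: "SU_structure \<A> 4 (\<lambda>m. 1) J \<Omega>"
    and semiflat: "semi_flat \<P> J \<Omega>"
    and frame: "semi_flat_frame \<P> \<Omega> a \<rho>"
    and flat: "flat_connection \<P> a"
begin

lemma smooth_\<A>: "smooth_structure \<A>" and smooth_\<B>: "smooth_structure \<B>"
  using torus_bdl by (auto simp: lagrangian_torus_bundle_def torus_bundle_def)

lemma chart: "c \<in> \<A> \<Longrightarrow> is_chart c"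
  by (rule smooth_structure_chart[OF smooth_\<A>])

lemma J_form: "diff_form \<A> J" and J_degree: "c \<in> \<A> \<Longrightarrow> u \<in> fst c \<Longrightarrow> has_degree 2 (J c u)"
  and \<Omega>_form: "diff_form \<A> \<Omega>" and \<Omega>_degree: "c \<in> \<A> \<Longrightarrow> u \<in> fst c \<Longrightarrow> has_degree 4 (\<Omega> c u)"
  and SU_at: "c \<in> \<A> \<Longrightarrow> u \<in> fst c \<Longrightarrow> SU_structure_at 4 1 (J c u) (\<Omega> c u)"
  using SU4 by (auto simp: SU_structure_def diff_form_deg_def everywhere_def)

section \<open>Forms in torus coordinates\<close>

definition coord :: "('b, 'm) torus_coords \<Rightarrow> model \<Rightarrow> 'm \<Rightarrow> bool" where
  "coord q u m \<longleftrightarrow> q \<in> \<P> \<and> fst u \<in> tc_dom q \<and> tc_map q u = m"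

lemma torus_coords: "q \<in> \<P> \<Longrightarrow> is_torus_coords \<A> \<B> prj q"
  using atlas by (auto simp: action_angle_atlas_def action_angle_def)

lemma tc_chart_in: "q \<in> \<P> \<Longrightarrow> tc_chart q \<theta> \<in> \<A>"
  using torus_coords unfolding is_torus_coords_def by blast

lemma open_tc_dom: "q \<in> \<P> \<Longrightarrow> open (tc_dom q)"
  using torus_coords[of q] is_chart_open[OF smooth_structure_chart[OF smooth_\<B>, of "(tc_dom q, tc_base q)"]]
  by (simp add: is_torus_coords_def)

lemma fst_tc_chart: "u \<in> fst (tc_chart q \<theta>) \<longleftrightarrow> fst u \<in> tc_dom q \<and> dist \<theta> (snd u) < pi"
  by (cases u) (simp add: tc_chart_def)

lemma snd_tc_chart [simp]: "snd (tc_chart q \<theta>) = tc_map q"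
  by (simp add: tc_chart_def)

lemma tc_chart_self: "fst u \<in> tc_dom q \<Longrightarrow> u \<in> fst (tc_chart q (snd u))"
  by (simp add: fst_tc_chart)

lemma prj_tc_map: "q \<in> \<P> \<Longrightarrow> fst u \<in> tc_dom q \<Longrightarrow> prj (tc_map q u) = tc_base q (fst u)"
proof -
  assume "q \<in> \<P>" "fst u \<in> tc_dom q"
  then have "range (\<lambda>\<theta>. tc_map q (fst u, \<theta>)) = prj -` {tc_base q (fst u)}"
    using torus_coords unfolding is_torus_coords_def by blast
  moreover have "tc_map q u \<in> range (\<lambda>\<theta>. tc_map q (fst u, \<theta>))"
    by (rule range_eqI[of _ _ "snd u"]) simp
  ultimately show ?thesis by blast
qed

lemma coord_exists: obtains q u where "coord q u m"
proof -
  obtain q r where q: "q \<in> \<P>" "r \<in> tc_dom q" "tc_base q r = prj m"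
    using atlas unfolding action_angle_atlas_def by (metis imageE)
  then have "range (\<lambda>\<theta>. tc_map q (r, \<theta>)) = prj -` {tc_base q r}"
    using torus_coords unfolding is_torus_coords_def by blast
  then have "m \<in> range (\<lambda>\<theta>. tc_map q (r, \<theta>))" using q by simp
  then obtain \<theta> where "tc_map q (r, \<theta>) = m" by blast
  then show ?thesis using that[of q "(r, \<theta>)"] q by (simp add: coord_def)
qed

lemma same_coords_jacobian:
  assumes "q \<in> \<P>" "u \<in> fst (tc_chart q \<theta>)" "u \<in> fst (tc_chart q \<theta>')"
  shows "transition (tc_chart q \<theta>) (tc_chart q \<theta>') u = u"
    "chart_jacobian (tc_chart q \<theta>) (tc_chart q \<theta>') u = (\<lambda>v. v)"
  using chart_jacobian_same_map[of "tc_dom q \<times> ball \<theta> pi" "tc_map q" "tc_dom q \<times> ball \<theta>' pi" u]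
    chart[OF tc_chart_in[OF assms(1)], of \<theta>] chart[OF tc_chart_in[OF assms(1)], of \<theta>'] assms(2,3)
  by (simp_all add: tc_chart_def)

lemma form_in_coords:
  assumes "diff_form \<A> \<omega>" "q \<in> \<P>" "u \<in> fst (tc_chart q \<theta>)"
  shows "\<omega> (tc_chart q \<theta>) u = in_coords \<omega> q u"
proof
  fix vs
  have u: "u \<in> fst (tc_chart q (snd u))" using assms(3) by (simp add: fst_tc_chart)
  have "u \<in> overlap (tc_chart q \<theta>) (tc_chart q (snd u))"
    by (rule overlapI[OF assms(3) u]) simp
  from diff_form_transition[OF assms(1) tc_chart_in[OF assms(2)] tc_chart_in[OF assms(2)] this, of vs]
  show "\<omega> (tc_chart q \<theta>) u vs = in_coords \<omega> q u vs"
    by (simp add: same_coords_jacobian[OF assms(2,3) u] in_coords_def)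
qed

lemma J_in_coords:
  assumes "q \<in> \<P>" "fst u \<in> tc_dom q" shows "in_coords J q u = std_symp"
proof
  fix vs
  have "action_angle \<A> \<B> prj J q" using atlas assms(1) unfolding action_angle_atlas_def by blast
  then have "\<forall>u\<in>tc_dom q \<times> UNIV. \<forall>vs. in_coords J q u vs = (\<Sum>j\<in>UNIV. wedge (d_theta j) (d_r j) vs)"
    unfolding action_angle_def by (rule conjunct2)
  moreover have "u \<in> tc_dom q \<times> UNIV" using assms(2) by (simp add: mem_Times_iff)
  ultimately show "in_coords J q u vs = std_symp vs" unfolding std_symp_def by blast
qed

lemma \<Omega>_invariant:
  assumes "q \<in> \<P>" "fst u \<in> tc_dom q" "fst u = fst u'" shows "in_coords \<Omega> q u = in_coords \<Omega> q u'"
proof -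
  have "\<forall>r\<in>tc_dom q. \<forall>\<theta> \<theta>'. in_coords \<Omega> q (r, \<theta>) = in_coords \<Omega> q (r, \<theta>')"
    using semiflat assms(1) unfolding semi_flat_def fibre_invariant_def by blast
  then have "in_coords \<Omega> q (fst u, snd u) = in_coords \<Omega> q (fst u, snd u')" using assms(2) by blast
  then show ?thesis by (metis assms(3) prod.collapse)
qed

lemma in_coords_alternating: "diff_form \<A> \<omega> \<Longrightarrow> q \<in> \<P> \<Longrightarrow> fst u \<in> tc_dom q \<Longrightarrow> alternating (in_coords \<omega> q u)"
  unfolding in_coords_def by (rule diff_form_alternating[OF _ tc_chart_in tc_chart_self])

text \<open>On \<open>darboux_basis\<close> the volume condition gives \<Omega> wedged with its
  conjugate the value 16, because the fourth power of J takes the value 4! there.\<close>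

lemma acs_determined_coords:
  assumes q: "q \<in> \<P>" "fst u \<in> tc_dom q"
  shows "acs_determined 4 (in_coords \<Omega> q u)"
proof -
  have c: "tc_chart q (snd u) \<in> \<A>" "u \<in> fst (tc_chart q (snd u))"
    using tc_chart_in q tc_chart_self by blast+
  have SU: "SU_structure_at 4 1 (in_coords J q u) (in_coords \<Omega> q u)"
    unfolding in_coords_def by (rule SU_at[OF c])
  have deg: "has_degree 2 (in_coords J q u)"
    unfolding in_coords_def by (rule J_degree[OF c])
  have "wedge_power (in_coords J q u) 4 darboux_basis = 24"
    by (rule wedge_power_darboux[OF deg]) (simp add: J_in_coords[OF q])
  moreover have "1 / 2 ^ 4 * wedge (in_coords \<Omega> q u) (conj_form (in_coords \<Omega> q u)) darboux_basis =
      \<i> ^ 4 / fact 4 * complex_of_real 1 * wedge_power (in_coords J q u) 4 darboux_basis"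
    using SU unfolding SU_structure_at_def by blast
  ultimately have "wedge (in_coords \<Omega> q u) (conj_form (in_coords \<Omega> q u)) darboux_basis \<noteq> 0"
    by (auto simp: fact_numeral)
  then show ?thesis
    using SU by (intro acs_determinedI[OF _ _ in_coords_alternating[OF \<Omega>_form q] distinct_darboux_basis set_darboux_basis])
      (simp_all add: SU_structure_at_def)
qed

section \<open>The almost complex structure in torus coordinates\<close>

definition I_at :: "('b, 'm) torus_coords \<Rightarrow> model \<Rightarrow> model \<Rightarrow> model" where
  "I_at q u = acs 4 (in_coords \<Omega> q u)"

lemma frame_props:
  assumes "q \<in> \<P>" "r \<in> tc_dom q"
  shows "transpose (a q r) = a q r" "transpose (\<rho> q r) = \<rho> q r" "invertible (\<rho> q r)"
  using frame assms by (auto simp: semi_flat_frame_def)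

text \<open>These are the imaginary and the real part of \<zeta>(I v) = \<i> \<zeta>(v) for the
  frame of (1,0)-forms.\<close>

lemma I_at_formula:
  assumes q: "q \<in> \<P>" "fst u \<in> tc_dom q"
  shows "\<rho> q (fst u) *v fst (I_at q u v) = snd v + a q (fst u) *v fst v"
    and "snd (I_at q u v) + a q (fst u) *v fst (I_at q u v) = - (\<rho> q (fst u) *v fst v)"
proof -
  let ?a = "a q (fst u)" and ?\<rho> = "\<rho> q (fst u)" and ?I = "I_at q u"
  have "form10 (acs 4 (in_coords \<Omega> q (fst u, snd u))) (zeta ?a ?\<rho> j)" for j
    using frame q unfolding semi_flat_frame_def by blast
  then have f: "zeta ?a ?\<rho> j [?I v] = \<i> * zeta ?a ?\<rho> j [v]" for j
    unfolding form10_def I_at_def prod.collapse by blast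
  have z: "zeta ?a ?\<rho> j [w] = of_real ((snd w + ?a *v fst w) $ j) + \<i> * of_real ((?\<rho> *v fst w) $ j)" for j w
    by (simp add: zeta_def d_theta_def d_r_def one_form_def matrix_vector_mult_def)
  have "(snd (?I v) + ?a *v fst (?I v)) $ j = - ((?\<rho> *v fst v) $ j) \<and> (?\<rho> *v fst (?I v)) $ j = (snd v + ?a *v fst v) $ j" for j
    using f[of j] unfolding z by (auto simp: complex_eq_iff)
  then show "?\<rho> *v fst (?I v) = snd v + ?a *v fst v" "snd (?I v) + ?a *v fst (?I v) = - (?\<rho> *v fst v)"
    by (simp_all add: vec_eq_iff)
qed

lemma I_at_props:
  assumes "q \<in> \<P>" "fst u \<in> tc_dom q"
  shows "linear (I_at q u)" "I_at q u (I_at q u v) = - v" "slotwise (I_at q u) \<i> (in_coords \<Omega> q u)"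
  using acs_props[OF acs_determined_coords[OF assms]] pq_type_slotwise
  unfolding I_at_def almost_complex_def by blast+

definition hor :: "('b, 'm) torus_coords \<Rightarrow> model \<Rightarrow> model \<Rightarrow> model" where
  "hor q u v = (fst v, - (a q (fst u) *v fst v))"

lemma linear_hor: "linear (hor q u)"
  by (rule linearI) (simp_all add: hor_def matrix_vector_right_distrib matrix_vector_mult_scaleR)

text \<open>This is why the horizontal projection depends on the fibration and on \<open>\<Omega>\<close> only, and not on the
  action-angle coordinates.\<close>

lemma hor_eq_I_vert:
  assumes q: "q \<in> \<P>" "fst u \<in> tc_dom q"
  shows "hor q u v = I_at q u (vert (\<rho> q (fst u) *v fst v))"
proof -
  let ?a = "a q (fst u)" and ?\<rho> = "\<rho> q (fst u)"
  have "?\<rho> *v fst (I_at q u (vert (?\<rho> *v fst v))) = ?\<rho> *v fst v"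
    using I_at_formula(1)[OF q, of "vert (?\<rho> *v fst v)"] by simp
  then have 1: "fst (I_at q u (vert (?\<rho> *v fst v))) = fst v"
    by (rule invertible_eqD[OF frame_props(3)[OF q]])
  moreover have "snd (I_at q u (vert (?\<rho> *v fst v))) = - (?a *v fst v)"
    using I_at_formula(2)[OF q, of "vert (?\<rho> *v fst v)"] unfolding 1 by (simp add: eq_neg_iff_add_eq_0)
  ultimately show ?thesis by (simp add: hor_def prod_eq_iff)
qed

lemma fst_I_vert:
  assumes "q \<in> \<P>" "fst u \<in> tc_dom q"
  shows "hor q u (I_at q u (vert y)) = I_at q u (vert y)"
  using I_at_formula(2)[OF assms, of "vert y"] by (simp add: hor_def prod_eq_iff eq_neg_iff_add_eq_0[symmetric])

text \<open>The \<zeta> restrict to the d\<theta> on vertical vectors, so this is the coefficient f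
  of \<Omega> in front of the product of the \<zeta>.\<close>

definition f_at :: "('b, 'm) torus_coords \<Rightarrow> model \<Rightarrow> complex" where
  "f_at q u = in_coords \<Omega> q u (map vert axes4)"

lemma split_vert:
  assumes "q \<in> \<P>" "fst u \<in> tc_dom q"
  shows "\<exists>y y'. v = vert y + I_at q u (vert y')"
proof (intro exI)
  have "v = vert (snd v + a q (fst u) *v fst v) + hor q u v"
    by (simp add: hor_def prod_eq_iff)
  then show "v = vert (snd v + a q (fst u) *v fst v) + I_at q u (vert (\<rho> q (fst u) *v fst v))"
    using hor_eq_I_vert[OF assms] by simp
qed

lemma f_at_nonzero:
  assumes q: "q \<in> \<P>" "fst u \<in> tc_dom q" shows "f_at q u \<noteq> 0"
proof
  assume f: "f_at q u = 0"
  let ?\<omega> = "in_coords \<Omega> q u"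
  have alt: "alternating ?\<omega>" by (rule in_coords_alternating[OF \<Omega>_form q])
  have "?\<omega> (map vert ys) = 0" if "length ys = 4" for ys
    using alternating_det_form_eq[OF alt linear_vert that] f by (simp add: f_at_def)
  then have "?\<omega> vs = 0" if "length vs = 4" for vs
    using slotwise_zero[OF alternating_multilinear[OF alt] I_at_props(3)[OF q] _ split_vert[OF q]] that by blast
  moreover have "?\<omega> vs = 0" if "length vs \<noteq> 4" for vs
    using that \<Omega>_degree[OF tc_chart_in tc_chart_self, OF q] by (simp add: in_coords_def has_degree_def)
  ultimately have "?\<omega> vs = 0" for vs by blast
  moreover have "\<exists>vs. ?\<omega> vs \<noteq> 0"
    using SU_at[OF tc_chart_in tc_chart_self, OF q] by (simp add: in_coords_def SU_structure_at_def)
  ultimately show False by blast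
qed

section \<open>Changes of torus coordinates\<close>

definition change :: "('b, 'm) torus_coords \<Rightarrow> model \<Rightarrow> ('b, 'm) torus_coords \<Rightarrow> model \<Rightarrow> model \<Rightarrow> model" where
  "change q u q' u' = chart_jacobian (tc_chart q (snd u)) (tc_chart q' (snd u')) u"

context
  fixes q u q' u' m
  assumes m: "coord q u m" "coord q' u' m"
begin

private lemma q: "q \<in> \<P>" "fst u \<in> tc_dom q" "q' \<in> \<P>" "fst u' \<in> tc_dom q'" "tc_map q u = tc_map q' u'"
  using m by (simp_all add: coord_def)

private lemma c: "tc_chart q (snd u) \<in> \<A>" "tc_chart q' (snd u') \<in> \<A>"
  using tc_chart_in q by blast+

private lemma ov: "u \<in> overlap (tc_chart q (snd u)) (tc_chart q' (snd u'))"
  by (rule overlapI[OF tc_chart_self tc_chart_self]) (simp_all add: q)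

private lemma tr: "transition (tc_chart q (snd u)) (tc_chart q' (snd u')) u = u'"
  by (rule transition_eqI[OF chart[OF c(2)] tc_chart_self]) (simp_all add: q)

lemma linear_change: "linear (change q u q' u')"
  unfolding change_def by (rule linear_chart_jacobian[OF smooth_\<A> c ov])

lemma bij_change: "bij (change q u q' u')"
  unfolding change_def by (rule bij_chart_jacobian[OF smooth_\<A> c ov])

lemma change_form: "diff_form \<A> \<omega> \<Longrightarrow> in_coords \<omega> q u vs = in_coords \<omega> q' u' (map (change q u q' u') vs)"
  using diff_form_transition[OF _ c ov, of \<omega> vs] by (simp add: in_coords_def change_def tr)

lemma change_base:
  obtains L where "det L = 1" "\<And>v. fst (change q u q' u' v) = L *v fst v"
proof -
  let ?c = "tc_chart q (snd u)" and ?c' = "tc_chart q' (snd u')"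
  have "tc_base q (fst u) = tc_base q' (fst u')"
    using prj_tc_map[of q u] prj_tc_map[of q' u'] q by metis
  then have "tc_base q (fst u) \<in> tc_base q' ` tc_dom q'" using q by blast
  then obtain L s e where L: "det L = 1" "e > 0"
    "\<forall>r\<in>tc_dom q \<inter> ball (fst u) e. \<forall>r'\<in>tc_dom q'. tc_base q r = tc_base q' r' \<longrightarrow> r' = L *v r + s"
    using atlas q unfolding action_angle_atlas_def by blast
  let ?W = "overlap ?c ?c' \<inter> (ball (fst u) e \<times> UNIV)"
  have W: "open ?W" "u \<in> ?W"
    using open_overlap[OF chart[OF c(1)] chart[OF c(2)]] ov L(2)
    by (auto simp: mem_Times_iff intro!: open_Int open_Times)
  have eq: "L *v fst z + s = fst (transition ?c ?c' z)" if "z \<in> ?W" for z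
  proof -
    have z: "z \<in> overlap ?c ?c'" "fst z \<in> ball (fst u) e" using that by (auto simp: mem_Times_iff)
    have z': "transition ?c ?c' z \<in> fst ?c'" "tc_map q' (transition ?c ?c' z) = tc_map q z"
      using transition_in[OF chart[OF c(2)] z(1)] by simp_all
    have d: "fst z \<in> tc_dom q" "fst (transition ?c ?c' z) \<in> tc_dom q'"
      using overlap_fst[OF z(1)] z'(1) by (simp_all add: fst_tc_chart)
    have "tc_base q (fst z) = tc_base q' (fst (transition ?c ?c' z))"
      using prj_tc_map[OF q(1) d(1)] prj_tc_map[OF q(3) d(2)] z'(2) by simp
    then show ?thesis using L(3) d z(2) by auto
  qed
  have "((\<lambda>z. L *v fst z + s) has_derivative (\<lambda>v. L *v fst v)) (at u)"
    by (auto intro!: derivative_eq_intros bounded_linear.has_derivative[OF matrix_vector_mul_bounded_linear])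
  then have 1: "((\<lambda>z. fst (transition ?c ?c' z)) has_derivative (\<lambda>v. L *v fst v)) (at u)"
    by (rule has_derivative_transform_within_open[OF _ W eq])
  have 2: "((\<lambda>z. fst (transition ?c ?c' z)) has_derivative (\<lambda>v. fst (change q u q' u' v))) (at u)"
    unfolding change_def by (rule has_derivative_fst[OF chart_jacobian_has_derivative[OF smooth_\<A> c ov]])
  show ?thesis using that[OF L(1)] has_derivative_unique[OF 2 1] by metis
qed

text \<open>J pairs fibre with base directions in the same way in both coordinate systems, so the
  fibre block is the inverse transpose of the base block L, and det L = 1 gives det N = 1.\<close>

lemma change_fibre:
  obtains N where "det N = 1" "\<And>y. change q u q' u' (vert y) = vert (N *v y)"
proof -
  let ?E = "change q u q' u'"
  obtain L where L: "det L = 1" "\<And>v. fst (?E v) = L *v fst v" by (rule change_base) (rule that)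
  define N where "N = matrix (\<lambda>y. snd (?E (vert y)))"
  have "linear (\<lambda>y. snd (?E (vert y)))"
    using linear_compose[OF linear_compose[OF linear_vert linear_change] linear_snd] by (simp add: o_def)
  then have N: "N *v y = snd (?E (vert y))" for y
    unfolding N_def by (simp add: matrix_works)
  have E: "?E (vert y) = vert (N *v y)" for y
    using L(2)[of "vert y"] N[of y] by (simp add: prod_eq_iff)
  have "y \<bullet> x = (N *v y) \<bullet> (L *v x)" for x y
  proof -
    have "std_symp [vert y, horiz x] = std_symp [?E (vert y), ?E (horiz x)]"
      using change_form[OF J_form, of "[vert y, horiz x]"] by (simp add: J_in_coords q)
    then show ?thesis by (simp add: std_symp_2 E L(2) flip: of_real_diff)
  qed
  then have "(transpose L ** N) *v y = mat 1 *v y" for y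
    by (intro vector_eq_rdot[THEN iffD1])
      (simp add: matrix_vector_mul_assoc[symmetric] transpose_matrix_vector dot_lmul_matrix)
  then have "transpose L ** N = mat 1" by (simp add: matrix_eq)
  then have "det L * det N = 1" by (metis det_I det_mul det_transpose)
  then show ?thesis using that[of N] L(1) E by simp
qed

lemma change_I: "change q u q' u' (I_at q u v) = I_at q' u' (change q u q' u' v)"
proof -
  have "in_coords \<Omega> q u = pull (change q u q' u') (in_coords \<Omega> q' u')"
    using change_form[OF \<Omega>_form] by (auto simp: pull_def)
  then have "I_at q u = inv (change q u q' u') \<circ> I_at q' u' \<circ> change q u q' u'"
    unfolding I_at_def using acs_pull(2)[OF linear_change bij_change acs_determined_coords[OF q(3,4)]] by simp
  then show ?thesis using bij_change by (simp add: bij_is_surj surj_f_inv_f)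
qed

text \<open>A change of coordinates multiplies f by det N. Here the linear parts having determinant
  1 makes f a function on the whole manifold.\<close>

lemma change_f: "f_at q u = f_at q' u'"
proof -
  obtain N where N: "det N = 1" "\<And>y. change q u q' u' (vert y) = vert (N *v y)" by (rule change_fibre) (rule that)
  have "f_at q u = in_coords \<Omega> q' u' (map (\<lambda>y. vert (N *v y)) axes4)"
    unfolding f_at_def change_form[OF \<Omega>_form] by (simp add: N(2) o_def)
  then show ?thesis
    using alternating_det[OF in_coords_alternating[OF \<Omega>_form q(3,4)] linear_vert, of N] N(1)
    by (simp add: f_at_def)
qed

lemma change_hor: "change q u q' u' (hor q u v) = hor q' u' (change q u q' u' v)"
proof -
  let ?E = "change q u q' u'"
  obtain N where N: "\<And>y. ?E (vert y) = vert (N *v y)" by (rule change_fibre) blast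
  obtain L where L: "\<And>v. fst (?E v) = L *v fst v" by (rule change_base) blast
  have "?E (hor q u v) = I_at q' u' (vert (N *v (\<rho> q (fst u) *v fst v)))"
    by (simp add: hor_eq_I_vert[OF q(1,2)] change_I N)
  then have "hor q' u' (?E (hor q u v)) = ?E (hor q u v)"
    using fst_I_vert[OF q(3,4)] by simp
  moreover have "fst (?E (hor q u v)) = fst (?E v)" by (simp add: L hor_def)
  ultimately show ?thesis by (simp add: hor_def prod_eq_iff)
qed

end

section \<open>The horizontal projection in arbitrary charts\<close>

lemma overlap_tc:
  assumes "u \<in> fst c" "coord q w (snd c u)"
  shows "u \<in> overlap c (tc_chart q (snd w))" "transition c (tc_chart q (snd w)) u = w"
    "tc_chart q (snd w) \<in> \<A>"
proof -
  have w: "w \<in> fst (tc_chart q (snd w))" "tc_map q w = snd c u" "q \<in> \<P>"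
    using assms(2) tc_chart_self[of w q] by (simp_all add: coord_def)
  show "u \<in> overlap c (tc_chart q (snd w))" using w assms by (intro overlapI[of _ _ w]) auto
  show "tc_chart q (snd w) \<in> \<A>" using w tc_chart_in by blast
  then show "transition c (tc_chart q (snd w)) u = w" using w by (intro transition_eqI) (auto intro: chart)
qed

text \<open>\<open>D_star\<close> and \<open>D_star_perp\<close> collect the forms of all torus
  coordinates at the point. That one map meets the conditions for all of them rests on
  \<open>change_base\<close> and \<open>change_hor\<close>; it is unique because the dr and
  \<delta>\<theta> of a single system already determine a vector.\<close>

lemma proj_D_unique:
  assumes c: "c \<in> \<A>" "u \<in> fst c" and w: "coord q w (snd c u)"
  shows "chart_jacobian c (tc_chart q (snd w)) u (proj_D \<P> a c u v) =
    hor q w (chart_jacobian c (tc_chart q (snd w)) u v)"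
    and "linear (proj_D \<P> a c u)"
proof -
  let ?D = "chart_jacobian c (tc_chart q (snd w)) u"
  note ov = overlap_tc[OF c(2) w]
  have lin: "linear ?D" and bij: "bij ?D"
    using linear_chart_jacobian[OF smooth_\<A> c(1) ov(3,1)] bij_chart_jacobian[OF smooth_\<A> c(1) ov(3,1)] .
  have i: "inv ?D (?D v) = v" "?D (inv ?D v) = v" for v
    using bij by (simp_all add: bij_is_surj surj_f_inv_f bij_is_inj inv_f_f)
  define P where "P = inv ?D \<circ> hor q w \<circ> ?D"
  have DP: "?D (P v) = hor q w (?D v)" for v by (simp add: P_def i)
  have linP: "linear P"
    unfolding P_def by (intro linear_compose lin linear_hor linear_inv_bij[OF lin bij])
  have ch: "chart_jacobian c (tc_chart q' (snd w')) u v = change q w q' w' (?D v)"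
    if "coord q' w' (snd c u)" for q' w' v
    using chart_jacobian_chain[OF smooth_\<A> c(1) ov(3) overlap_tc(3)[OF c(2) that] ov(1) overlap_tc(1)[OF c(2) that], of v]
    by (simp add: change_def ov(2))
  have ok: "\<beta> (P v) = \<beta> v" if \<beta>: "\<beta> \<in> D_star \<P> c u" for \<beta> v
  proof -
    obtain q' r \<theta> k where b: "\<beta> = (\<lambda>v. \<Sum>j\<in>UNIV. k $ j * (fst (chart_jacobian c (tc_chart q' \<theta>) u v) $ j))"
      "coord q' (r, \<theta>) (snd c u)" using \<beta> by (auto simp: D_star_def coord_def)
    obtain L where L: "\<And>v. fst (change q w q' (r, \<theta>) v) = L *v fst v" by (rule change_base[OF w b(2)]) blast
    show ?thesis
      using ch[OF b(2), of v] ch[OF b(2), of "P v"] by (simp add: b(1) L DP hor_def)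
  qed
  have ok': "\<beta> (P v) = 0" if \<beta>: "\<beta> \<in> D_star_perp \<P> a c u" for \<beta> v
  proof -
    obtain q' r \<theta> k where b: "\<beta> = (\<lambda>v. \<Sum>j\<in>UNIV. k $ j * ((snd (chart_jacobian c (tc_chart q' \<theta>) u v)
        + a q' r *v fst (chart_jacobian c (tc_chart q' \<theta>) u v)) $ j))"
      "coord q' (r, \<theta>) (snd c u)" using \<beta> by (auto simp: D_star_perp_def coord_def)
    have "chart_jacobian c (tc_chart q' \<theta>) u (P v) = hor q' (r, \<theta>) (change q w q' (r, \<theta>) (?D v))"
      using ch[OF b(2), of "P v"] change_hor[OF w b(2), of "?D v"] by (simp add: DP)
    then show ?thesis by (simp add: b(1) hor_def)
  qed
  have un: "P' = P" if P': "linear P' \<and> (\<forall>\<beta>\<in>D_star \<P> c u. \<forall>v. \<beta> (P' v) = \<beta> v) \<and> (\<forall>\<beta>\<in>D_star_perp \<P> a c u. \<forall>v. \<beta> (P' v) = 0)" for P'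
  proof
    fix v
    have w': "q \<in> \<P>" "fst w \<in> tc_dom q" "tc_map q (fst w, snd w) = snd c u" using w by (simp_all add: coord_def)
    have mem1: "(\<lambda>v. \<Sum>j\<in>UNIV. k $ j * (fst (?D v) $ j)) \<in> D_star \<P> c u" for k
      unfolding D_star_def using w' by blast
    have 1: "(\<Sum>j\<in>UNIV. k $ j * (fst (?D (P' v)) $ j)) = (\<Sum>j\<in>UNIV. k $ j * (fst (?D v) $ j))" for k :: "real^4"
      using P'[THEN conjunct2, THEN conjunct1, rule_format, OF mem1[of k], of v] .
    have mem2: "(\<lambda>v. \<Sum>j\<in>UNIV. k $ j * ((snd (?D v) + a q (fst w) *v fst (?D v)) $ j)) \<in> D_star_perp \<P> a c u" for k
      unfolding D_star_perp_def using w' by blast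
    have 2: "(\<Sum>j\<in>UNIV. k $ j * ((snd (?D (P' v)) + a q (fst w) *v fst (?D (P' v))) $ j)) = 0" for k :: "real^4"
      using P'[THEN conjunct2, THEN conjunct2, rule_format, OF mem2[of k], of v] .
    have ax: "(\<Sum>j\<in>UNIV. axis l 1 $ j * x $ j) = x $ l" for l :: 4 and x :: "real^4"
      using inner_axis'[of l 1 x] by (simp add: inner_vec_def)
    have "fst (?D (P' v)) = fst (?D v)" using 1[of "axis l 1" for l] by (simp add: ax vec_eq_iff)
    moreover have "snd (?D (P' v)) + a q (fst w) *v fst (?D (P' v)) = 0"
      using 2[of "axis l 1" for l] unfolding ax by (simp add: vec_eq_iff)
    ultimately have "?D (P' v) = ?D (P v)"
      unfolding DP by (simp add: hor_def prod_eq_iff eq_neg_iff_add_eq_0)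
    then show "P' v = P v" using bij by (metis bij_is_inj injD)
  qed
  have "proj_D \<P> a c u = P"
    unfolding proj_D_def by (rule the_equality) (use linP ok ok' un in blast)+
  then show "?D (proj_D \<P> a c u v) = hor q w (?D v)" "linear (proj_D \<P> a c u)"
    using DP linP by simp_all
qed

lemma proj_D_transition:
  assumes c: "c \<in> \<A>" "c' \<in> \<A>" "u \<in> overlap c c'"
  shows "chart_jacobian c c' u (proj_D \<P> a c u v) = proj_D \<P> a c' (transition c c' u) (chart_jacobian c c' u v)"
proof -
  obtain q w where w: "coord q w (snd c u)" by (rule coord_exists)
  let ?u' = "transition c c' u" and ?t = "tc_chart q (snd w)"
  have u': "?u' \<in> fst c'" "snd c' ?u' = snd c u" using transition_in[OF chart[OF c(2)] c(3)] .
  have w': "coord q w (snd c' ?u')" using w u' by simp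
  note ov = overlap_tc[OF overlap_fst[OF c(3)] w] and ov' = overlap_tc[OF u'(1) w']
  have ch: "chart_jacobian c ?t u v = chart_jacobian c' ?t ?u' (chart_jacobian c c' u v)" for v
    by (rule chart_jacobian_chain[OF smooth_\<A> c(1,2) ov(3) c(3) ov(1)])
  have "chart_jacobian c' ?t ?u' (chart_jacobian c c' u (proj_D \<P> a c u v)) =
      chart_jacobian c' ?t ?u' (proj_D \<P> a c' ?u' (chart_jacobian c c' u v))"
    using proj_D_unique(1)[OF c(1) overlap_fst[OF c(3)] w, of v] proj_D_unique(1)[OF c(2) u'(1) w', of "chart_jacobian c c' u v"]
    by (simp add: ch)
  then show ?thesis
    using bij_chart_jacobian[OF smooth_\<A> c(2) ov(3) ov'(1)] by (metis bij_is_inj injD)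
qed

lemma proj_D_tc_chart:
  assumes "q \<in> \<P>" "u \<in> fst (tc_chart q \<theta>)"
  shows "proj_D \<P> a (tc_chart q \<theta>) u = hor q u"
proof
  fix v
  have u: "u \<in> fst (tc_chart q (snd u))" "coord q u (snd (tc_chart q \<theta>) u)"
    using assms by (simp_all add: fst_tc_chart coord_def)
  show "proj_D \<P> a (tc_chart q \<theta>) u v = hor q u v"
    using proj_D_unique(1)[OF tc_chart_in[OF assms(1)] assms(2) u(2), of v]
    by (simp add: same_coords_jacobian[OF assms u(1)])
qed

end

section \<open>Stretching the horizontal directions\<close>

lemma alternating_degree_part:
  assumes "alternating \<omega>" shows "alternating (\<lambda>vs. if length vs = k then \<omega> vs else 0)"
  by (rule alternatingI_adjacent[OF multilinearI])
    (simp_all add: multilinear_add[OF alternating_multilinear[OF assms]]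
      multilinear_scale[OF alternating_multilinear[OF assms]] alternating_adjacent[OF assms])

lemma smooth_on_map_args:
  fixes T :: "'a::real_normed_vector \<Rightarrow> 'v \<Rightarrow> 'e::euclidean_space"
  assumes "open U" "\<And>u. u \<in> U \<Longrightarrow> multilinear (\<omega> u)" "\<And>vs. smooth_on U (\<lambda>u. \<omega> u vs)"
    and "\<And>v. v \<in> set vs \<Longrightarrow> smooth_on U (\<lambda>u. T u v)"
  shows "smooth_on U (\<lambda>u. \<omega> u (map (T u) vs))"
proof -
  have "smooth_on U (\<lambda>u. \<omega> u ([] @ map (\<lambda>w. w u) (map (\<lambda>v u. T u v) vs)))"
    by (rule smooth_on_form_args[OF assms(1-3)]) (use assms(4) in auto)
  then show ?thesis by (simp add: o_def)
qed

context semiflat_bundle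
begin

section \<open>The coefficient of \<Omega> as a global function\<close>

definition fcoef :: "'m \<Rightarrow> complex" where
  "fcoef m = (SOME z. \<exists>q u. coord q u m \<and> z = f_at q u)"

lemma fcoef_eq: assumes "coord q u m" shows "fcoef m = f_at q u"
proof -
  have "\<exists>q' u'. coord q' u' m \<and> fcoef m = f_at q' u'"
    unfolding fcoef_def by (rule someI[of _ "f_at q u"]) (use assms in blast)
  then show ?thesis using change_f[OF assms] by metis
qed

lemma fcoef_nonzero: "fcoef m \<noteq> 0"
proof -
  obtain q u where u: "coord q u m" by (rule coord_exists)
  then show ?thesis using fcoef_eq[OF u] f_at_nonzero[of q u] by (simp add: coord_def)
qed

lemma coord_tc_chart: "q \<in> \<P> \<Longrightarrow> u \<in> fst (tc_chart q \<theta>) \<Longrightarrow> coord q u (tc_map q u)"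
  by (simp add: coord_def fst_tc_chart)

lemma open_tc_chart: "q \<in> \<P> \<Longrightarrow> open (fst (tc_chart q \<theta>))"
  by (rule is_chart_open[OF chart[OF tc_chart_in]])

lemma smooth_funI_tc:
  assumes "\<And>q \<theta>. q \<in> \<P> \<Longrightarrow> smooth_on (fst (tc_chart q \<theta>)) (\<lambda>z. h (tc_map q z))"
  shows "smooth_fun \<A> h"
proof (rule smooth_funI_local[OF smooth_\<A>])
  fix m
  obtain q u where u: "coord q u m" by (rule coord_exists)
  then have "q \<in> \<P>" "u \<in> fst (tc_chart q (snd u))" "tc_map q u = m" using tc_chart_self[of u q] by (simp_all add: coord_def)
  then show "\<exists>c u V. c \<in> \<A> \<and> u \<in> fst c \<and> snd c u = m \<and> open V \<and> u \<in> V \<and> V \<subseteq> fst c \<and> smooth_on V (\<lambda>z. h (snd c z))"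
    using assms tc_chart_in open_tc_chart
    by (intro exI[of _ "tc_chart q (snd u)"] exI[of _ u] exI[of _ "fst (tc_chart q (snd u))"]) simp
qed

lemma diff_formI_tc:
  assumes alt: "\<And>c u. c \<in> \<A> \<Longrightarrow> u \<in> fst c \<Longrightarrow> alternating (\<omega> c u)"
    and law: "\<And>c c' u vs. c \<in> \<A> \<Longrightarrow> c' \<in> \<A> \<Longrightarrow> u \<in> overlap c c' \<Longrightarrow>
        \<omega> c u vs = \<omega> c' (transition c c' u) (map (chart_jacobian c c' u) vs)"
    and loc: "\<And>q \<theta> vs. q \<in> \<P> \<Longrightarrow> smooth_on (fst (tc_chart q \<theta>)) (\<lambda>z. \<omega> (tc_chart q \<theta>) z vs)"
  shows "diff_form \<A> \<omega>"
proof (rule diff_formI_local[OF smooth_\<A> alt law])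
  fix m
  obtain q u where u: "coord q u m" by (rule coord_exists)
  then have "q \<in> \<P>" "u \<in> fst (tc_chart q (snd u))" "tc_map q u = m" using tc_chart_self[of u q] by (simp_all add: coord_def)
  then show "\<exists>c u V. c \<in> \<A> \<and> u \<in> fst c \<and> snd c u = m \<and> open V \<and> u \<in> V \<and> V \<subseteq> fst c \<and> (\<forall>vs. smooth_on V (\<lambda>z. \<omega> c z vs))"
    using loc tc_chart_in open_tc_chart
    by (intro exI[of _ "tc_chart q (snd u)"] exI[of _ u] exI[of _ "fst (tc_chart q (snd u))"]) simp
qed

lemma smooth_fcoef: "smooth_fun \<A> fcoef"
proof (rule smooth_funI_tc)
  fix q \<theta> assume q: "q \<in> \<P>"
  show "smooth_on (fst (tc_chart q \<theta>)) (\<lambda>z. fcoef (tc_map q z))"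
    by (rule smooth_on_cong[OF open_tc_chart[OF q] _ diff_form_smooth[OF \<Omega>_form tc_chart_in[OF q], of _ "map vert axes4"]])
      (simp add: fcoef_eq[OF coord_tc_chart[OF q]] f_at_def form_in_coords[OF \<Omega>_form q])
qed

section \<open>Smoothness of the projections\<close>

lemma smooth_hor:
  assumes "q \<in> \<P>" shows "smooth_on (fst (tc_chart q \<theta>)) (\<lambda>z. hor q z v)"
proof -
  let ?U = "fst (tc_chart q \<theta>)"
  have op: "open ?U" by (rule open_tc_chart[OF assms])
  have "smooth_on (tc_dom q) (a q)" using frame assms by (simp add: semi_flat_frame_def)
  then have "smooth_on ?U (\<lambda>z. a q (fst z))"
    by (rule smooth_on_compose[OF op open_tc_dom[OF assms] _ smooth_on_bounded_linear[OF bounded_linear_fst]])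
      (auto simp: fst_tc_chart)
  moreover have "bounded_linear (\<lambda>M::real^4^4. vert (- (M *v fst v)))"
    unfolding linear_conv_bounded_linear[symmetric]
    by (rule linearI) (simp_all add: matrix_vector_mult_add_rdistrib scaleR_matrix_vector_assoc)
  ultimately have "smooth_on ?U (\<lambda>z. horiz (fst v) + vert (- (a q (fst z) *v fst v)))"
    by (intro smooth_on_add[OF op] smooth_on_const smooth_on_compose_linear[OF op, where f = "\<lambda>M. vert (- (M *v fst v))"])
  then show ?thesis by (simp add: hor_def)
qed

lemma smooth_proj_D:
  assumes "q \<in> \<P>" shows "smooth_on (fst (tc_chart q \<theta>)) (\<lambda>z. proj_D \<P> a (tc_chart q \<theta>) z v)"
  by (rule smooth_on_cong[OF open_tc_chart[OF assms] _ smooth_hor[OF assms]])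
    (simp add: proj_D_tc_chart[OF assms])

lemma linear_proj_D: assumes "c \<in> \<A>" "u \<in> fst c" shows "linear (proj_D \<P> a c u)"
proof -
  obtain q w where "coord q w (snd c u)" by (rule coord_exists)
  then show ?thesis by (rule proj_D_unique(2)[OF assms])
qed

lemma pi_D_split_part:
  "pi_D \<P> a m n \<omega> c u vs = (if length vs = m + n
    then split_part (proj_D \<P> a c u) (\<lambda>v. v - proj_D \<P> a c u v) m (\<omega> c u) vs else 0)"
  by (simp add: pi_D_def split_part_def)

lemma diff_form_pi_D:
  assumes w: "diff_form \<A> \<omega>" shows "diff_form \<A> (pi_D \<P> a m n \<omega>)"
proof (rule diff_formI_tc)
  fix c u assume c: "c \<in> \<A>" "u \<in> fst c"
  have "alternating (split_part (proj_D \<P> a c u) (\<lambda>v. v - proj_D \<P> a c u v) m (\<omega> c u))"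
    using linear_proj_D[OF c]
    by (intro alternating_split_part diff_form_alternating[OF w c] linear_compose_sub linear_ident)
  from alternating_degree_part[OF this, of "m + n"]
  show "alternating (pi_D \<P> a m n \<omega> c u)"
    by (simp add: pi_D_split_part[abs_def])
next
  fix c c' u vs assume c: "c \<in> \<A>" "c' \<in> \<A>" "u \<in> overlap c c'"
  let ?D = "chart_jacobian c c' u" and ?u = "transition c c' u"
  have "\<omega> c u = pull ?D (\<omega> c' ?u)"
    using diff_form_transition[OF w c] by (auto simp: pull_def)
  moreover have "?D (v - proj_D \<P> a c u v) = ?D v - proj_D \<P> a c' ?u (?D v)" for v
    by (simp add: linear_diff[OF linear_chart_jacobian[OF smooth_\<A> c]] proj_D_transition[OF c])
  ultimately show "pi_D \<P> a m n \<omega> c u vs = pi_D \<P> a m n \<omega> c' ?u (map ?D vs)"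
    using split_part_pull[of ?D "proj_D \<P> a c u" "proj_D \<P> a c' ?u" "\<lambda>v. v - proj_D \<P> a c u v"
        "\<lambda>v. v - proj_D \<P> a c' ?u v" m "\<omega> c' ?u" vs] proj_D_transition[OF c]
    by (simp add: pi_D_split_part)
next
  fix q \<theta> vs assume q: "q \<in> \<P>"
  let ?c = "tc_chart q \<theta>"
  have op: "open (fst ?c)" by (rule open_tc_chart[OF q])
  have P: "smooth_on (fst ?c) (\<lambda>z. proj_D \<P> a ?c z v)" for v by (rule smooth_proj_D[OF q])
  have Q: "smooth_on (fst ?c) (\<lambda>z. v - proj_D \<P> a ?c z v)" for v
    using smooth_on_add[OF op smooth_on_const smooth_on_scaleR[OF op smooth_on_const P], of v "-1" v] by simp
  have "smooth_on (fst ?c) (\<lambda>z. \<omega> ?c z (map (\<lambda>i. if i \<in> S then proj_D \<P> a ?c z (vs ! i) else vs ! i - proj_D \<P> a ?c z (vs ! i)) [0..<length vs]))" for S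
  proof (rule smooth_on_map_args[OF op])
    show "multilinear (\<omega> ?c z)" if "z \<in> fst ?c" for z
      by (rule alternating_multilinear[OF diff_form_alternating[OF w tc_chart_in[OF q] that]])
    show "smooth_on (fst ?c) (\<lambda>z. \<omega> ?c z vs)" for vs
      by (rule diff_form_smooth[OF w tc_chart_in[OF q]])
    show "smooth_on (fst ?c) (\<lambda>u. if i \<in> S then proj_D \<P> a ?c u (vs ! i) else vs ! i - proj_D \<P> a ?c u (vs ! i))" for i
      using P Q by (cases "i \<in> S") simp_all
  qed
  then show "smooth_on (fst ?c) (\<lambda>z. pi_D \<P> a m n \<omega> ?c z vs)"
    unfolding pi_D_def by (cases "length vs = m + n") (simp_all add: smooth_on_sum[OF op])
qed

section \<open>The stretch and the SU(4)-structure it produces\<close>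

definition stretch :: "real \<Rightarrow> (model, 'm) chart \<Rightarrow> model \<Rightarrow> model \<Rightarrow> model" where
  "stretch t c u v = v + (t - 1) *\<^sub>R proj_D \<P> a c u v"

lemma linear_stretch:
  assumes "c \<in> \<A>" "u \<in> fst c" shows "linear (stretch t c u)"
  unfolding stretch_def
  by (intro linear_compose_add linear_ident linear_compose_scale_right linear_proj_D assms)

lemma proj_D_idem:
  assumes c: "c \<in> \<A>" "u \<in> fst c" shows "proj_D \<P> a c u (proj_D \<P> a c u v) = proj_D \<P> a c u v"
proof -
  obtain q w where w: "coord q w (snd c u)" by (rule coord_exists)
  note ov = overlap_tc[OF c(2) w]
  have "chart_jacobian c (tc_chart q (snd w)) u (proj_D \<P> a c u (proj_D \<P> a c u v)) =
      chart_jacobian c (tc_chart q (snd w)) u (proj_D \<P> a c u v)"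
    unfolding proj_D_unique(1)[OF c w] by (simp add: hor_def)
  then show ?thesis using bij_chart_jacobian[OF smooth_\<A> c(1) ov(3,1)] by (metis bij_is_inj injD)
qed

lemma stretch_stretch:
  assumes c: "c \<in> \<A>" "u \<in> fst c" shows "stretch t c u (stretch t' c u v) = stretch (t * t') c u v"
proof -
  have "proj_D \<P> a c u (stretch t' c u v) = proj_D \<P> a c u v + (t' - 1) *\<^sub>R proj_D \<P> a c u v"
    unfolding stretch_def linear_add[OF linear_proj_D[OF c]] linear_scale[OF linear_proj_D[OF c]] proj_D_idem[OF c] ..
  then have "stretch t c u (stretch t' c u v) = v + (t' - 1) *\<^sub>R proj_D \<P> a c u v +
      (t - 1) *\<^sub>R (proj_D \<P> a c u v + (t' - 1) *\<^sub>R proj_D \<P> a c u v)"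
    by (simp add: stretch_def[of t] stretch_def[of t' c u v])
  then show ?thesis by (simp add: stretch_def algebra_simps)
qed

lemma bij_stretch:
  assumes "c \<in> \<A>" "u \<in> fst c" "t \<noteq> 0" shows "bij (stretch t c u)"
  by (rule o_bij[of "stretch (1 / t) c u"])
    (use assms(3) in \<open>auto simp: fun_eq_iff stretch_stretch[OF assms(1,2)]\<close>, simp_all add: stretch_def)

lemma stretch_transition:
  assumes c: "c \<in> \<A>" "c' \<in> \<A>" "u \<in> overlap c c'"
  shows "chart_jacobian c c' u (stretch t c u v) = stretch t c' (transition c c' u) (chart_jacobian c c' u v)"
  by (simp add: stretch_def linear_add[OF linear_chart_jacobian[OF smooth_\<A> c]]
      linear_scale[OF linear_chart_jacobian[OF smooth_\<A> c]] proj_D_transition[OF c])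

text \<open>The fibres are Lagrangian, and so are the horizontal spaces because a is symmetric. J
  therefore pairs horizontal with vertical components only, and exactly one of the two is
  stretched.\<close>

lemma J_stretch:
  assumes c: "c \<in> \<A>" "u \<in> fst c" shows "pull (stretch t c u) (J c u) = (\<lambda>vs. of_real t * J c u vs)"
proof
  fix vs
  show "pull (stretch t c u) (J c u) vs = of_real t * J c u vs"
  proof (cases "length vs = 2")
    case True
    then obtain v w where vs: "vs = [v, w]" by (auto simp: length_Suc_conv numeral_2_eq_2)
    obtain q x where x: "coord q x (snd c u)" by (rule coord_exists)
    note ov = overlap_tc[OF c(2) x]
    have q: "q \<in> \<P>" "fst x \<in> tc_dom q" using x by (simp_all add: coord_def)
    let ?D = "chart_jacobian c (tc_chart q (snd x)) u" and ?a = "a q (fst x)"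
    have lin: "linear ?D" by (rule linear_chart_jacobian[OF smooth_\<A> c(1) ov(3,1)])
    have J: "J c u [v, w] = std_symp [?D v, ?D w]" for v w
      using diff_form_transition[OF J_form c(1) ov(3,1), of "[v, w]"] J_in_coords[OF q]
      by (simp add: ov(2) in_coords_def)
    have D: "?D (stretch t c u v) = (t *\<^sub>R fst (?D v), snd (?D v) - (t - 1) *\<^sub>R (?a *v fst (?D v)))" for v
      unfolding stretch_def linear_add[OF lin] linear_scale[OF lin] proj_D_unique(1)[OF c x]
      by (simp add: hor_def prod_eq_iff algebra_simps)
    have sym: "(?a *v x) \<bullet> y = (?a *v y) \<bullet> x" for x y
      by (metis dot_lmul_matrix frame_props(1)[OF q] inner_commute transpose_matrix_vector)
    show ?thesis
      unfolding vs pull_def using sym[of "fst (?D v)" "fst (?D w)"]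
      by (simp add: J D std_symp_2 inner_diff_left algebra_simps)
  next
    case False
    then show ?thesis using J_degree[OF c] by (simp add: pull_def has_degree_def)
  qed
qed

lemma acs_determined_\<Omega>:
  assumes c: "c \<in> \<A>" "u \<in> fst c" shows "acs_determined 4 (\<Omega> c u)"
proof -
  obtain q x where x: "coord q x (snd c u)" by (rule coord_exists)
  note ov = overlap_tc[OF c(2) x]
  have q: "q \<in> \<P>" "fst x \<in> tc_dom q" using x by (simp_all add: coord_def)
  have "\<Omega> c u = pull (chart_jacobian c (tc_chart q (snd x)) u) (in_coords \<Omega> q x)"
    using diff_form_transition[OF \<Omega>_form c(1) ov(3,1)] by (auto simp: ov(2) in_coords_def pull_def)
  then show ?thesis
    using acs_pull(1)[OF linear_chart_jacobian[OF smooth_\<A> c(1) ov(3,1)] bij_chart_jacobian[OF smooth_\<A> c(1) ov(3,1)]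
        acs_determined_coords[OF q]] by simp
qed

definition stretched :: "('m \<Rightarrow> real) \<Rightarrow> (model, 'm) dform" where
  "stretched s c u vs = 1 / fcoef (snd c u) * \<Omega> c u (map (stretch (s (snd c u)) c u) vs)"

lemma SU_structure_stretched:
  assumes s: "smooth_fun \<A> s" "\<And>m. s m > 0"
  shows "SU_structure \<A> 4 (\<lambda>m. (cmod (1 / fcoef m))\<^sup>2 * s m ^ 4) J (stretched s)"
proof -
  have inv_f: "smooth_fun \<A> (\<lambda>m. inverse (fcoef m))"
  proof (rule smooth_funI_tc)
    fix q \<theta> assume q: "q \<in> \<P>"
    show "smooth_on (fst (tc_chart q \<theta>)) (\<lambda>z. inverse (fcoef (tc_map q z)))"
      using smooth_funD[OF smooth_fcoef tc_chart_in[OF q], of \<theta>] fcoef_nonzero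
      by (intro smooth_on_compose[OF open_tc_chart[OF q] _ smooth_on_inverse]) (auto simp: open_Compl)
  qed
  have K: "smooth_fun \<A> (\<lambda>m. (cmod (1 / fcoef m))\<^sup>2 * s m ^ 4)"
  proof (rule smooth_funI_tc)
    fix q \<theta> assume q: "q \<in> \<P>"
    note op = open_tc_chart[OF q, of \<theta>]
    have f: "smooth_on (fst (tc_chart q \<theta>)) (\<lambda>z. inverse (fcoef (tc_map q z)))"
      and s': "smooth_on (fst (tc_chart q \<theta>)) (\<lambda>z. s (tc_map q z))"
      using smooth_funD[OF inv_f tc_chart_in[OF q], of \<theta>] smooth_funD[OF s(1) tc_chart_in[OF q], of \<theta>] by simp_all
    \<comment> \<open>The squared modulus is rewritten as an inner product, which is smooth by
      bilinearity, whereas the norm itself is not covered by the rules for smooth functions.\<close>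
    have "(cmod (1 / fcoef m))\<^sup>2 * s m ^ 4 = (inverse (fcoef m) \<bullet> inverse (fcoef m)) * ((s m * s m) * (s m * s m))" for m
      by (simp add: power2_norm_eq_inner divide_inverse power4_eq_xxxx mult.assoc)
    then show "smooth_on (fst (tc_chart q \<theta>)) (\<lambda>z. (cmod (1 / fcoef (tc_map q z)))\<^sup>2 * s (tc_map q z) ^ 4)"
      by (simp only:) (intro smooth_on_mult[OF op] smooth_on_inner[OF op] f s')
  qed
  have form: "diff_form \<A> (stretched s)"
  proof (rule diff_formI_tc)
    fix c u assume c: "c \<in> \<A>" "u \<in> fst c"
    have "alternating (\<lambda>vs. 1 / fcoef (snd c u) * pull (stretch (s (snd c u)) c u) (\<Omega> c u) vs)"
      by (intro alternating_scale alternating_pull linear_stretch[OF c] diff_form_alternating[OF \<Omega>_form c])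
    then show "alternating (stretched s c u)" by (simp add: stretched_def[abs_def] pull_def)
  next
    fix c c' u vs assume c: "c \<in> \<A>" "c' \<in> \<A>" "u \<in> overlap c c'"
    show "stretched s c u vs = stretched s c' (transition c c' u) (map (chart_jacobian c c' u) vs)"
      by (simp add: stretched_def transition_in(2)[OF chart[OF c(2)] c(3)] diff_form_transition[OF \<Omega>_form c] o_def
          stretch_transition[OF c])
  next
    fix q \<theta> vs assume q: "q \<in> \<P>"
    note op = open_tc_chart[OF q, of \<theta>] and cA = tc_chart_in[OF q, of \<theta>]
    have "smooth_on (fst (tc_chart q \<theta>)) (\<lambda>z. s (tc_map q z))"
      using smooth_funD[OF s(1) cA] by simp
    then have st: "smooth_on (fst (tc_chart q \<theta>)) (\<lambda>z. stretch (s (tc_map q z)) (tc_chart q \<theta>) z v)" for v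
      unfolding stretch_def diff_conv_add_uminus
      by (intro smooth_on_add[OF op] smooth_on_const smooth_on_scaleR[OF op] smooth_proj_D[OF q])
    have m: "smooth_on (fst (tc_chart q \<theta>)) (\<lambda>z. \<Omega> (tc_chart q \<theta>) z (map (stretch (s (tc_map q z)) (tc_chart q \<theta>) z) vs))"
      by (rule smooth_on_map_args[OF op alternating_multilinear[OF diff_form_alternating[OF \<Omega>_form cA]]
            diff_form_smooth[OF \<Omega>_form cA] st])
    have "smooth_on (fst (tc_chart q \<theta>)) (\<lambda>z. inverse (fcoef (tc_map q z)))"
      using smooth_funD[OF inv_f cA] by simp
    from smooth_on_mult[OF op this m]
    have "smooth_on (fst (tc_chart q \<theta>)) (\<lambda>z. inverse (fcoef (tc_map q z)) *
        \<Omega> (tc_chart q \<theta>) z (map (stretch (s (tc_map q z)) (tc_chart q \<theta>) z) vs))" .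
    then show "smooth_on (fst (tc_chart q \<theta>)) (\<lambda>z. stretched s (tc_chart q \<theta>) z vs)"
      by (simp add: stretched_def divide_inverse)
  qed
  have deg: "has_degree 4 (stretched s c u)" if "c \<in> \<A>" "u \<in> fst c" for c u
    using \<Omega>_degree[OF that] by (simp add: has_degree_def stretched_def)
  have at: "SU_structure_at 4 ((cmod (1 / fcoef (snd c u)))\<^sup>2 * s (snd c u) ^ 4) (J c u) (stretched s c u)"
    if c: "c \<in> \<A>" "u \<in> fst c" for c u
    using SU_structure_at_rescale(1)[OF SU_at[OF c] acs_determined_\<Omega>[OF c] _ linear_stretch[OF c]
        bij_stretch[OF c] J_stretch[OF c] s(2), of "snd c u" "1 / fcoef (snd c u)"]
      s(2)[of "snd c u"] fcoef_nonzero by (simp add: stretched_def[abs_def])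
  have nz: "(cmod (1 / fcoef m))\<^sup>2 * s m ^ 4 \<noteq> 0" for m
    using s(2)[of m] fcoef_nonzero[of m] by simp
  have J: "DIM(model) = 2 * 4" "diff_form_deg \<A> 2 J" "everywhere \<A> (\<lambda>c u. real_form (J c u))"
    using SU4 unfolding SU_structure_def by blast+
  show ?thesis
    unfolding SU_structure_def
    by (intro conjI allI J K nz) (auto simp only: diff_form_deg_def everywhere_def intro!: form deg at)
qed

lemma diff_form_stretched:
  "smooth_fun \<A> s \<Longrightarrow> (\<And>m. s m > 0) \<Longrightarrow> diff_form \<A> (stretched s)"
  using SU_structure_stretched by (auto simp: SU_structure_def diff_form_deg_def)

end

section \<open>The supersymmetry equations on the base\<close>

lemma omit_0 [simp]: "omit 0 (v # vs) = vs"
  by (simp add: omit_def)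

lemma omit_Suc [simp]: "omit (Suc i) (v # vs) = v # omit i vs"
  by (simp add: omit_def)

text \<open>Brings a product with a one-form into the shape of \<open>alt_deriv\<close>, so that dh
  \<and> \<omega> can be recognised in the Leibniz rule.\<close>

lemma wedge_one_omit:
  assumes "is_one_form \<beta>"
  shows "wedge \<beta> \<omega> vs = (\<Sum>i<length vs. (-1) ^ i * (\<beta> [vs ! i] * \<omega> (omit i vs)))"
proof (induction vs arbitrary: \<omega>)
  case (Cons v vs)
  show ?case
    unfolding wedge_one_Cons[OF assms] Cons list.size(4) add_Suc_right add_0_right sum.lessThan_Suc_shift
    by (simp add: sum_negf)
qed (simp add: is_one_form_Nil[OF assms])

text \<open>Unless the inserted entry is the omitted one, it already occurs in the rest of the list.
  This picks one summand out of a sum over omitted positions.\<close>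

lemma alternating_insert_omit:
  assumes "alternating \<omega>" "k < length es" "l < length es"
  shows "\<omega> (es ! k # omit l es) = (if l = k then (-1) ^ k * \<omega> es else 0)"
proof (cases "l = k")
  case True
  have "es = take k es @ es ! k # drop (Suc k) es" using assms(2) by (rule id_take_nth_drop)
  then show ?thesis
    using alternating_move[OF assms(1), of "[]" "es ! k" "take k es" "drop (Suc k) es"] assms(2) True
    by (simp add: omit_def)
next
  case False
  have es: "es = take l es @ es ! l # drop (Suc l) es" using assms(3) by (rule id_take_nth_drop)
  have "es ! k \<in> set (omit l es)"
  proof (cases "k < l")
    case True
    then have "es ! k = take l es ! k" "k < length (take l es)" using assms(3) by simp_all
    then show ?thesis unfolding omit_def by (metis UnI1 nth_mem set_append)
  next
    case False
    then have "es ! k = drop (Suc l) es ! (k - Suc l)" "k - Suc l < length (drop (Suc l) es)"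
      using \<open>l \<noteq> k\<close> assms(2) by auto
    then show ?thesis unfolding omit_def by (metis UnI2 nth_mem set_append)
  qed
  then obtain p s where "omit l es = p @ es ! k # s" by (metis split_list)
  then show ?thesis using False alternating_repeat[OF assms(1), of "[]" "es ! k" p s] by simp
qed

lemma length_axes4: "length axes4 = 4"
  by (simp add: axes4_def)

lemma alt_deriv_scale:
  fixes h :: "'e::real_normed_vector \<Rightarrow> complex"
  assumes "h differentiable at u" "\<And>vs. (\<lambda>z. \<omega> z vs) differentiable at u"
  shows "alt_deriv (\<lambda>z vs. h z * \<omega> z vs) u vs = h u * alt_deriv \<omega> u vs +
    (\<Sum>i<length vs. (-1) ^ i * (frechet_derivative h (at u) (vs ! i) * \<omega> u (omit i vs)))"
proof -
  have "frechet_derivative (\<lambda>z. h z * \<omega> z xs) (at u) =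
      (\<lambda>v. h u * frechet_derivative (\<lambda>z. \<omega> z xs) (at u) v + frechet_derivative h (at u) v * \<omega> u xs)" for xs
    using assms
    by (intro frechet_derivative_at[symmetric] has_derivative_mult) (simp_all add: frechet_derivative_works[symmetric])
  then show ?thesis
    by (simp add: alt_deriv_def distrib_left sum.distrib sum_distrib_left mult.left_commute)
qed

lemma fst_has_derivative:
  fixes k :: "'a::real_normed_vector \<Rightarrow> 'c::real_normed_vector" and u :: "'a \<times> 'b::real_normed_vector"
  assumes "k differentiable at (fst u)"
  shows "((\<lambda>z. k (fst z)) has_derivative (\<lambda>h. frechet_derivative k (at (fst u)) (fst h))) (at u)"
  by (rule has_derivative_compose[OF has_derivative_fst[OF has_derivative_ident]])
    (use assms in \<open>simp add: frechet_derivative_works\<close>)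

text \<open>The exterior derivative of a fibre-invariant form: only the base component of the
  differentiating vector counts.\<close>

definition base_deriv :: "(real^4 \<Rightarrow> model form) \<Rightarrow> real^4 \<Rightarrow> model form" where
  "base_deriv \<omega> r vs = (\<Sum>i<length vs. (-1) ^ i * frechet_derivative (\<lambda>r. \<omega> r (omit i vs)) (at r) (fst (vs ! i)))"

lemma alt_deriv_base:
  assumes "\<And>vs. (\<lambda>r. \<omega> r vs) differentiable at (fst u)"
  shows "alt_deriv (\<lambda>z. \<omega> (fst z)) u vs = base_deriv \<omega> (fst u) vs"
  unfolding alt_deriv_def base_deriv_def
  by (simp add: frechet_derivative_at[OF fst_has_derivative[OF assms], symmetric])

lemma std_symp_degree: "length vs \<noteq> 2 \<Longrightarrow> std_symp vs = 0"
proof -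
  assume l: "length vs \<noteq> 2"
  have o: "is_one_form (d_theta j)" "is_one_form (d_r j)" for j
    by (auto simp: d_theta_def d_r_def is_one_form_def has_degree_def one_form_def complex_eq_iff intro!: linearI)
  have "wedge (d_theta j) (d_r j) vs = 0" for j
    unfolding wedge_one_omit[OF o(1)]
    by (rule sum.neutral) (use l o(2) in \<open>auto simp: is_one_form_def has_degree_def length_omit\<close>)
  then show ?thesis by (simp add: std_symp_def)
qed

context semiflat_bundle
begin

definition bform :: "('b, 'm) torus_coords \<Rightarrow> real^4 \<Rightarrow> model form" where
  "bform q r = in_coords \<Omega> q (r, 0)"

lemma in_coords_bform: "q \<in> \<P> \<Longrightarrow> fst u \<in> tc_dom q \<Longrightarrow> in_coords \<Omega> q u = bform q (fst u)"
  unfolding bform_def by (rule \<Omega>_invariant) simp_all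

lemma \<Omega>_bform:
  assumes "q \<in> \<P>" "u \<in> fst (tc_chart q \<theta>)" shows "\<Omega> (tc_chart q \<theta>) u = bform q (fst u)"
  using form_in_coords[OF \<Omega>_form assms] in_coords_bform[OF assms(1)] assms(2) by (simp add: fst_tc_chart)

lemma I_at_base: "q \<in> \<P> \<Longrightarrow> fst u \<in> tc_dom q \<Longrightarrow> I_at q u = acs 4 (bform q (fst u))"
  by (simp add: I_at_def in_coords_bform)

lemma alternating_bform: "q \<in> \<P> \<Longrightarrow> r \<in> tc_dom q \<Longrightarrow> alternating (bform q r)"
  unfolding bform_def by (rule in_coords_alternating[OF \<Omega>_form]) simp_all

lemma smooth_bform: assumes "q \<in> \<P>" shows "smooth_on (tc_dom q) (\<lambda>r. bform q r vs)"
proof -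
  have "bounded_linear (\<lambda>r::real^4. (r, 0::real^4))"
    unfolding linear_conv_bounded_linear[symmetric] by (rule linearI) simp_all
  then have "smooth_on (tc_dom q) (\<lambda>r. \<Omega> (tc_chart q 0) (r, 0) vs)"
    by (intro smooth_on_compose[OF open_tc_dom[OF assms] open_tc_chart[OF assms, of 0] diff_form_smooth[OF \<Omega>_form tc_chart_in[OF assms]]]
        smooth_on_bounded_linear) (auto simp: fst_tc_chart)
  then show ?thesis by (simp add: bform_def in_coords_def)
qed

lemma bform_differentiable: "q \<in> \<P> \<Longrightarrow> r \<in> tc_dom q \<Longrightarrow> (\<lambda>r. bform q r vs) differentiable at r"
  by (rule smooth_on_differentiable[OF smooth_bform])

text \<open>J is of type (1,1); in coordinates this follows from the symmetry of a and
  \<rho>.\<close>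

lemma I_at_symplectic:
  assumes q: "q \<in> \<P>" "fst u \<in> tc_dom q"
  shows "pull (I_at q u) std_symp = std_symp"
proof
  fix vs
  show "pull (I_at q u) std_symp vs = std_symp vs"
  proof (cases "length vs = 2")
    case True
    then obtain v w where vs: "vs = [v, w]" by (auto simp: length_Suc_conv numeral_2_eq_2)
    let ?a = "a q (fst u)" and ?\<rho> = "\<rho> q (fst u)" and ?I = "I_at q u"
    have syma: "(?a *v x) \<bullet> y = (?a *v y) \<bullet> x" and sym\<rho>: "(?\<rho> *v x) \<bullet> y = (?\<rho> *v y) \<bullet> x" for x y
      by (metis dot_lmul_matrix frame_props(1,2)[OF q] inner_commute transpose_matrix_vector)+
    have s: "snd (?I v) = - (?\<rho> *v fst v) - ?a *v fst (?I v)" for v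
      using I_at_formula(2)[OF q, of v] by (simp add: algebra_simps)
    have r: "?\<rho> *v fst (?I v) = snd v + ?a *v fst v" for v by (rule I_at_formula(1)[OF q])
    have "snd (?I v) \<bullet> fst (?I w) - snd (?I w) \<bullet> fst (?I v) =
        (?\<rho> *v fst (?I v)) \<bullet> fst w - (?\<rho> *v fst (?I w)) \<bullet> fst v"
      unfolding s inner_diff_left inner_minus_left
      using syma[of "fst (?I v)" "fst (?I w)"] sym\<rho>[of "fst v" "fst (?I w)"] sym\<rho>[of "fst w" "fst (?I v)"] by simp
    also have "\<dots> = snd v \<bullet> fst w - snd w \<bullet> fst v"
      unfolding r inner_add_left using syma[of "fst v" "fst w"] by simp
    finally show ?thesis by (simp add: vs pull_def std_symp_2)
  qed (simp add: std_symp_degree pull_def)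
qed

end

locale susy_bundle = semiflat_bundle \<A> \<B> prj \<P> J \<Omega> a \<rho>
  for \<A> :: "(model, 'm::{t2_space, second_countable_topology}) chart set"
    and \<B> :: "(real^4, 'b::{t2_space, second_countable_topology}) chart set"
    and prj \<P> J \<Omega> a \<rho> +
  fixes A :: "'m \<Rightarrow> real" and W2 :: "(model, 'm) dform"
  assumes smooth_A: "smooth_fun \<A> A"
    and W2_type: "c \<in> \<A> \<Longrightarrow> u \<in> fst c \<Longrightarrow> pq_type (acs 4 (\<Omega> c u)) 2 1 (W2 c u)"
    and d\<Omega>: "c \<in> \<A> \<Longrightarrow> u \<in> fst c \<Longrightarrow> ext_d \<Omega> c u vs =
        wedge (W2 c u) (J c u) vs + wedge (conj_form (del \<Omega> A c u)) (\<Omega> c u) vs"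
begin

section \<open>The differential of A and its two types\<close>

definition dA :: "('b, 'm) torus_coords \<Rightarrow> model \<Rightarrow> model \<Rightarrow> real" where
  "dA q u = frechet_derivative (\<lambda>z. A (tc_map q z)) (at u)"

lemma A_has_derivative:
  assumes q: "q \<in> \<P>" "fst u \<in> tc_dom q"
  shows "((\<lambda>z. A (tc_map q z)) has_derivative dA q u) (at u)"
  using smooth_on_has_derivative[OF smooth_funD[OF smooth_A tc_chart_in[OF q(1)]] tc_chart_self[OF q(2)]]
  by (simp add: dA_def)

lemma linear_dA: "q \<in> \<P> \<Longrightarrow> fst u \<in> tc_dom q \<Longrightarrow> linear (dA q u)"
  by (rule has_derivative_linear[OF A_has_derivative])

text \<open>By the supersymmetry system, the fifth torsion class is \<open>\<partial>A\<close>.\<close>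

definition W5 :: "('b, 'm) torus_coords \<Rightarrow> model \<Rightarrow> model form" where
  "W5 q u = one_form (\<lambda>v. (of_real (dA q u v) - \<i> * of_real (dA q u (I_at q u v))) / 2)"

definition W5bar :: "('b, 'm) torus_coords \<Rightarrow> model \<Rightarrow> model form" where
  "W5bar q u = one_form (\<lambda>v. (of_real (dA q u v) + \<i> * of_real (dA q u (I_at q u v))) / 2)"

context
  fixes q and u :: model assumes q: "q \<in> \<P>" "fst u \<in> tc_dom q"
begin

private lemma c: "tc_chart q (snd u) \<in> \<A>" "u \<in> fst (tc_chart q (snd u))"
  using tc_chart_in[OF q(1)] tc_chart_self[OF q(2)] .

private lemma \<Omega>_c: "\<Omega> (tc_chart q (snd u)) u = bform q (fst u)"
  by (rule \<Omega>_bform[OF q(1) c(2)])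

lemma conj_del: "conj_form (del \<Omega> A (tc_chart q (snd u)) u) = W5bar q u"
proof -
  let ?c = "tc_chart q (snd u)"
  have "((\<lambda>z. of_real (A (tc_map q z)) :: complex) has_derivative (\<lambda>v. of_real (dA q u v))) (at u)"
    by (intro has_derivative_of_real A_has_derivative q)
  then have "ext_d (fun_dform (\<lambda>m. complex_of_real (A m))) ?c u [v] = of_real (dA q u v)" for v
    by (simp add: ext_d_def fun_dform_def unit_form_def frechet_derivative_at[symmetric])
  then show ?thesis
    by (auto simp: fun_eq_iff conj_form_def del_def part10_def W5bar_def one_form_def \<Omega>_c I_at_base[OF q])
qed

lemma is_one_form_W5: "is_one_form (W5 q u)" "is_one_form (W5bar q u)"
proof -
  have "linear (\<lambda>v. (of_real (dA q u v) + k * of_real (dA q u (I_at q u v))) / 2 :: complex)" for k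
    by (rule linearI) (simp_all add: linear_add[OF linear_dA[OF q]] linear_add[OF I_at_props(1)[OF q]]
        linear_scale[OF linear_dA[OF q]] linear_scale[OF I_at_props(1)[OF q]] complex_eq_iff algebra_simps add_divide_distrib)
  from this[of "- \<i>"] this[of \<i>] show "is_one_form (W5 q u)" "is_one_form (W5bar q u)"
    by (simp_all add: is_one_form_def has_degree_def W5_def W5bar_def one_form_def)
qed

lemma W5_I: "pull (I_at q u) (W5 q u) = (\<lambda>vs. \<i> * W5 q u vs)"
  "pull (I_at q u) (W5bar q u) = (\<lambda>vs. - \<i> * W5bar q u vs)"
proof -
  have "pull (I_at q u) (W5 q u) vs = \<i> * W5 q u vs" "pull (I_at q u) (W5bar q u) vs = - \<i> * W5bar q u vs" for vs
  proof -
    have "pull (I_at q u) (W5 q u) vs = \<i> * W5 q u vs \<and> pull (I_at q u) (W5bar q u) vs = - \<i> * W5bar q u vs"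
    proof (cases "length vs = 1")
      case True
      then obtain v where "vs = [v]" by (cases vs) auto
      then show ?thesis
        by (simp add: pull_def W5_def W5bar_def one_form_def I_at_props(2)[OF q] linear_neg[OF linear_dA[OF q]] complex_eq_iff)
    qed (simp add: pull_def W5_def W5bar_def one_form_def)
    then show "pull (I_at q u) (W5 q u) vs = \<i> * W5 q u vs" "pull (I_at q u) (W5bar q u) vs = - \<i> * W5bar q u vs"
      by blast+
  qed
  then show "pull (I_at q u) (W5 q u) = (\<lambda>vs. \<i> * W5 q u vs)"
    "pull (I_at q u) (W5bar q u) = (\<lambda>vs. - \<i> * W5bar q u vs)"
    by auto
qed

lemma W5_sum: "W5 q u [v] + W5bar q u [v] = of_real (dA q u v)"
  by (simp add: W5_def W5bar_def one_form_def field_simps)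

lemma d\<Omega>_base: "base_deriv (bform q) (fst u) vs =
    wedge (W2 (tc_chart q (snd u)) u) std_symp vs + wedge (W5bar q u) (bform q (fst u)) vs"
proof -
  let ?c = "tc_chart q (snd u)"
  have "ext_d \<Omega> ?c u vs = alt_deriv (\<lambda>z. bform q (fst z)) u vs"
    unfolding ext_d_alt_deriv
    by (rule alt_deriv_cong[OF open_tc_chart[OF q(1), of "snd u"] c(2)])
      (simp_all add: \<Omega>_bform[OF q(1)] diff_form_differentiable[OF \<Omega>_form c])
  also have "\<dots> = base_deriv (bform q) (fst u) vs"
    by (rule alt_deriv_base[OF bform_differentiable[OF q]])
  finally show ?thesis
    using d\<Omega>[OF c, of vs] conj_del J_in_coords[OF q] by (simp add: \<Omega>_c in_coords_def)
qed

text \<open>I acts on \<open>W2\<close>, of type (2,1), by \<i>, on J and on \<Omega> trivially, on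
  the conjugate of \<partial>A by -\<i> and on \<partial>A by \<i>.\<close>

lemma type_rules:
  "wedge (W2 (tc_chart q (snd u)) u) std_symp (map (I_at q u) vs) = \<i> * wedge (W2 (tc_chart q (snd u)) u) std_symp vs"
  "wedge (W5bar q u) (bform q (fst u)) (map (I_at q u) vs) = - \<i> * wedge (W5bar q u) (bform q (fst u)) vs"
  "wedge (W5 q u) (bform q (fst u)) (map (I_at q u) vs) = \<i> * wedge (W5 q u) (bform q (fst u)) vs"
proof -
  have W2: "pull (I_at q u) (W2 (tc_chart q (snd u)) u) = (\<lambda>vs. \<i> * W2 (tc_chart q (snd u)) u vs)"
    using pq_type_scaled[OF W2_type[OF c]] by (simp add: fun_eq_iff pull_def \<Omega>_c I_at_base[OF q] power2_eq_square)
  have O: "pull (I_at q u) (bform q (fst u)) = bform q (fst u)"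
    using pq_type_scaled[OF acs_props(2)[OF acs_determined_coords[OF q]]]
    by (simp add: fun_eq_iff pull_def I_at_base[OF q] in_coords_bform[OF q])
  show "wedge (W2 (tc_chart q (snd u)) u) std_symp (map (I_at q u) vs) = \<i> * wedge (W2 (tc_chart q (snd u)) u) std_symp vs"
    unfolding wedge_pull[symmetric] W2 I_at_symplectic[OF q] by (rule wedge_scale_left)
  show "wedge (W5bar q u) (bform q (fst u)) (map (I_at q u) vs) = - \<i> * wedge (W5bar q u) (bform q (fst u)) vs"
    unfolding wedge_pull[symmetric] W5_I O by (rule wedge_scale_left)
  show "wedge (W5 q u) (bform q (fst u)) (map (I_at q u) vs) = \<i> * wedge (W5 q u) (bform q (fst u)) vs"
    unfolding wedge_pull[symmetric] W5_I O by (rule wedge_scale_left)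
qed

text \<open>The two types in \<open>d\<Omega>\<close> are separated by the almost complex structure acting on all arguments.\<close>

lemma W5bar_wedge: "2 * wedge (W5bar q u) (bform q (fst u)) vs =
    base_deriv (bform q) (fst u) vs + \<i> * base_deriv (bform q) (fst u) (map (I_at q u) vs)"
  unfolding d\<Omega>_base type_rules by (simp add: algebra_simps)

text \<open>Wedging with \<Omega> is injective on (0,1)-forms: the value at I e and the four
  vertical axes returns the component along the axis e. Half of the factor comes from the one-form
  at I e, which gives -\<i>, the other half from \<Omega> with I e in one slot, which gives \<i>
  with a minus sign in front.\<close>

lemma W5bar_vert:
  assumes "k < 4"
  shows "wedge (W5bar q u) (bform q (fst u)) (I_at q u (vert (axes4 ! k)) # map vert axes4) =
    - 2 * \<i> * (W5bar q u [vert (axes4 ! k)] * bform q (fst u) (map vert axes4))"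
proof -
  define es where "es = map vert axes4"
  let ?\<omega> = "bform q (fst u)" and ?es = es and ?I = "I_at q u" and ?b = "W5bar q u"
  have len: "length ?es = 4" by (simp add: es_def axes4_def)
  have sl: "?\<omega> (?I v # vs) = \<i> * ?\<omega> (v # vs)" for v vs
    using I_at_props(3)[OF q] unfolding slotwise_def in_coords_bform[OF q] by (metis append_Nil)
  have nth: "vert (axes4 ! k) = ?es ! k" using assms len by (simp add: es_def)
  have "wedge ?b (\<lambda>ws. ?\<omega> (?I (vert (axes4 ! k)) # ws)) ?es =
      (\<Sum>i<4. (-1) ^ i * (?b [?es ! i] * (\<i> * ?\<omega> (?es ! k # omit i ?es))))"
    unfolding wedge_one_omit[OF is_one_form_W5(2)] sl len nth ..
  also have "\<dots> = (\<Sum>i<4. if i = k then (-1) ^ k * (?b [?es ! k] * (\<i> * ((-1) ^ k * ?\<omega> ?es))) else 0)"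
    using assms len by (intro sum.cong) (auto simp: alternating_insert_omit[OF alternating_bform[OF q]])
  also have "\<dots> = \<i> * (?b [?es ! k] * ?\<omega> ?es)"
    using assms by (simp add: mult.left_commute[of "(-1) ^ k"] power_mult_distrib[symmetric] mult.assoc[symmetric])
  finally have 1: "wedge ?b (\<lambda>ws. ?\<omega> (?I (vert (axes4 ! k)) # ws)) ?es = \<i> * (?b [?es ! k] * ?\<omega> ?es)" .
  have "?b [?I v] = - \<i> * ?b [v]" for v
    using fun_cong[OF W5_I(2), of "[v]"] by (simp add: pull_def)
  then show ?thesis
    unfolding es_def[symmetric] wedge_one_Cons[OF is_one_form_W5(2)] 1[unfolded nth] nth by (simp add: algebra_simps)
qed

end

text \<open>The right-hand side of \<open>W5bar_wedge\<close> depends on \<Omega> near the base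
  point only, so it is the same along the fibre; \<open>W5bar_vert\<close> recovers
  \<open>W5bar\<close> from it, and dA is twice the real part of \<open>W5bar\<close>.\<close>

lemma dA_vert_invariant:
  assumes q: "q \<in> \<P>" "fst u \<in> tc_dom q" "fst u' = fst u" and k: "k < 4"
  shows "dA q u (vert (axes4 ! k)) = dA q u' (vert (axes4 ! k))"
proof -
  have q': "fst u' \<in> tc_dom q" using q by simp
  have f: "bform q (fst u) (map vert axes4) \<noteq> 0"
    using f_at_nonzero[OF q(1,2)] by (simp add: f_at_def in_coords_bform[OF q(1,2)])
  have I: "I_at q u' = I_at q u" using q q' by (simp add: I_at_base)
  have "2 * wedge (W5bar q u) (bform q (fst u)) vs = 2 * wedge (W5bar q u') (bform q (fst u)) vs" for vs
    using W5bar_wedge[OF q(1,2), of vs] W5bar_wedge[OF q(1) q', of vs] by (simp add: I q(3))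
  then have "W5bar q u [vert (axes4 ! k)] = W5bar q u' [vert (axes4 ! k)]"
    using W5bar_vert[OF q(1,2) k] W5bar_vert[OF q(1) q' k] f by (simp add: I q(3))
  then show ?thesis by (simp add: W5bar_def one_form_def complex_eq_iff)
qed

lemma tc_map_periodic:
  assumes "q \<in> \<P>" "r \<in> tc_dom q" shows "tc_map q (r, \<theta> + (2 * pi) *\<^sub>R axis j 1) = tc_map q (r, \<theta>)"
proof -
  have "\<forall>\<theta> \<theta>'. tc_map q (r, \<theta>) = tc_map q (r, \<theta>') \<longleftrightarrow> (\<forall>i. \<exists>k::int. (\<theta> - \<theta>') $ i = 2 * pi * real_of_int k)"
    using torus_coords[OF assms(1)] assms(2) unfolding is_torus_coords_def by blast
  moreover have "\<exists>k::int. (\<theta> + (2 * pi) *\<^sub>R axis j 1 - \<theta>) $ i = 2 * pi * real_of_int k" for i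
    by (rule exI[of _ "if i = j then 1 else 0"]) (simp add: axis_def)
  ultimately show ?thesis by blast
qed

text \<open>A function on a torus whose gradient is constant in angle coordinates is constant.\<close>

lemma A_fibre_invariant:
  assumes q: "q \<in> \<P>" "r \<in> tc_dom q"
  shows "A (tc_map q (r, \<theta>)) = A (tc_map q (r, \<theta>'))"
proof -
  let ?\<alpha> = "\<lambda>\<theta>. A (tc_map q (r, \<theta>))"
  have der: "(?\<alpha> has_derivative (\<lambda>y. dA q (r, \<theta>) (vert y))) (at \<theta>)" for \<theta>
  proof -
    have "((\<lambda>\<theta>. (r, \<theta>)) has_derivative (\<lambda>y. vert y)) (at \<theta>)"
      by (auto intro!: derivative_eq_intros)
    from has_derivative_compose[OF this A_has_derivative[OF q(1)]] show ?thesis using q(2) by simp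
  qed
  have zero: "dA q (r, \<theta>) (vert (axes4 ! k)) = 0" if k: "k < 4" for k \<theta>
  proof -
    let ?e = "axes4 ! k"
    obtain j where j: "?e = axis j 1"
      using k by (auto simp: axes4_def less_Suc_eq numeral_eq_Suc)
    let ?d = "dA q (r, \<theta>) (vert ?e)"
    have "((\<lambda>t. ?\<alpha> (\<theta> + t *\<^sub>R ?e)) has_real_derivative ?d) (at t)" for t
    proof -
      have "((\<lambda>t. \<theta> + t *\<^sub>R ?e) has_derivative (\<lambda>s. s *\<^sub>R ?e)) (at t)"
        by (auto intro!: derivative_eq_intros)
      from has_derivative_compose[OF this der]
      have "((\<lambda>t. ?\<alpha> (\<theta> + t *\<^sub>R ?e)) has_derivative (\<lambda>s. dA q (r, \<theta> + t *\<^sub>R ?e) (vert (s *\<^sub>R ?e)))) (at t)" .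
      moreover have "dA q (r, \<theta> + t *\<^sub>R ?e) (vert (s *\<^sub>R ?e)) = ?d * s" for s
      proof -
        have "vert (s *\<^sub>R ?e) = s *\<^sub>R vert ?e" by simp
        then have "dA q (r, \<theta> + t *\<^sub>R ?e) (vert (s *\<^sub>R ?e)) = s *\<^sub>R dA q (r, \<theta> + t *\<^sub>R ?e) (vert ?e)"
          using linear_scale[OF linear_dA[OF q(1)], of "(r, \<theta> + t *\<^sub>R ?e)" s "vert ?e"] q(2) by simp
        also have "dA q (r, \<theta> + t *\<^sub>R ?e) (vert ?e) = ?d"
          by (rule dA_vert_invariant[OF q(1) _ _ k]) (simp_all add: q(2))
        finally show ?thesis by (simp add: mult.commute)
      qed
      ultimately show ?thesis by (simp add: has_field_derivative_def)
    qed
    \<comment> \<open>The slope is constant along the circle, so the increment over one period is 2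
      pi times the slope; periodicity makes it zero.\<close>
    then have "\<exists>z>0. z < 2 * pi \<and> ?\<alpha> (\<theta> + (2 * pi) *\<^sub>R ?e) - ?\<alpha> (\<theta> + 0 *\<^sub>R ?e) = (2 * pi - 0) * ?d"
      by (intro MVT2) auto
    then show ?thesis using tc_map_periodic[OF q, of \<theta> j] by (auto simp: j)
  qed
  have "dA q (r, \<theta>) (vert y) = 0" for \<theta> y
  proof -
    have lin: "linear (\<lambda>y. dA q (r, \<theta>) (vert y))" using der by (rule has_derivative_linear)
    have "dA q (r, \<theta>) (vert b) = 0" if "b \<in> Basis" for b
    proof -
      have "b \<in> set axes4" using that by (simp only: set_axes4)
      then obtain k where k: "k < length axes4" "axes4 ! k = b" unfolding in_set_conv_nth by blast
      then show ?thesis using zero[of k] by (simp add: length_axes4)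
    qed
    then show ?thesis using linear_eq_0_on_span[OF lin, of Basis y] by simp
  qed
  then have "(?\<alpha> has_derivative (\<lambda>y. 0)) (at \<theta>)" for \<theta> using der[of \<theta>] by simp
  then obtain c where "\<And>\<theta>. ?\<alpha> \<theta> = c"
    using has_derivative_zero_constant[of UNIV ?\<alpha>] by auto
  then show ?thesis by simp
qed

section \<open>The weighted form on the base\<close>

definition wform :: "('b, 'm) torus_coords \<Rightarrow> real^4 \<Rightarrow> model form" where
  "wform q r vs = of_real (exp (- A (tc_map q (r, 0)))) * bform q r vs"

lemma warp_smooth: assumes "q \<in> \<P>" shows "smooth_on (tc_dom q) (\<lambda>r. complex_of_real (exp (- A (tc_map q (r, 0)))))"
proof -
  have "bounded_linear (\<lambda>r::real^4. (r, 0::real^4))"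
    unfolding linear_conv_bounded_linear[symmetric] by (rule linearI) simp_all
  note bl = this bounded_linear_minus[OF bounded_linear_ident] bounded_linear_of_real
  note op = open_tc_dom[OF assms]
  have "smooth_on (tc_dom q) (\<lambda>r. A (tc_map q (r, 0)))"
    using smooth_funD[OF smooth_A tc_chart_in[OF assms], of 0]
    by (intro smooth_on_compose[OF op open_tc_chart[OF assms, of 0] _ smooth_on_bounded_linear[OF bl(1)]]) (auto simp: fst_tc_chart)
  then have "smooth_on (tc_dom q) (\<lambda>r. - A (tc_map q (r, 0)))"
    by (rule smooth_on_compose_linear[OF op bl(2)])
  then have "smooth_on (tc_dom q) (\<lambda>r. exp (- A (tc_map q (r, 0))))"
    by (rule smooth_on_compose[OF op open_UNIV smooth_on_exp]) simp
  then show ?thesis by (rule smooth_on_compose_linear[OF op bl(3)])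
qed

lemma smooth_wform: assumes "q \<in> \<P>" shows "smooth_on (tc_dom q) (\<lambda>r. wform q r vs)"
  unfolding wform_def by (intro smooth_on_mult open_tc_dom warp_smooth smooth_bform assms)

lemma alternating_wform: "q \<in> \<P> \<Longrightarrow> r \<in> tc_dom q \<Longrightarrow> alternating (wform q r)"
  unfolding wform_def[abs_def] by (intro alternating_scale alternating_bform)

text \<open>The part of d\<Omega> on which I acts by -\<i> is \<open>W5bar\<close> \<and> \<Omega>.
  Differentiating the weight contributes - (\<open>W5\<close> + \<open>W5bar\<close>) \<and>
  \<Omega>, which removes it; this fixes the exponent -A.\<close>

lemma wform_type:
  assumes q: "q \<in> \<P>" "r \<in> tc_dom q"
  shows "base_deriv (wform q) r (map (I_at q (r, 0)) vs) = \<i> * base_deriv (wform q) r vs"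
proof -
  let ?u = "(r, 0) :: model" and ?g = "\<lambda>z. complex_of_real (exp (- A (tc_map q z)))"
  have qu: "fst ?u \<in> tc_dom q" using q by simp
  have "((\<lambda>z. exp (- A (tc_map q z))) has_derivative (\<lambda>v. exp (- A (tc_map q ?u)) * - dA q ?u v)) (at ?u)"
    by (rule has_derivative_exp[OF has_derivative_minus[OF A_has_derivative[OF q(1) qu]], THEN has_derivative_eq_rhs]) (simp add: fun_eq_iff)
  from has_derivative_of_real[OF this]
  have g: "(?g has_derivative (\<lambda>v. - (?g ?u * of_real (dA q ?u v)))) (at ?u)" by simp
  have gd: "frechet_derivative ?g (at ?u) v = - (?g ?u * of_real (dA q ?u v))" for v
    using frechet_derivative_at[OF g] by metis
  have dif: "(\<lambda>z. bform q (fst z) vs) differentiable at ?u" for vs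
    using fst_has_derivative[where u = ?u, OF bform_differentiable[OF q(1) qu]] unfolding differentiable_def by blast
  have U: "open (tc_dom q \<times> (UNIV :: (real^4) set))" "?u \<in> tc_dom q \<times> UNIV"
    using open_tc_dom[OF q(1)] q(2) by (auto intro: open_Times)
  have gdif: "?g differentiable at ?u" using g by (auto simp: differentiable_def)
  have V: "base_deriv (wform q) r vs = ?g ?u * (wedge (W2 (tc_chart q 0) ?u) std_symp vs - wedge (W5 q ?u) (bform q r) vs)" for vs
  proof -
    have "base_deriv (wform q) r vs = alt_deriv (\<lambda>z. wform q (fst z)) ?u vs"
      using alt_deriv_base[of "wform q" ?u vs] smooth_on_differentiable[OF smooth_wform[OF q(1)] q(2)] by simp
    \<comment> \<open>Here the constancy of A on the fibres enters: the weight at angle 0 is the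
      weight at every angle, so its differential is the full dA, which splits into the two
      types.\<close>
    also have "\<dots> = alt_deriv (\<lambda>z vs. ?g z * bform q (fst z) vs) ?u vs"
    proof (rule alt_deriv_cong[OF U, symmetric])
      show "?g z * bform q (fst z) vs = wform q (fst z) vs" if "z \<in> tc_dom q \<times> UNIV" for z vs
        using A_fibre_invariant[OF q(1), of "fst z" "snd z" 0] that by (auto simp: wform_def mem_Times_iff)
      show "(\<lambda>z. ?g z * bform q (fst z) vs) differentiable at ?u" for vs
        by (intro differentiable_mult gdif dif)
    qed
    also have "\<dots> = ?g ?u * alt_deriv (\<lambda>z. bform q (fst z)) ?u vs +
        (\<Sum>i<length vs. (-1) ^ i * (frechet_derivative ?g (at ?u) (vs ! i) * bform q (fst ?u) (omit i vs)))"
      by (rule alt_deriv_scale[OF gdif dif])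
    also have "alt_deriv (\<lambda>z. bform q (fst z)) ?u vs = base_deriv (bform q) (fst ?u) vs"
      by (rule alt_deriv_base[OF bform_differentiable[OF q(1) qu]])
    also have "(\<Sum>i<length vs. (-1) ^ i * (frechet_derivative ?g (at ?u) (vs ! i) * bform q (fst ?u) (omit i vs))) =
        - ?g ?u * (wedge (W5 q ?u) (bform q r) vs + wedge (W5bar q ?u) (bform q r) vs)"
      unfolding gd wedge_one_omit[OF is_one_form_W5(1)[OF q(1) qu]] wedge_one_omit[OF is_one_form_W5(2)[OF q(1) qu]]
        W5_sum[OF q(1) qu, symmetric]
      by (simp add: sum_distrib_left sum.distrib[symmetric] sum_negf[symmetric] algebra_simps)
    finally show ?thesis
      unfolding d\<Omega>_base[OF q(1) qu] by (simp add: algebra_simps)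
  qed
  show ?thesis
    unfolding V using type_rules(1,3)[OF q(1) qu, of vs] by (simp add: algebra_simps)
qed

end

section \<open>Removing the flat connection\<close>

lemma multilinear_scale_map:
  assumes "multilinear \<omega>"
  shows "\<omega> (pre @ map (\<lambda>v. t *\<^sub>R v) xs @ ws) = of_real t ^ length xs * \<omega> (pre @ xs @ ws)"
proof (induction xs arbitrary: pre)
  case (Cons x xs)
  have "\<omega> (pre @ map (\<lambda>v. t *\<^sub>R v) (x # xs) @ ws) = of_real t * \<omega> ((pre @ [x]) @ map (\<lambda>v. t *\<^sub>R v) xs @ ws)"
    using multilinear_scale[OF assms, of pre t x] by simp
  then show ?case unfolding Cons by simp
qed simp

lemma slotwise_map:
  assumes "slotwise I k \<omega>"
  shows "\<omega> (pre @ map I xs @ ws) = k ^ length xs * \<omega> (pre @ xs @ ws)"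
proof (induction xs arbitrary: pre)
  case (Cons x xs)
  have "\<omega> (pre @ map I (x # xs) @ ws) = k * \<omega> ((pre @ [x]) @ map I xs @ ws)"
    using assms by (simp add: slotwise_def)
  then show ?case unfolding Cons by simp
qed simp

section \<open>Splitting into base and fibre components\<close>

abbreviation Ph :: "model \<Rightarrow> model" where "Ph v \<equiv> horiz (fst v)"

abbreviation Qv :: "model \<Rightarrow> model" where "Qv v \<equiv> vert (snd v)"

lemma linear_Ph: "linear (\<lambda>v. Ph v)" and linear_Qv: "linear (\<lambda>v. Qv v)"
  by (auto intro: linearI)

text \<open>Multiplying the horizontal arguments by t produces the single power
  \<open>t ^ length xs\<close>, so all other coefficients vanish.\<close>

lemma split_part_mixed:
  assumes "multilinear \<omega>"
  shows "split_part Ph Qv m \<omega> (map horiz xs @ map vert ys) = (if m = length xs then \<omega> (map horiz xs @ map vert ys) else 0)"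
proof (cases "m \<le> length xs + length ys")
  case True
  let ?L = "map horiz xs @ map vert ys"
  let ?c = "\<lambda>k. split_part Ph Qv k \<omega> ?L - (if k = length xs then \<omega> ?L else 0)"
  have "(\<Sum>k\<le>length ?L. ?c k * of_real t ^ k) = 0" for t :: real
  proof -
    have "\<omega> (map (\<lambda>v. t *\<^sub>R Ph v + Qv v) ?L) = \<omega> ([] @ map (\<lambda>v. t *\<^sub>R v) (map horiz xs) @ map vert ys)"
      by (simp add: o_def)
    also have "\<dots> = of_real t ^ length xs * \<omega> ?L"
      by (subst multilinear_scale_map[OF assms]) simp
    finally have "(\<Sum>k\<le>length ?L. split_part Ph Qv k \<omega> ?L * of_real t ^ k) = of_real t ^ length xs * \<omega> ?L"
      using split_part_generating[OF assms, of t Ph Qv ?L] by simp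
    moreover have "(\<Sum>k\<le>length ?L. (if k = length xs then \<omega> ?L else 0) * of_real t ^ k) = of_real t ^ length xs * \<omega> ?L"
      by (simp add: if_distrib[where f = "\<lambda>x. x * _"] cong: if_cong)
    ultimately show ?thesis by (simp add: left_diff_distrib sum_subtractf)
  qed
  then have "?c m = 0" by (rule real_poly_zero_coeffs[where n = "length ?L"]) (use True in simp)
  then show ?thesis by simp
next
  case False
  then show ?thesis by (simp add: split_part_too_large)
qed

definition scale_horiz :: "real \<Rightarrow> model \<Rightarrow> model" where
  "scale_horiz s v = (s *\<^sub>R fst v, snd v)"

lemma linear_scale_horiz: "linear (scale_horiz s)"
  by (rule linearI) (simp_all add: scale_horiz_def algebra_simps)

text \<open>Replaces t by t s in the generating polynomial. The case m = 3 is the origin of the cube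
  in the choice of s.\<close>

lemma split_part_scale_horiz:
  assumes "alternating \<omega>"
  shows "split_part Ph Qv m (pull (scale_horiz s) \<omega>) vs = of_real s ^ m * split_part Ph Qv m \<omega> vs"
proof (cases "m \<le> length vs")
  case True
  have ml: "multilinear \<omega>" "multilinear (pull (scale_horiz s) \<omega>)"
    using assms by (auto intro: alternating_multilinear alternating_pull linear_scale_horiz)
  let ?c = "\<lambda>k. split_part Ph Qv k (pull (scale_horiz s) \<omega>) vs - of_real s ^ k * split_part Ph Qv k \<omega> vs"
  have "(\<Sum>k\<le>length vs. ?c k * of_real t ^ k) = 0" for t :: real
  proof -
    have "(\<Sum>k\<le>length vs. split_part Ph Qv k (pull (scale_horiz s) \<omega>) vs * of_real t ^ k) =
        \<omega> (map (\<lambda>v. (t * s) *\<^sub>R Ph v + Qv v) vs)"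
      unfolding split_part_generating[OF ml(2), symmetric] by (simp add: pull_def scale_horiz_def o_def mult.commute)
    also have "\<dots> = (\<Sum>k\<le>length vs. split_part Ph Qv k \<omega> vs * of_real (t * s) ^ k)"
      by (rule split_part_generating[OF ml(1)])
    finally show ?thesis by (simp add: algebra_simps sum_subtractf power_mult_distrib)
  qed
  then have "?c m = 0" by (rule real_poly_zero_coeffs[where n = "length vs"]) (use True in simp)
  then show ?thesis by simp
qed (simp add: split_part_too_large)

lemma split_part_0: "split_part Ph Qv 0 \<omega> vs = \<omega> (map Qv vs)"
proof -
  have "{S. S \<subseteq> {..<length vs} \<and> card S = 0} = {{}}" by (auto dest: finite_subset)
  moreover have "map (\<lambda>i. Qv (vs ! i)) [0..<length vs] = map Qv vs"
    by (rule nth_equalityI) simp_all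
  ultimately show ?thesis by (simp add: split_part_def)
qed

lemma Im_frechet_derivative:
  assumes "open D" "r \<in> D" "g differentiable at r" "\<And>z. z \<in> D \<Longrightarrow> Im (g z) = 0"
  shows "Im (frechet_derivative g (at r) v) = 0"
proof -
  have "((\<lambda>z. Im (g z)) has_derivative (\<lambda>v. Im (frechet_derivative g (at r) v))) (at r)"
    by (intro has_derivative_Im) (use assms(3) in \<open>simp add: frechet_derivative_works\<close>)
  moreover have "((\<lambda>z. Im (g z)) has_derivative (\<lambda>v. 0)) (at r)"
    by (rule has_derivative_transform_within_open[OF has_derivative_const assms(1,2)]) (simp add: assms(4))
  ultimately show ?thesis using has_derivative_unique by metis
qed

text \<open>The last sum is real because each differentiated function is, and imaginary by the hypothesis.\<close>

lemma divergence_conj: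
  fixes F :: "'a::real_normed_vector \<Rightarrow> complex" and C :: "'i \<Rightarrow> 'a \<Rightarrow> real"
  assumes D: "open D" "r \<in> D" and F: "F differentiable at r"
    and X: "\<And>i. i \<in> K \<Longrightarrow> (\<lambda>z. F z * of_real (C i z)) differentiable at r"
    and eq: "(\<Sum>i\<in>K. frechet_derivative (\<lambda>z. F z * of_real (C i z)) (at r) (e i)) =
      - (\<Sum>i\<in>K. of_real (C i r) * frechet_derivative F (at r) (e i))"
  shows "(\<Sum>i\<in>K. frechet_derivative (\<lambda>z. cnj (F z) * (F z * of_real (C i z))) (at r) (e i)) = 0"
proof -
  let ?X = "\<lambda>i z. F z * of_real (C i z)"
  have hasF: "(F has_derivative frechet_derivative F (at r)) (at r)"
    using F by (simp add: frechet_derivative_works)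
  have der: "((\<lambda>z. cnj (F z) * ?X i z) has_derivative
      (\<lambda>v. cnj (F r) * frechet_derivative (?X i) (at r) v + cnj (frechet_derivative F (at r) v) * ?X i r)) (at r)"
    if "i \<in> K" for i
    by (intro has_derivative_mult has_derivative_cnj hasF) (use X[OF that] in \<open>simp add: frechet_derivative_works\<close>)
  have val: "frechet_derivative (\<lambda>z. cnj (F z) * ?X i z) (at r) v =
      cnj (F r) * frechet_derivative (?X i) (at r) v + cnj (frechet_derivative F (at r) v) * ?X i r" if "i \<in> K" for i v
    by (simp add: frechet_derivative_at[OF der[OF that], symmetric])
  have "cnj (F z) * ?X i z = of_real ((cmod (F z))\<^sup>2 * C i z)" for i z
    by (simp add: complex_norm_square[symmetric] mult.assoc[symmetric] mult.commute del: of_real_power)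
  then have "Im (cnj (F z) * ?X i z) = 0" for i z by simp
  then have "Im (frechet_derivative (\<lambda>z. cnj (F z) * ?X i z) (at r) (e i)) = 0" if "i \<in> K" for i
    by (intro Im_frechet_derivative[OF D]) (use der[OF that] in \<open>auto simp: differentiable_def\<close>)
  then have im: "Im (\<Sum>i\<in>K. frechet_derivative (\<lambda>z. cnj (F z) * ?X i z) (at r) (e i)) = 0" by simp
  define P where "P = (\<Sum>i\<in>K. of_real (C i r) * frechet_derivative F (at r) (e i))"
  have "(\<Sum>i\<in>K. frechet_derivative (\<lambda>z. cnj (F z) * ?X i z) (at r) (e i)) =
      (\<Sum>i\<in>K. cnj (F r) * frechet_derivative (?X i) (at r) (e i) + cnj (frechet_derivative F (at r) (e i)) * ?X i r)"
    by (rule sum.cong[OF refl val])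
  also have "\<dots> = cnj (F r) * (\<Sum>i\<in>K. frechet_derivative (?X i) (at r) (e i)) + F r * cnj P"
    by (simp add: P_def sum.distrib sum_distrib_left ac_simps)
  also have "\<dots> = F r * cnj P - cnj (F r * cnj P)"
    unfolding eq P_def[symmetric] by simp
  finally have *: "(\<Sum>i\<in>K. frechet_derivative (\<lambda>z. cnj (F z) * ?X i z) (at r) (e i)) = F r * cnj P - cnj (F r * cnj P)" .
  then have "Re (\<Sum>i\<in>K. frechet_derivative (\<lambda>z. cnj (F z) * ?X i z) (at r) (e i)) = 0" by simp
  with im show ?thesis by (simp add: complex_eq_iff)
qed

section \<open>Derivatives of fibre-invariant forms on sorted lists\<close>

lemma omit_append1: "i < length xs \<Longrightarrow> omit i (xs @ ys) = omit i xs @ ys"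
  by (simp add: omit_def)

lemma omit_append2: "omit (length xs) (xs @ [y]) = xs"
  by (simp add: omit_def)

text \<open>A vertical vector in the differentiating position has base component zero, so only the
  horizontal positions contribute.\<close>

lemma base_deriv_mixed:
  assumes "\<And>vs. (\<lambda>r. \<omega> r vs) differentiable at r"
  shows "base_deriv \<omega> r (map horiz xs @ map vert ys) =
    (\<Sum>i<length xs. (-1) ^ i * frechet_derivative (\<lambda>r. \<omega> r (map horiz (omit i xs) @ map vert ys)) (at r) (xs ! i))"
proof -
  let ?L = "map horiz xs @ map vert ys"
  have lin: "linear (frechet_derivative (\<lambda>r. \<omega> r vs) (at r))" for vs
    by (rule linear_frechet_derivative[OF assms])
  have "base_deriv \<omega> r ?L = (\<Sum>i<length xs. (-1) ^ i * frechet_derivative (\<lambda>r. \<omega> r (omit i ?L)) (at r) (fst (?L ! i)))"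
    unfolding base_deriv_def
  proof (rule sum.mono_neutral_right)
    show "\<forall>i\<in>{..<length ?L} - {..<length xs}. (-1) ^ i * frechet_derivative (\<lambda>r. \<omega> r (omit i ?L)) (at r) (fst (?L ! i)) = 0"
      by (auto simp: nth_append linear_0[OF lin])
  qed auto
  also have "\<dots> = (\<Sum>i<length xs. (-1) ^ i * frechet_derivative (\<lambda>r. \<omega> r (map horiz (omit i xs) @ map vert ys)) (at r) (xs ! i))"
    by (intro sum.cong) (simp_all add: omit_append1 map_omit nth_append)
  finally show ?thesis .
qed

lemma base_deriv_vert_horiz:
  assumes "\<And>vs. (\<lambda>r. \<omega> r vs) differentiable at r"
  shows "base_deriv \<omega> r (map vert ys @ [horiz x]) =
    (-1) ^ length ys * frechet_derivative (\<lambda>r. \<omega> r (map vert ys)) (at r) x"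
proof -
  have lin: "linear (frechet_derivative (\<lambda>r. \<omega> r vs) (at r))" for vs
    by (rule linear_frechet_derivative[OF assms])
  have "omit (length ys) (map vert ys @ [horiz x]) = map vert ys"
    using omit_append2[of "map vert ys" "horiz x"] by simp
  moreover have "(\<Sum>i<length ys. (-1) ^ i * frechet_derivative (\<lambda>r. \<omega> r (omit i (map vert ys @ [horiz x]))) (at r) (fst ((map vert ys @ [horiz x]) ! i))) = 0"
    by (rule sum.neutral) (auto simp: nth_append linear_0[OF lin])
  ultimately show ?thesis by (simp add: base_deriv_def nth_append)
qed

lemma alternating_base_deriv:
  assumes "open D" "r \<in> D" "\<And>z. z \<in> D \<Longrightarrow> alternating (\<omega> z)" "\<And>vs. (\<lambda>r. \<omega> r vs) differentiable at r"
  shows "alternating (base_deriv \<omega> r)"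
proof -
  let ?u = "(r, 0) :: model"
  have U: "open (D \<times> (UNIV :: (real^4) set))" "?u \<in> D \<times> UNIV" using assms(1,2) by (auto intro: open_Times)
  have dif: "(\<lambda>z. \<omega> (fst z) vs) differentiable at ?u" for vs
    using fst_has_derivative[where u = ?u and k = "\<lambda>r. \<omega> r vs"] assms(4) unfolding differentiable_def by fastforce
  have "alternating (alt_deriv (\<lambda>z. \<omega> (fst z)) ?u)"
    by (rule alternating_alt_deriv[OF U _ dif]) (auto simp: assms(3))
  moreover have "alt_deriv (\<lambda>z. \<omega> (fst z)) ?u = base_deriv \<omega> r"
    using alt_deriv_base[of \<omega> ?u] assms(4) by (intro ext) simp
  ultimately show ?thesis by simp
qed

text \<open>Only the component of w along the omitted axis survives. With w in front this gives the
  sign \<open>(-1) ^ i\<close>, and moving w behind the three other vectors gives the extra minus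
  sign.\<close>

lemma det_form_omit:
  assumes "i < 4" shows "det_form (omit i axes4 @ [w]) = - ((-1) ^ i * of_real (w \<bullet> axes4 ! i))"
proof -
  have ml: "multilinear det_form" by (rule alternating_multilinear[OF alternating_det_form])
  have "det_form (w # omit i axes4) = det_form ([] @ (\<Sum>b\<in>Basis. (w \<bullet> b) *\<^sub>R b) # omit i axes4)"
    by (simp add: euclidean_representation)
  also have "\<dots> = (\<Sum>b\<in>Basis. of_real (w \<bullet> b) * det_form (b # omit i axes4))"
    by (simp only: multilinear_sum[OF ml] multilinear_scale[OF ml]) simp
  also have "\<dots> = (\<Sum>b\<in>Basis. if b = axes4 ! i then of_real (w \<bullet> b) * (-1) ^ i else 0)"
  proof (rule sum.cong[OF refl])
    fix b :: "real^4" assume "b \<in> Basis"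
    then have "b \<in> set axes4" by (simp only: set_axes4)
    then obtain k where k: "k < length axes4" "axes4 ! k = b" unfolding in_set_conv_nth by blast
    have "b = axes4 ! i \<longleftrightarrow> i = k"
      using k assms nth_eq_iff_index_eq[OF distinct_axes4] by (auto simp: length_axes4)
    then show "of_real (w \<bullet> b) * det_form (b # omit i axes4) = (if b = axes4 ! i then of_real (w \<bullet> b) * (-1) ^ i else 0)"
      using alternating_insert_omit[OF alternating_det_form k(1), of i] assms k(2)
      by (simp add: length_axes4 det_form_axes4)
  qed
  also have "\<dots> = of_real (w \<bullet> axes4 ! i) * (-1) ^ i"
    using nth_mem[of i axes4] assms by (simp add: set_axes4 length_axes4)
  finally have 1: "det_form (w # omit i axes4) = of_real (w \<bullet> axes4 ! i) * (-1) ^ i" .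
  have "det_form (w # omit i axes4) = (-1) ^ length (omit i axes4) * det_form (omit i axes4 @ [w])"
    using alternating_move[OF alternating_det_form, of "[]" w "omit i axes4" "[]"] by simp
  moreover have "length (omit i axes4) = 3" using assms by (simp add: length_omit length_axes4)
  ultimately have "det_form (omit i axes4 @ [w]) = - det_form (w # omit i axes4)" by simp
  then show ?thesis unfolding 1 by (simp add: mult.commute)
qed

section \<open>The frame dual to dr and \<delta>\<theta>\<close>

context semiflat_bundle
begin

text \<open>Takes a coordinate vector to its components with respect to dr and \<delta>\<theta>;
  \<open>unshear\<close> goes back.\<close>

definition shear :: "('b, 'm) torus_coords \<Rightarrow> real^4 \<Rightarrow> model \<Rightarrow> model" where
  "shear q r v = (fst v, snd v + a q r *v fst v)"

definition unshear :: "('b, 'm) torus_coords \<Rightarrow> real^4 \<Rightarrow> model \<Rightarrow> model" where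
  "unshear q r v = (fst v, snd v - a q r *v fst v)"

lemma shear_simps [simp]: "shear q r (unshear q r v) = v" "unshear q r (shear q r v) = v"
  "shear q r (vert y) = vert y" "unshear q r (vert y) = vert y" "fst (shear q r v) = fst v"
  by (simp_all add: shear_def unshear_def)

lemma linear_shear: "linear (shear q r)" "linear (unshear q r)"
  by (rule linearI; simp add: shear_def unshear_def matrix_vector_right_distrib matrix_vector_mult_scaleR algebra_simps)+

lemma smooth_a: "q \<in> \<P> \<Longrightarrow> smooth_on (tc_dom q) (a q)"
  using frame by (simp add: semi_flat_frame_def)

lemma linear_matrix_action: "bounded_linear (\<lambda>M::real^4^4. vert (M *v x))"
  unfolding linear_conv_bounded_linear[symmetric]
  by (rule linearI) (simp_all add: matrix_vector_mult_add_rdistrib scaleR_matrix_vector_assoc)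

lemma smooth_unshear: assumes "q \<in> \<P>" shows "smooth_on (tc_dom q) (\<lambda>r. unshear q r v)"
proof -
  note op = open_tc_dom[OF assms]
  have "smooth_on (tc_dom q) (\<lambda>r. v + (-1) *\<^sub>R vert (a q r *v fst v))"
    by (intro smooth_on_add[OF op] smooth_on_const smooth_on_scaleR[OF op]
        smooth_on_compose_linear[OF op linear_matrix_action smooth_a[OF assms]])
  moreover have "v + (-1) *\<^sub>R vert (a q r *v fst v) = unshear q r v" for r
    by (simp add: unshear_def prod_eq_iff)
  ultimately show ?thesis by simp
qed

text \<open>This is \<open>flat_connection\<close> without indices, obtained by expanding both
  vectors in the axes. It supplies the symmetry required by \<open>alt_deriv_pull\<close> for the
  shear.\<close>

lemma a_derivative_symmetric:
  assumes q: "q \<in> \<P>" "r \<in> tc_dom q"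
  shows "frechet_derivative (a q) (at r) x *v y = frechet_derivative (a q) (at r) y *v x"
proof -
  let ?a = "frechet_derivative (a q) (at r)"
  have dif: "a q differentiable at r" by (rule smooth_on_differentiable[OF smooth_a[OF q(1)] q(2)])
  have lin: "linear ?a" by (rule linear_frechet_derivative[OF dif])
  have comp: "frechet_derivative (\<lambda>r. a q r $ l $ k) (at r) h = ?a h $ l $ k" for l k h
  proof -
    have "bounded_linear (\<lambda>M::real^4^4. M $ l $ k)"
      unfolding linear_conv_bounded_linear[symmetric] by (rule linearI) simp_all
    from frechet_derivative_compose_linear[OF this dif] show ?thesis by (simp add: fun_eq_iff)
  qed
  have s: "?a (axis j 1) $ l $ k = ?a (axis k 1) $ l $ j" for j k l
  proof -
    have "frechet_derivative (\<lambda>r. a q r $ l $ k) (at r) (axis j 1) - frechet_derivative (\<lambda>r. a q r $ l $ j) (at r) (axis k 1) = 0"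
      using flat q unfolding flat_connection_def by blast
    then show ?thesis by (simp add: comp)
  qed
  have ex: "(?a x *v y) $ l = (\<Sum>k\<in>UNIV. \<Sum>j\<in>UNIV. x $ j * y $ k * ?a (axis j 1) $ l $ k)" for x y l
  proof -
    have "?a x = ?a (\<Sum>j\<in>UNIV. x $ j *\<^sub>R axis j 1)" by (simp add: basis_expansion scalar_mult_eq_scaleR[symmetric])
    also have "\<dots> = (\<Sum>j\<in>UNIV. x $ j *\<^sub>R ?a (axis j 1))" by (simp add: linear_sum[OF lin] linear_scale[OF lin])
    finally have "?a x $ l $ k = (\<Sum>j\<in>UNIV. x $ j * ?a (axis j 1) $ l $ k)" for k by simp
    then show ?thesis by (simp add: matrix_vector_mult_def sum_distrib_right sum_distrib_left mult_ac)
  qed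
  show ?thesis
    unfolding vec_eq_iff ex by (subst sum.swap) (simp add: s[of _ _ "_"] mult.commute mult.left_commute)
qed

text \<open>Flatness makes the frame \<open>dr, \<delta>\<theta>\<close> closed, so that forms may be differentiated as if \<open>a = 0\<close>.\<close>

lemma base_deriv_shear:
  assumes q: "q \<in> \<P>" "r \<in> tc_dom q" and alt: "\<And>r. r \<in> tc_dom q \<Longrightarrow> alternating (\<omega> r)"
    and dif: "\<And>vs. (\<lambda>r. \<omega> r vs) differentiable at r"
  shows "base_deriv (\<lambda>r vs. \<omega> r (map (shear q r) vs)) r vs = base_deriv \<omega> r (map (shear q r) vs)"
    and "(\<lambda>r. \<omega> r (map (shear q r) vs)) differentiable at r"
proof -
  let ?u = "(r, 0) :: model" and ?a = "frechet_derivative (a q) (at r)"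
  have U: "open (tc_dom q \<times> (UNIV :: (real^4) set))" "?u \<in> tc_dom q \<times> UNIV"
    using open_tc_dom[OF q(1)] q(2) by (auto intro: open_Times)
  have ad: "a q differentiable at r" by (rule smooth_on_differentiable[OF smooth_a[OF q(1)] q(2)])
  have sh: "((\<lambda>r. shear q r v) has_derivative (\<lambda>h. vert (?a h *v fst v))) (at r)" for v
  proof -
    have "((\<lambda>r. v + vert (a q r *v fst v)) has_derivative (\<lambda>h. 0 + vert (?a h *v fst v))) (at r)"
      by (intro has_derivative_add has_derivative_const bounded_linear.has_derivative[OF linear_matrix_action])
        (use ad in \<open>simp add: frechet_derivative_works\<close>)
    moreover have "v + vert (a q r *v fst v) = shear q r v" for r by (simp add: shear_def prod_eq_iff)
    ultimately show ?thesis by simp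
  qed
  have sh': "((\<lambda>z. shear q (fst z) v) has_derivative (\<lambda>h. vert (?a (fst h) *v fst v))) (at ?u)" for v
  proof -
    have f: "(fst has_derivative fst) (at ?u)" by (rule has_derivative_fst[OF has_derivative_ident])
    show ?thesis using has_derivative_compose[OF f, of "\<lambda>r. shear q r v" "\<lambda>h. vert (?a h *v fst v)"] sh by simp
  qed
  have D: "(\<lambda>r. \<omega> r (map (shear q r) vs)) differentiable at r" for vs
  proof -
    note form_args_has_derivative[where B = "shear q" and B' = "\<lambda>h v. vert (?a h *v fst v)",
        OF open_tc_dom[OF q(1)] q(2) alternating_multilinear[OF alt] dif sh, where pre = "[]" and vs = vs]
    then have "\<exists>D. ((\<lambda>z. \<omega> z ([] @ map (shear q z) vs)) has_derivative D) (at r)" by blast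
    then show ?thesis by (simp add: differentiable_def)
  qed
  then show "(\<lambda>r. \<omega> r (map (shear q r) vs)) differentiable at r" .
  have dif': "(\<lambda>z. \<omega> (fst z) vs) differentiable at ?u" for vs
    using fst_has_derivative[where u = ?u and k = "\<lambda>r. \<omega> r vs"] dif unfolding differentiable_def by fastforce
  have "base_deriv (\<lambda>r vs. \<omega> r (map (shear q r) vs)) r vs = alt_deriv (\<lambda>z vs. \<omega> (fst z) (map (shear q (fst z)) vs)) ?u vs"
    using alt_deriv_base[of "\<lambda>r vs. \<omega> r (map (shear q r) vs)" ?u vs] D by simp
  also have "\<dots> = (\<Sum>i<length vs. (-1) ^ i * frechet_derivative (\<lambda>z. \<omega> (fst z) (map (shear q (fst ?u)) (omit i vs))) (at ?u) (vs ! i))"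
    by (rule alt_deriv_pull[where B = "\<lambda>z. shear q (fst z)" and B' = "\<lambda>h v. vert (?a (fst h) *v fst v)", OF U _ dif' sh'])
      (auto simp: alt a_derivative_symmetric[OF q])
  also have "\<dots> = base_deriv \<omega> r (map (shear q r) vs)"
  proof -
    have "frechet_derivative (\<lambda>z. \<omega> (fst z) xs) (at ?u) = (\<lambda>h. frechet_derivative (\<lambda>r. \<omega> r xs) (at r) (fst h))" for xs
      using frechet_derivative_at[OF fst_has_derivative[where u = ?u and k = "\<lambda>r. \<omega> r xs"]] dif by simp
    then show ?thesis by (simp add: base_deriv_def map_omit)
  qed
  finally show "base_deriv (\<lambda>r vs. \<omega> r (map (shear q r) vs)) r vs = base_deriv \<omega> r (map (shear q r) vs)" .
qed

end

section \<open>The divergence of the cofactor matrix\<close>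

context susy_bundle
begin

text \<open>The weighted \<Omega> in components with respect to dr and \<delta>\<theta>. The
  connection has disappeared: the almost complex structure becomes \<open>I0\<close>, which by
  \<open>I0_vert\<close> and \<open>I0_horiz\<close> is governed by \<rho> alone.\<close>

definition flatform :: "('b, 'm) torus_coords \<Rightarrow> real^4 \<Rightarrow> model form" where
  "flatform q r vs = wform q r (map (unshear q r) vs)"

text \<open>The function F = e^-A f; vertical vectors are unaffected by the shear.\<close>

definition fcoef_warped :: "('b, 'm) torus_coords \<Rightarrow> real^4 \<Rightarrow> complex" where
  "fcoef_warped q r = flatform q r (map vert axes4)"

context
  fixes q assumes q: "q \<in> \<P>"
begin

lemma flatform_shear: "flatform q r (map (shear q r) vs) = wform q r vs"
  by (simp add: flatform_def o_def)

lemma alternating_flatform: "r \<in> tc_dom q \<Longrightarrow> alternating (flatform q r)"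
proof -
  assume "r \<in> tc_dom q"
  then have "alternating (pull (unshear q r) (wform q r))"
    by (intro alternating_pull linear_shear alternating_wform q)
  moreover have "flatform q r = pull (unshear q r) (wform q r)" by (auto simp: fun_eq_iff flatform_def pull_def)
  ultimately show ?thesis by simp
qed

lemma smooth_flatform: "smooth_on (tc_dom q) (\<lambda>r. flatform q r vs)"
  unfolding flatform_def
  by (rule smooth_on_map_args[OF open_tc_dom[OF q] alternating_multilinear[OF alternating_wform[OF q]] smooth_wform[OF q]
        smooth_unshear[OF q]])

lemma flatform_differentiable: "r \<in> tc_dom q \<Longrightarrow> (\<lambda>r. flatform q r vs) differentiable at r"
  by (rule smooth_on_differentiable[OF smooth_flatform])

lemma flatform_degree: "r \<in> tc_dom q \<Longrightarrow> length vs \<noteq> 4 \<Longrightarrow> flatform q r vs = 0"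
  using \<Omega>_degree[OF tc_chart_in[OF q] tc_chart_self, of "(r, 0)"]
  by (simp add: flatform_def wform_def bform_def in_coords_def has_degree_def)

section \<open>The almost complex structure in the flat frame\<close>

definition I0 :: "real^4 \<Rightarrow> model \<Rightarrow> model" where
  "I0 r v = shear q r (I_at q (r, 0) (unshear q r v))"

lemma I0_vert: "r \<in> tc_dom q \<Longrightarrow> I0 r (vert (\<rho> q r *v x)) = horiz x"
proof -
  assume "r \<in> tc_dom q"
  then have "I_at q (r, 0) (vert (\<rho> q r *v x)) = (x, - (a q r *v x))"
    using hor_eq_I_vert[OF q, of "(r, 0)" "horiz x"] by (simp add: hor_def)
  then show ?thesis by (simp add: I0_def) (simp add: shear_def)
qed

lemma I0_horiz: "r \<in> tc_dom q \<Longrightarrow> I0 r (horiz x) = vert (- (\<rho> q r *v x))"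
proof -
  assume r: "r \<in> tc_dom q"
  then have "unshear q r (horiz x) = I_at q (r, 0) (vert (\<rho> q r *v x))"
    using hor_eq_I_vert[OF q, of "(r, 0)" "horiz x"] by (simp add: hor_def unshear_def)
  moreover have "I_at q (r, 0) (I_at q (r, 0) (vert (\<rho> q r *v x))) = vert (- (\<rho> q r *v x))"
    using I_at_props(2)[OF q, of "(r, 0)" "vert (\<rho> q r *v x)"] r by simp
  ultimately show ?thesis by (simp add: I0_def)
qed

lemma slotwise_flatform: assumes "r \<in> tc_dom q" shows "slotwise (I0 r) \<i> (flatform q r)"
  unfolding slotwise_def
proof (intro allI)
  fix us v vs
  have "slotwise (I_at q (r, 0)) \<i> (in_coords \<Omega> q (r, 0))" using I_at_props(3)[OF q, of "(r, 0)"] assms by simp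
  then have "bform q r (map (unshear q r) us @ I_at q (r, 0) (unshear q r v) # map (unshear q r) vs) =
      \<i> * bform q r (map (unshear q r) us @ unshear q r v # map (unshear q r) vs)"
    unfolding slotwise_def bform_def by blast
  then show "flatform q r (us @ I0 r v # vs) = \<i> * flatform q r (us @ v # vs)"
    by (simp add: flatform_def wform_def I0_def)
qed

lemma flatform_type:
  assumes r: "r \<in> tc_dom q"
  shows "base_deriv (flatform q) r (map (I0 r) vs) = \<i> * base_deriv (flatform q) r vs"
proof -
  have w: "base_deriv (flatform q) r (map (shear q r) xs) = base_deriv (wform q) r xs" for xs
    using base_deriv_shear(1)[OF q r alternating_flatform flatform_differentiable[OF r], of xs]
    by (simp add: flatform_shear[abs_def])
  have "base_deriv (flatform q) r (map (I0 r) vs) = base_deriv (wform q) r (map (I_at q (r, 0)) (map (unshear q r) vs))"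
  proof -
    have "map (I0 r) vs = map (shear q r) (map (I_at q (r, 0)) (map (unshear q r) vs))"
      by (induction vs) (simp_all add: I0_def)
    then show ?thesis using w by metis
  qed
  also have "\<dots> = \<i> * base_deriv (wform q) r (map (unshear q r) vs)" by (rule wform_type[OF q r])
  also have "\<dots> = \<i> * base_deriv (flatform q) r vs"
    using w[of "map (unshear q r) vs"] by (simp add: o_def)
  finally show ?thesis .
qed

lemma linear_\<rho>_vert: "linear (\<lambda>x. vert (\<rho> q r *v x))"
  by (rule linearI) (simp_all add: matrix_vector_right_distrib matrix_vector_mult_scaleR)

lemma flatform_det: "r \<in> tc_dom q \<Longrightarrow> flatform q r (map (\<lambda>x. vert (N *v x)) axes4) = of_real (det N) * fcoef_warped q r"
  unfolding fcoef_warped_def by (rule alternating_det[OF alternating_flatform linear_vert])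

text \<open>Component i of the cofactor matrix of \<rho> applied to y: as \<rho> is symmetric, its
  cofactor matrix is \<open>det\<close> times the inverse. The vector y is the one vertical argument
  of a (3,1)-part.\<close>

definition cof :: "real^4 \<Rightarrow> nat \<Rightarrow> real^4 \<Rightarrow> real" where
  "cof y i r = det (\<rho> q r) * ((matrix_inv (\<rho> q r) *v y) \<bullet> axes4 ! i)"

lemma \<rho>_inverse: "r \<in> tc_dom q \<Longrightarrow> \<rho> q r *v (matrix_inv (\<rho> q r) *v y) = y"
proof -
  assume "r \<in> tc_dom q"
  then have "\<rho> q r ** matrix_inv (\<rho> q r) = mat 1"
    using someI_ex[of "\<lambda>M. \<rho> q r ** M = mat 1 \<and> M ** \<rho> q r = mat 1"] frame_props(3)[OF q, of r]
    unfolding invertible_def matrix_inv_def by blast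
  then show ?thesis by (simp add: matrix_vector_mul_assoc)
qed

text \<open>Each horizontal x is the image of the vertical \<rho> x under \<open>I0\<close>, so
  three slots give \<i>^3 and all arguments become vertical. Writing y as \<rho> w turns the value
  into F det \<rho> times the determinant of three axes and w, which is a component of w up to
  sign.\<close>

lemma flatform_cof:
  assumes r: "r \<in> tc_dom q" and i: "i < 4"
  shows "flatform q r (map horiz (omit i axes4) @ [vert y]) = (-1) ^ i * (\<i> * (fcoef_warped q r * of_real (cof y i r)))"
proof -
  let ?xs = "omit i axes4" and ?w = "matrix_inv (\<rho> q r) *v y" and ?\<phi> = "\<lambda>x. vert (\<rho> q r *v x)"
  have len: "length ?xs = 3" using i by (simp add: length_omit length_axes4)
  have m: "map horiz ?xs = map (I0 r) (map ?\<phi> ?xs)" using I0_vert[OF r] by simp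
  have "flatform q r (map horiz ?xs @ [vert y]) = \<i> ^ 3 * flatform q r (map ?\<phi> ?xs @ [vert y])"
    unfolding m using slotwise_map[OF slotwise_flatform[OF r], of "[]" "map ?\<phi> ?xs" "[vert y]"]
    by (simp only: append_Nil length_map len)
  also have "map ?\<phi> ?xs @ [vert y] = map ?\<phi> (?xs @ [?w])" by (simp add: \<rho>_inverse[OF r])
  also have "flatform q r (map ?\<phi> (?xs @ [?w])) = det_form (?xs @ [?w]) * flatform q r (map ?\<phi> axes4)"
    by (rule alternating_det_form_eq[OF alternating_flatform[OF r] linear_\<rho>_vert]) (simp add: len)
  also have "flatform q r (map ?\<phi> axes4) = of_real (det (\<rho> q r)) * fcoef_warped q r" by (rule flatform_det[OF r])
  finally show ?thesis
    unfolding det_form_omit[OF i] cof_def by (simp add: power3_eq_cube algebra_simps)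
qed

lemma fcoef_warped_differentiable: "r \<in> tc_dom q \<Longrightarrow> fcoef_warped q differentiable at r"
  unfolding fcoef_warped_def[abs_def] by (rule flatform_differentiable)

text \<open>By \<open>flatform_cof\<close> the product is, up to a constant, a value of a smooth
  form, so neither the determinant nor the inverse of \<rho> has to be differentiated.\<close>

lemma cof_differentiable:
  assumes r: "r \<in> tc_dom q" and i: "i < 4"
  shows "(\<lambda>r. fcoef_warped q r * of_real (cof y i r)) differentiable at r"
proof -
  let ?g = "\<lambda>r. (-1) ^ i * - \<i> * flatform q r (map horiz (omit i axes4) @ [vert y])"
  have "?g differentiable at r"
    by (intro differentiable_mult differentiable_const flatform_differentiable r)
  then obtain D where D: "(?g has_derivative D) (at r)" unfolding differentiable_def by blast
  have "?g z = fcoef_warped q z * of_real (cof y i z)" if "z \<in> tc_dom q" for z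
    unfolding flatform_cof[OF that i] by (cases "even i") simp_all
  from has_derivative_transform_within_open[OF D open_tc_dom[OF q] r this]
  have "((\<lambda>r. fcoef_warped q r * of_real (cof y i r)) has_derivative D) (at r)" .
  then show ?thesis unfolding differentiable_def by blast
qed

text \<open>The type of \<open>d(e\<^sup>-\<^sup>A \<Omega>)\<close> expresses the divergence of the cofactor matrix by the gradient
  of the coefficient.\<close>

lemma cofactor_divergence:
  assumes r: "r \<in> tc_dom q"
  shows "(\<Sum>i<4. frechet_derivative (\<lambda>r. fcoef_warped q r * of_real (cof y i r)) (at r) (axes4 ! i)) =
    - (\<Sum>i<4. of_real (cof y i r) * frechet_derivative (fcoef_warped q) (at r) (axes4 ! i))"
proof -
  let ?F = "fcoef_warped q" and ?w = "matrix_inv (\<rho> q r) *v y" and ?\<phi> = "\<lambda>x. vert (\<rho> q r *v x)"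
  note dif = flatform_differentiable[OF r]
  have linF: "linear (frechet_derivative ?F (at r))"
    by (rule linear_frechet_derivative[OF fcoef_warped_differentiable[OF r]])
  have summand: "(-1) ^ i * frechet_derivative (\<lambda>r. flatform q r (map horiz (omit i axes4) @ [vert y])) (at r) v =
      \<i> * frechet_derivative (\<lambda>r. ?F r * of_real (cof y i r)) (at r) v" if i: "i < 4" for i v
  proof -
    have "((\<lambda>z. (-1) ^ i * (\<i> * (?F z * of_real (cof y i z)))) has_derivative
        (\<lambda>v. (-1) ^ i * (\<i> * frechet_derivative (\<lambda>r. ?F r * of_real (cof y i r)) (at r) v))) (at r)"
      by (intro has_derivative_mult_right) (use cof_differentiable[OF r i] in \<open>simp add: frechet_derivative_works\<close>)
    then have "((\<lambda>r. flatform q r (map horiz (omit i axes4) @ [vert y])) has_derivative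
        (\<lambda>v. (-1) ^ i * (\<i> * frechet_derivative (\<lambda>r. ?F r * of_real (cof y i r)) (at r) v))) (at r)"
      by (rule has_derivative_transform_within_open[OF _ open_tc_dom[OF q] r]) (simp add: flatform_cof i)
    from frechet_derivative_at[OF this, symmetric] show ?thesis
      by (simp add: power_mult_distrib[symmetric] mult.assoc[symmetric])
  qed
  have "base_deriv (flatform q) r (map horiz axes4 @ map vert [y]) =
      (\<Sum>i<4. (-1) ^ i * frechet_derivative (\<lambda>r. flatform q r (map horiz (omit i axes4) @ [vert y])) (at r) (axes4 ! i))"
    using base_deriv_mixed[of "flatform q" r axes4 "[y]", OF dif] by (simp add: length_axes4)
  also have "\<dots> = \<i> * (\<Sum>i<4. frechet_derivative (\<lambda>r. ?F r * of_real (cof y i r)) (at r) (axes4 ! i))"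
    unfolding sum_distrib_left by (rule sum.cong) (simp_all add: summand)
  finally have 1: "base_deriv (flatform q) r (map horiz axes4 @ map vert [y]) =
      \<i> * (\<Sum>i<4. frechet_derivative (\<lambda>r. ?F r * of_real (cof y i r)) (at r) (axes4 ! i))" .
  \<comment> \<open>The five arguments are images under \<open>I0\<close> of four vertical vectors
    \<rho> x and one horizontal vector; the minus sign compensates the one in
    \<open>I0_horiz\<close>.\<close>
  have L: "map horiz axes4 @ map vert [y] = map (I0 r) (map ?\<phi> axes4 @ [horiz (- ?w)])"
  proof -
    have "\<rho> q r *v (- ?w) = - y" using \<rho>_inverse[OF r, of y]
      by (simp add: linear_neg[OF matrix_vector_mul_linear])
    then show ?thesis using I0_vert[OF r] I0_horiz[OF r, of "- ?w"] by simp
  qed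
  have vv: "map ?\<phi> axes4 = map vert (map (\<lambda>x. \<rho> q r *v x) axes4)" by simp
  have "base_deriv (flatform q) r (map horiz axes4 @ map vert [y]) =
      \<i> * base_deriv (flatform q) r (map vert (map (\<lambda>x. \<rho> q r *v x) axes4) @ [horiz (- ?w)])"
    unfolding L vv[symmetric] by (rule flatform_type[OF r])
  \<comment> \<open>The arguments are constant vectors with \<rho> frozen at r, so the determinant
    comes out undifferentiated and only the derivative of F remains.\<close>
  also have "base_deriv (flatform q) r (map vert (map (\<lambda>x. \<rho> q r *v x) axes4) @ [horiz (- ?w)]) =
      frechet_derivative (\<lambda>z. flatform q z (map vert (map (\<lambda>x. \<rho> q r *v x) axes4))) (at r) (- ?w)"
    by (subst base_deriv_vert_horiz[OF dif]) (simp add: length_axes4)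
  also have "\<dots> = of_real (det (\<rho> q r)) * frechet_derivative ?F (at r) (- ?w)"
  proof -
    have "((\<lambda>z. of_real (det (\<rho> q r)) * ?F z) has_derivative (\<lambda>v. of_real (det (\<rho> q r)) * frechet_derivative ?F (at r) v)) (at r)"
      by (intro has_derivative_mult_right) (use fcoef_warped_differentiable[OF r] in \<open>simp add: frechet_derivative_works\<close>)
    then have "((\<lambda>z. flatform q z (map vert (map (\<lambda>x. \<rho> q r *v x) axes4))) has_derivative
        (\<lambda>v. of_real (det (\<rho> q r)) * frechet_derivative ?F (at r) v)) (at r)"
      by (rule has_derivative_transform_within_open[OF _ open_tc_dom[OF q] r])
        (use flatform_det in \<open>simp add: o_def\<close>)
    from frechet_derivative_at[OF this, symmetric] show ?thesis by simp
  qed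
  also have "frechet_derivative ?F (at r) (- ?w) = - (\<Sum>i<4. of_real (?w \<bullet> axes4 ! i) * frechet_derivative ?F (at r) (axes4 ! i))"
  proof -
    have "?w = (\<Sum>b\<in>set axes4. (?w \<bullet> b) *\<^sub>R b)" by (simp add: set_axes4 euclidean_representation)
    also have "\<dots> = (\<Sum>i<4. (?w \<bullet> axes4 ! i) *\<^sub>R axes4 ! i)"
      using sum_list_distinct_conv_sum_set[OF distinct_axes4, of "\<lambda>b. (?w \<bullet> b) *\<^sub>R b"]
      by (simp add: sum_list_sum_nth length_axes4 atLeast0LessThan)
    finally have w: "?w = (\<Sum>i<4. (?w \<bullet> axes4 ! i) *\<^sub>R axes4 ! i)" .
    have "frechet_derivative ?F (at r) ?w = (\<Sum>i<4. (?w \<bullet> axes4 ! i) *\<^sub>R frechet_derivative ?F (at r) (axes4 ! i))"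
      by (subst w) (simp only: linear_sum[OF linF] linear_scale[OF linF])
    then show ?thesis by (simp only: linear_neg[OF linF] scaleR_conv_of_real)
  qed
  finally have "\<i> * (\<Sum>i<4. frechet_derivative (\<lambda>r. ?F r * of_real (cof y i r)) (at r) (axes4 ! i)) =
      \<i> * - (\<Sum>i<4. of_real (cof y i r) * frechet_derivative ?F (at r) (axes4 ! i))"
    unfolding 1 cof_def by (simp add: sum_distrib_left mult.assoc)
  then show ?thesis by (simp only: mult_cancel_left complex_i_not_zero simp_thms)
qed

text \<open>Since s^3 = |F|^2, the factor s^3 / F in front of the (3,1)-part of \<Omega>_A equals
  conj F. In this form s is gone and the coefficients are |F|^2 C up to constants.\<close>

definition closed31 :: "real^4 \<Rightarrow> model form" where
  "closed31 r vs = cnj (fcoef_warped q r) * split_part Ph Qv 3 (flatform q r) vs"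

lemma closed31_differentiable: "r \<in> tc_dom q \<Longrightarrow> (\<lambda>r. closed31 r vs) differentiable at r"
proof -
  assume r: "r \<in> tc_dom q"
  have "((\<lambda>z. cnj (fcoef_warped q z)) has_derivative (\<lambda>v. cnj (frechet_derivative (fcoef_warped q) (at r) v))) (at r)"
    by (intro has_derivative_cnj) (use fcoef_warped_differentiable[OF r] in \<open>simp add: frechet_derivative_works\<close>)
  then have "(\<lambda>z. cnj (fcoef_warped q z)) differentiable at r" unfolding differentiable_def by blast
  then show ?thesis
    unfolding closed31_def split_part_def
    by (intro differentiable_mult differentiable_sum flatform_differentiable r) 
       (auto intro: flatform_differentiable[OF r] finite_subset[of _ "Pow {..<length vs}"])
qed

lemma alternating_closed31: "r \<in> tc_dom q \<Longrightarrow> alternating (closed31 r)"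
  unfolding closed31_def[abs_def]
  by (intro alternating_scale alternating_split_part alternating_flatform linear_Ph linear_Qv)

lemma closed31_degree: "r \<in> tc_dom q \<Longrightarrow> length vs \<noteq> 4 \<Longrightarrow> closed31 r vs = 0"
  by (simp add: closed31_def split_part_def flatform_degree)

lemma closed31_mixed:
  "r \<in> tc_dom q \<Longrightarrow> closed31 r (map horiz xs @ map vert ys) =
    (if length xs = 3 then cnj (fcoef_warped q r) * flatform q r (map horiz xs @ map vert ys) else 0)"
  by (simp add: closed31_def split_part_mixed[OF alternating_multilinear[OF alternating_flatform]])

lemma frechet_derivative_zero:
  assumes "open D" "r \<in> D" "\<And>z. z \<in> D \<Longrightarrow> g z = 0"
  shows "frechet_derivative g (at r) v = 0"
proof -
  have "(g has_derivative (\<lambda>v. 0)) (at r)"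
    by (rule has_derivative_transform_within_open[OF has_derivative_const assms(1,2)]) (simp add: assms(3))
  from frechet_derivative_at[OF this, symmetric] show ?thesis by simp
qed

text \<open>A five-form is tested on sublists of the basis. Differentiation uses up one horizontal
  argument and \<open>closed31\<close> needs three others, so only the four horizontal axes with one
  vertical vector matter; there the value is \<i> times the divergence treated in
  \<open>divergence_conj\<close>.\<close>

lemma base_deriv_closed31:
  assumes r: "r \<in> tc_dom q" shows "base_deriv closed31 r vs = 0"
proof (cases "length vs = 5")
  case False
  have "frechet_derivative (\<lambda>r. closed31 r (omit i vs)) (at r) v = 0" if "i < length vs" for i v
    by (rule frechet_derivative_zero[OF open_tc_dom[OF q] r], rule closed31_degree)
      (use False that in \<open>auto simp: length_omit\<close>)
  then show ?thesis by (simp add: base_deriv_def)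
next
  case True
  let ?bs = "map horiz axes4 @ map vert axes4"
  note op = open_tc_dom[OF q] and dif = closed31_differentiable[OF r]
  have mixed: "base_deriv closed31 r (map horiz xs @ map vert ys) = 0"
    if xs: "xs = filter P axes4" and len: "length xs + length ys = 5" for P xs ys
  proof (cases "length xs = 4")
    case False
    have "frechet_derivative (\<lambda>r. closed31 r (map horiz (omit i xs) @ map vert ys)) (at r) v = 0" if "i < length xs" for i v
      by (rule frechet_derivative_zero[OF op r]) (use False that in \<open>auto simp: closed31_mixed length_omit\<close>)
    then show ?thesis by (simp add: base_deriv_mixed[OF dif])
  next
    case True
    then have xs4: "xs = axes4" using filter_full[of P axes4] xs by (simp add: length_axes4)
    obtain y where y: "ys = [y]" using True len by (cases ys) auto
    have "base_deriv closed31 r (map horiz xs @ map vert ys) =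
        (\<Sum>i<4. (-1) ^ i * frechet_derivative (\<lambda>r. closed31 r (map horiz (omit i axes4) @ map vert [y])) (at r) (axes4 ! i))"
      by (simp only: xs4 y base_deriv_mixed[OF dif] length_axes4)
    also have "\<dots> = (\<Sum>i<4. \<i> * frechet_derivative (\<lambda>z. cnj (fcoef_warped q z) * (fcoef_warped q z * of_real (cof y i z))) (at r) (axes4 ! i))"
    proof (rule sum.cong[OF refl])
      fix i :: nat assume "i \<in> {..<4}"
      then have i: "i < 4" by simp
      let ?g = "\<lambda>z. cnj (fcoef_warped q z) * (fcoef_warped q z * of_real (cof y i z))"
      have l3: "length (omit i axes4) = 3" using i by (simp add: length_omit length_axes4)
      have gd: "?g differentiable at r"
      proof -
        have "((\<lambda>z. cnj (fcoef_warped q z)) has_derivative (\<lambda>v. cnj (frechet_derivative (fcoef_warped q) (at r) v))) (at r)"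
          by (intro has_derivative_cnj) (use fcoef_warped_differentiable[OF r] in \<open>simp add: frechet_derivative_works\<close>)
        then have "(\<lambda>z. cnj (fcoef_warped q z)) differentiable at r" unfolding differentiable_def by blast
        then show ?thesis by (intro differentiable_mult cof_differentiable r i)
      qed
      have "((\<lambda>z. (-1) ^ i * (\<i> * ?g z)) has_derivative (\<lambda>v. (-1) ^ i * (\<i> * frechet_derivative ?g (at r) v))) (at r)"
        by (intro has_derivative_mult_right) (use gd in \<open>simp add: frechet_derivative_works\<close>)
      then have "((\<lambda>r. closed31 r (map horiz (omit i axes4) @ map vert [y])) has_derivative
          (\<lambda>v. (-1) ^ i * (\<i> * frechet_derivative ?g (at r) v))) (at r)"
      proof (rule has_derivative_transform_within_open[OF _ op r])
        fix z assume z: "z \<in> tc_dom q"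
        show "(-1) ^ i * (\<i> * ?g z) = closed31 z (map horiz (omit i axes4) @ map vert [y])"
          unfolding closed31_mixed[OF z] using flatform_cof[OF z i, of y] l3 by simp
      qed
      from frechet_derivative_at[OF this, symmetric]
      show "(-1) ^ i * frechet_derivative (\<lambda>r. closed31 r (map horiz (omit i axes4) @ map vert [y])) (at r) (axes4 ! i) =
          \<i> * frechet_derivative ?g (at r) (axes4 ! i)"
        by (simp add: power_mult_distrib[symmetric] mult.assoc[symmetric])
    qed
    also have "\<dots> = \<i> * (\<Sum>i<4. frechet_derivative (\<lambda>z. cnj (fcoef_warped q z) * (fcoef_warped q z * of_real (cof y i z))) (at r) (axes4 ! i))"
      by (simp only: sum_distrib_left)
    also have "\<dots> = 0"
      using divergence_conj[OF op r fcoef_warped_differentiable[OF r], of "{..<4}" "cof y" "\<lambda>i. axes4 ! i"]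
        cof_differentiable[OF r] cofactor_divergence[OF r, of y] by simp
    finally show ?thesis .
  qed
  show ?thesis
  proof (rule alternating_zero_on_basis[where bs = ?bs and n = 5])
    show "alternating (base_deriv closed31 r)"
      by (rule alternating_base_deriv[OF op r alternating_closed31 dif])
    show "distinct ?bs"
      using distinct_axes4 by (auto simp: distinct_map inj_on_def axes4_def axis_eq_0_iff)
    have "set ?bs = Basis" by (auto simp: Basis_prod_def set_axes4)
    then show "span (set ?bs) = UNIV" by simp
    fix P assume "length (filter P ?bs) = 5"
    then show "base_deriv closed31 r (filter P ?bs) = 0"
      using mixed[of "filter (P \<circ> horiz) axes4" "P \<circ> horiz" "filter (P \<circ> vert) axes4"]
      by (simp add: filter_map)
  qed (rule True)
qed

end

end

section \<open>The LTY 2A system\<close>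

lemma split_part_scale: "split_part P Q m (\<lambda>vs. k * \<omega> vs) vs = k * split_part P Q m \<omega> vs"
  by (simp add: split_part_def sum_distrib_left)

context susy_bundle
begin

text \<open>The positive cube root of |f|^2 e^(-2A), written as the exponential of a logarithm so
  that smoothness is immediate.\<close>

definition sfac :: "'m \<Rightarrow> real" where
  "sfac m = exp ((ln ((cmod (fcoef m))\<^sup>2) - 2 * A m) / 3)"

lemma sfac_pos: "sfac m > 0"
  by (simp add: sfac_def)

lemma sfac_cube: "sfac m ^ 3 = (cmod (fcoef m))\<^sup>2 * exp (- 2 * A m)"
proof -
  have "sfac m ^ 3 = exp (ln ((cmod (fcoef m))\<^sup>2) - 2 * A m)"
    unfolding sfac_def by (subst exp_of_nat_mult[symmetric]) simp
  also have "\<dots> = (cmod (fcoef m))\<^sup>2 * exp (- 2 * A m)"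
    using fcoef_nonzero[of m] by (simp add: exp_diff exp_minus divide_inverse)
  finally show ?thesis .
qed

lemma smooth_sfac: "smooth_fun \<A> sfac"
proof (rule smooth_funI_tc)
  fix q \<theta> assume q: "q \<in> \<P>"
  let ?U = "fst (tc_chart q \<theta>)"
  note op = open_tc_chart[OF q, of \<theta>]
  have f: "smooth_on ?U (\<lambda>z. fcoef (tc_map q z))" and A: "smooth_on ?U (\<lambda>z. A (tc_map q z))"
    using smooth_funD[OF smooth_fcoef tc_chart_in[OF q], of \<theta>] smooth_funD[OF smooth_A tc_chart_in[OF q], of \<theta>] by simp_all
  have "smooth_on ?U (\<lambda>z. ln (fcoef (tc_map q z) \<bullet> fcoef (tc_map q z)))"
    by (rule smooth_on_compose[OF op _ smooth_on_ln smooth_on_inner[OF op f f]]) (auto simp: fcoef_nonzero)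
  then have "smooth_on ?U (\<lambda>z. (1 / 3) * (ln (fcoef (tc_map q z) \<bullet> fcoef (tc_map q z)) + (- 2) * A (tc_map q z)))"
    by (intro smooth_on_mult[OF op] smooth_on_add[OF op] smooth_on_const A)
  then have "smooth_on ?U (\<lambda>z. exp ((1 / 3) * (ln (fcoef (tc_map q z) \<bullet> fcoef (tc_map q z)) + (- 2) * A (tc_map q z))))"
    by (rule smooth_on_compose[OF op open_UNIV smooth_on_exp]) simp
  then show "smooth_on ?U (\<lambda>z. sfac (tc_map q z))"
    by (simp add: sfac_def power2_norm_eq_inner)
qed

definition closed_part :: "(model, 'm) dform" where
  "closed_part = add_dform (pi_D \<P> a 0 4 (stretched sfac)) (pi_D \<P> a 3 1 (stretched sfac))"

lemma diff_form_closed_part: "diff_form \<A> closed_part"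
  unfolding closed_part_def
  by (intro diff_form_add smooth_\<A> diff_form_pi_D diff_form_stretched smooth_sfac sfac_pos)

context
  fixes q assumes q: "q \<in> \<P>"
begin

lemma warped_eq: "r \<in> tc_dom q \<Longrightarrow> fcoef_warped q r = of_real (exp (- A (tc_map q (r, 0)))) * bform q r (map vert axes4)"
  by (simp add: fcoef_warped_def flatform_def wform_def o_def)

lemma warped_nonzero: "r \<in> tc_dom q \<Longrightarrow> fcoef_warped q r \<noteq> 0"
  using f_at_nonzero[OF q, of "(r, 0)"] by (simp add: warped_eq f_at_def in_coords_bform[OF q])

lemma fcoef_bform: "z \<in> fst (tc_chart q \<theta>) \<Longrightarrow> fcoef (tc_map q z) = bform q (fst z) (map vert axes4)"
  using fcoef_eq[OF coord_tc_chart[OF q, of z \<theta>]] in_coords_bform[OF q, of z] by (simp add: f_at_def fst_tc_chart)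

text \<open>The weight e^-A may be inserted because it cancels between \<open>fcoef_warped\<close>
  and \<open>flatform\<close>; in the flat frame the stretch just multiplies base components by
  s.\<close>

lemma stretched_coords:
  assumes z: "z \<in> fst (tc_chart q \<theta>)"
  shows "stretched sfac (tc_chart q \<theta>) z =
    pull (shear q (fst z)) (\<lambda>ws. 1 / fcoef_warped q (fst z) * pull (scale_horiz (sfac (tc_map q z))) (flatform q (fst z)) ws)"
proof
  fix vs
  let ?r = "fst z" and ?s = "sfac (tc_map q z)" and ?c = "tc_chart q \<theta>"
  have r: "?r \<in> tc_dom q" using z by (simp add: fst_tc_chart)
  have st: "unshear q ?r (scale_horiz ?s (shear q ?r v)) = stretch ?s ?c z v" for v
    by (simp add: stretch_def proj_D_tc_chart[OF q z] hor_def unshear_def shear_def scale_horiz_def prod_eq_iff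
        matrix_vector_mult_scaleR algebra_simps)
  show "stretched sfac ?c z vs = pull (shear q ?r) (\<lambda>ws. 1 / fcoef_warped q ?r * pull (scale_horiz ?s) (flatform q ?r) ws) vs"
    by (simp add: stretched_def pull_def flatform_def wform_def o_def st warped_eq[OF r] fcoef_bform[OF z] \<Omega>_bform[OF q z])
qed

text \<open>s is evaluated on the total space, F at the base point with angle 0; the constancy of A
  on the fibres makes them comparable.\<close>

lemma sfac_warped:
  assumes z: "z \<in> fst (tc_chart q \<theta>)"
  shows "of_real (sfac (tc_map q z)) ^ 3 = fcoef_warped q (fst z) * cnj (fcoef_warped q (fst z))"
proof -
  have r: "fst z \<in> tc_dom q" using z by (simp add: fst_tc_chart)
  have A: "A (tc_map q z) = A (tc_map q (fst z, 0))"
    using A_fibre_invariant[OF q r, of "snd z" 0] by simp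
  have e: "exp (- 2 * x) = exp (- x) * exp (- x)" for x :: real by (simp flip: exp_add)
  have "complex_of_real (sfac (tc_map q z)) ^ 3 = of_real (sfac (tc_map q z) ^ 3)" by simp
  also have "\<dots> = of_real ((cmod (fcoef_warped q (fst z)))\<^sup>2)"
    unfolding sfac_cube warped_eq[OF r] A fcoef_bform[OF z] e
    by (simp add: norm_mult power_mult_distrib power2_eq_square)
  also have "\<dots> = fcoef_warped q (fst z) * cnj (fcoef_warped q (fst z))" by (rule complex_norm_square)
  finally show ?thesis .
qed

text \<open>The first summand is the product of the \<delta>\<theta>, all that is left of the
  (0,4)-part after division by f; its coefficients are constant, so only \<open>closed31\<close>
  contributes to the derivative.\<close>

definition flat_closed :: "real^4 \<Rightarrow> model form" where
  "flat_closed r ws = det_form (map snd ws) + closed31 q r ws"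

lemma closed_part_coords:
  assumes z: "z \<in> fst (tc_chart q \<theta>)"
  shows "closed_part (tc_chart q \<theta>) z vs = flat_closed (fst z) (map (shear q (fst z)) vs)"
proof (cases "length vs = 4")
  case False
  have r: "fst z \<in> tc_dom q" using z by (simp add: fst_tc_chart)
  show ?thesis
    using False closed31_degree[OF q r, of "map (shear q (fst z)) vs"]
    by (simp add: closed_part_def add_dform_def pi_D_split_part flat_closed_def det_form_def)
next
  case True
  let ?r = "fst z" and ?s = "sfac (tc_map q z)" and ?c = "tc_chart q \<theta>"
  let ?ws = "map (shear q ?r) vs" and ?F = "fcoef_warped q ?r"
  have r: "?r \<in> tc_dom q" using z by (simp add: fst_tc_chart)
  have sp: "split_part (hor q z) (\<lambda>v. v - hor q z v) m (stretched sfac ?c z) vs =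
      1 / ?F * (of_real ?s ^ m * split_part Ph Qv m (flatform q ?r) ?ws)" for m
  proof -
    have "shear q ?r (hor q z v) = Ph (shear q ?r v)" "shear q ?r (v - hor q z v) = Qv (shear q ?r v)" for v
      by (simp_all add: shear_def hor_def prod_eq_iff)
    then have "split_part (hor q z) (\<lambda>v. v - hor q z v) m (stretched sfac ?c z) vs =
        split_part Ph Qv m (\<lambda>ws. 1 / ?F * pull (scale_horiz ?s) (flatform q ?r) ws) ?ws"
      unfolding stretched_coords[OF z] by (rule split_part_pull)
    then show ?thesis
      unfolding split_part_scale split_part_scale_horiz[OF alternating_flatform[OF q r]] .
  qed
  have "flatform q ?r (map Qv ?ws) = det_form (map snd ?ws) * ?F"
    using alternating_det_form_eq[OF alternating_flatform[OF q r] linear_vert, of "map snd ?ws"] True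
    by (simp add: fcoef_warped_def o_def)
  then have "1 / ?F * (of_real ?s ^ 0 * split_part Ph Qv 0 (flatform q ?r) ?ws) = det_form (map snd ?ws)"
    using warped_nonzero[OF r] by (simp add: split_part_0)
  moreover have "1 / ?F * (of_real ?s ^ 3 * split_part Ph Qv 3 (flatform q ?r) ?ws) = closed31 q ?r ?ws"
    unfolding sfac_warped[OF z] closed31_def[OF q] using warped_nonzero[OF r] by simp
  ultimately show ?thesis
    using True by (simp only: closed_part_def add_dform_def pi_D_split_part proj_D_tc_chart[OF q z] sp flat_closed_def) simp
qed

lemma closed_part_closed_at:
  assumes u: "fst u \<in> tc_dom q" shows "ext_d closed_part (tc_chart q (snd u)) u vs = 0"
proof -
  let ?c = "tc_chart q (snd u)" and ?r = "fst u"
  note cu = tc_chart_self[OF u]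
  have alt: "alternating (flat_closed r)" if "r \<in> tc_dom q" for r
    using alternating_add[OF alternating_pull[OF linear_snd alternating_det_form] alternating_closed31[OF q that]]
    by (simp add: flat_closed_def[abs_def] pull_def)
  have der: "((\<lambda>r. flat_closed r ws) has_derivative frechet_derivative (\<lambda>r. closed31 q r ws) (at ?r)) (at ?r)" for ws
  proof -
    have "((\<lambda>r. det_form (map snd ws) + closed31 q r ws) has_derivative
        (\<lambda>h. 0 + frechet_derivative (\<lambda>r. closed31 q r ws) (at ?r) h)) (at ?r)"
      by (intro has_derivative_add has_derivative_const)
        (use closed31_differentiable[OF q u] in \<open>simp add: frechet_derivative_works\<close>)
    then show ?thesis by (simp add: flat_closed_def[abs_def])
  qed
  then have dif: "(\<lambda>r. flat_closed r ws) differentiable at ?r" for ws unfolding differentiable_def by blast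
  have "ext_d closed_part ?c u vs = alt_deriv (\<lambda>z vs. flat_closed (fst z) (map (shear q (fst z)) vs)) u vs"
    unfolding ext_d_alt_deriv
    by (rule alt_deriv_cong[OF open_tc_chart[OF q] cu closed_part_coords
          diff_form_differentiable[OF diff_form_closed_part tc_chart_in[OF q] cu]])
  also have "\<dots> = base_deriv (\<lambda>r vs. flat_closed r (map (shear q r) vs)) ?r vs"
    by (rule alt_deriv_base) (rule base_deriv_shear(2)[OF q u alt dif])
  also have "\<dots> = base_deriv flat_closed ?r (map (shear q ?r) vs)"
    by (rule base_deriv_shear(1)[OF q u alt dif])
  also have "\<dots> = base_deriv (closed31 q) ?r (map (shear q ?r) vs)"
    unfolding base_deriv_def frechet_derivative_at[OF der, symmetric] ..
  also have "\<dots> = 0" by (rule base_deriv_closed31[OF q u])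
  finally show ?thesis .
qed

end

lemma closed_closed_part: "closed_dform \<A> closed_part"
proof (rule closed_dformI_local[OF smooth_\<A> diff_form_closed_part])
  fix m
  obtain q u where u: "coord q u m" by (rule coord_exists)
  then have "q \<in> \<P>" "fst u \<in> tc_dom q" "tc_map q u = m" by (simp_all add: coord_def)
  then show "\<exists>c u. c \<in> \<A> \<and> u \<in> fst c \<and> snd c u = m \<and> (\<forall>vs. ext_d closed_part c u vs = 0)"
    using tc_chart_in tc_chart_self[of u q] closed_part_closed_at
    by (intro exI[of _ "tc_chart q (snd u)"] exI[of _ u]) simp
qed

end

theorem theorem5p1:
  fixes \<A> :: "(model, 'm::{t2_space, second_countable_topology}) chart set"
    and \<B> :: "(real^4, 'b::{t2_space, second_countable_topology}) chart set"
    and prj :: "'m \<Rightarrow> 'b"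
    and \<P> :: "('b, 'm) torus_coords set"
    and J \<Omega> H F :: "(model, 'm) dform"
    and A \<phi> vartheta \<alpha> :: "'m \<Rightarrow> real"
    and a \<rho> :: "('b, 'm) torus_coords \<Rightarrow> real^4 \<Rightarrow> real^4^4"
    and dD :: "(model, 'm) dform \<Rightarrow> (model, 'm) dform"
  assumes torus_bdl: "lagrangian_torus_bundle \<A> \<B> prj J"
    and coords: "action_angle_atlas \<A> \<B> prj J \<P>"
    and SU4: "SU_structure \<A> 4 (\<lambda>m. 1) J \<Omega>"
    and semiflat: "semi_flat \<P> J \<Omega>"
    and scalars: "smooth_fun \<A> A" "smooth_fun \<A> \<phi>" "smooth_fun \<A> vartheta"
        "smooth_fun \<A> \<alpha>" "\<forall>m. \<alpha> m > 0"
    and H: "diff_form_deg \<A> 3 H" "everywhere \<A> (\<lambda>c u. real_form (H c u))"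
    and F: "diff_form \<A> F" "everywhere \<A> (\<lambda>c u. real_form (F c u))"
        "everywhere \<A> (\<lambda>c u. \<forall>vs. even (length vs) \<longrightarrow> F c u vs = 0)"
    and susy: "symplectic_susy_system \<A> J \<Omega> A \<phi> vartheta \<alpha> H F"
    and frame: "semi_flat_frame \<P> \<Omega> a \<rho>"
    and flat: "flat_connection \<P> a"
    and dD: "first_order_operator \<A> dD"
  shows "\<exists>JA \<Omega>A KA \<rho>A. LTY_2A_system \<A> \<P> a dD JA \<Omega>A KA \<rho>A"
proof -
  obtain W1 W2 W3 W4 W5 where tors: "torsion_classes \<A> J \<Omega> W1 W2 W3 W4 W5"
    and W: "form_eq \<A> W1 zero_dform" "form_eq \<A> W5 (del \<Omega> A)"
    using susy unfolding symplectic_susy_system_def by blast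
  interpret susy_bundle \<A> \<B> prj \<P> J \<Omega> a \<rho> A W2
  proof unfold_locales
    fix c u assume c: "c \<in> \<A>" "u \<in> fst c"
    show "pq_type (acs 4 (\<Omega> c u)) 2 1 (W2 c u)"
      using tors c unfolding torsion_classes_def everywhere_def Let_def by blast
    fix vs
    have "ext_d \<Omega> c u = (\<lambda>vs. 8 * \<i> / 3 * wedge (W1 c u) (wedge (J c u) (J c u)) vs
        + wedge (W2 c u) (J c u) vs + wedge (conj_form (W5 c u)) (\<Omega> c u) vs)"
      using tors c unfolding torsion_classes_def everywhere_def Let_def by blast
    moreover have "W1 c u = (\<lambda>vs. 0)" "W5 c u = del \<Omega> A c u"
      using W c unfolding form_eq_def everywhere_def by (auto simp: fun_eq_iff zero_dform_def)
    ultimately show "ext_d \<Omega> c u vs = wedge (W2 c u) (J c u) vs + wedge (conj_form (del \<Omega> A c u)) (\<Omega> c u) vs"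
      by (simp add: wedge_zero_left)
  qed (rule torus_bdl coords SU4 semiflat frame flat scalars)+
  \<comment> \<open>The conformal factor produced by \<open>SU_structure_at_rescale\<close> for k =
    1 / f and initial factor 1.\<close>
  let ?K = "\<lambda>m. (cmod (1 / fcoef m))\<^sup>2 * sfac m ^ 4" and ?\<Omega> = "stretched sfac"
  \<comment> \<open>The last equation of the system is a definition, so its right-hand side is the
    witness; what remains is that it is a differential form.\<close>
  let ?\<rho> = "scale_dform (\<lambda>m. - \<i>) (ext_d (dD (scale_dform (\<lambda>m. complex_of_real (?K m))
            (add_dform (pi_D \<P> a 1 3 ?\<Omega>) (pi_D \<P> a 4 0 ?\<Omega>)))))"
  have SU: "SU_structure \<A> 4 ?K J ?\<Omega>"
    by (rule SU_structure_stretched[OF smooth_sfac sfac_pos])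
  have K: "smooth_fun \<A> (\<lambda>m. complex_of_real (?K m))"
  proof (rule smooth_funI_tc)
    fix q \<theta> assume q: "q \<in> \<P>"
    have "smooth_fun \<A> ?K" using SU by (simp add: SU_structure_def)
    from smooth_on_compose_linear[OF open_tc_chart[OF q] bounded_linear_of_real smooth_funD[OF this tc_chart_in[OF q], unfolded snd_tc_chart]]
    show "smooth_on (fst (tc_chart q \<theta>)) (\<lambda>z. complex_of_real (?K (tc_map q z)))" .
  qed
  have const: "smooth_fun \<A> (\<lambda>m. k)" for k :: complex
    by (rule smooth_funI_tc) (rule smooth_on_const)
  have dD_form: "diff_form \<A> (dD \<omega>)" if "diff_form \<A> \<omega>" for \<omega>
    using dD that unfolding first_order_operator_def by blast
  have "diff_form \<A> (dD (scale_dform (\<lambda>m. complex_of_real (?K m)) (add_dform (pi_D \<P> a 1 3 ?\<Omega>) (pi_D \<P> a 4 0 ?\<Omega>))))"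
    by (intro dD_form diff_form_scale[OF smooth_\<A> _ K] diff_form_add[OF smooth_\<A>] diff_form_pi_D
        diff_form_stretched[OF smooth_sfac sfac_pos])
  then have "diff_form \<A> ?\<rho>"
    by (intro diff_form_scale[OF smooth_\<A> _ const] diff_form_ext_d[OF smooth_\<A>])
  moreover have "closed_dform \<A> J"
    using torus_bdl by (simp add: lagrangian_torus_bundle_def symplectic_def)
  moreover have "form_eq \<A> ?\<rho> ?\<rho>" by (simp add: form_eq_def everywhere_def)
  ultimately have "LTY_2A_system \<A> \<P> a dD J ?\<Omega> ?K ?\<rho>"
    using SU closed_closed_part unfolding LTY_2A_system_def closed_part_def by blast
  then show ?thesis by blast
qed


end
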